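(* Let $s\ge 2$. There exists a non-empty open subset $U\subseteq(\mathbb{P}^1\times\mathbb{P}^1)^s$ such that for all $(P_1,\ldots,P_s)\in U$, the points $\{P_1,\ldots,P_s\}$ are in generic position, and $\nu(I(P_1,\ldots,P_s))=v(s;1,1)$.
   Context: $\mathbf{k}$ is an algebraically closed field of characteristic $0$; $\mathbb{N}=\{0,1,2,\ldots\}$; $e_1,e_2$ is the standard basis of $\mathbb{N}^2$; $\mathbb{N}^2$ is partially ordered coordinatewise, and $\min\mathcal{S}$ denotes the set of minimal elements of $\mathcal{S}\subseteq\mathbb{N}^2$. $R=\mathbf{k}[x_{1,0},x_{1,1},x_{2,0},x_{2,1}]$ is $\mathbb{N}^2$-graded by $\deg x_{l,m}=e_l$; it is the coordinate ring of $\mathbb{P}^1\times\mathbb{P}^1$ over $\mathbf{k}$. $N(i_1,i_2)=\dim_{\mathbf{k}}R_{(i_1,i_2)}=(i_1+1)(i_2+1)$. For distinct points $P_1,\ldots,P_s\in\mathbb{P}^1\times\mathbb{P}^1$, $I(P_1,\ldots,P_s)\subseteq R$ is the ideal generated by the $\mathbb{N}^2$-homogeneous forms vanishing at all $P_i$; these points are in generic position if $\dim_{\mathbf{k}}(R/I(P_1,\ldots,P_s))_{\underline{i}}=\min\{N(\underline{i}),s\}$ for all $\underline{i}\in\mathbb{N}^2$ (being in generic position includes being $s$ distinct points). $\nu(I)$ is the minimal number of generators of $I$. $(\mathbb{P}^1\times\mathbb{P}^1)^s$ is the $s$-fold product variety with its Zariski topology. Definition of $v(s;1,1)$: let $\mathcal{D}=\min\{\underline{i}\in\mathbb{N}^2\mid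 N(\underline{i})>s\}$ and $\mathcal{D}+e_l=\{\underline{i}+e_l\mid\underline{i}\in\mathcal{D}\}$; for $\underline{i}\in\mathcal{D}$ let $\mathbb{D}_{\underline{i}}=\{\underline{j}\in\mathbb{N}^2\mid\underline{j}\ge\underline{i}\}\setminus\{\underline{i},\underline{i}+e_1,\underline{i}+e_2\}$; let $\mathbb{D}=\left[(\mathcal{D}+e_1)\cup(\mathcal{D}+e_2)\right]\setminus\bigcup_{\underline{i}\in\mathcal{D}}\mathbb{D}_{\underline{i}}$; for $\underline{j}\in\mathbb{D}$ let $L_{\underline{j}}=\{l\in\{1,2\}\mid\underline{j}\in\mathcal{D}+e_l\}$. Then $$v(s;1,1)=\sum_{\underline{i}\in\mathcal{D}}(N(\underline{i})-s)+\sum_{\underline{j}\in\mathbb{D}}\max\Big\{0,\ N(\underline{j})-s-\sum_{l\in L_{\underline{j}}}2\big(N(\underline{j}-e_l)-s\big)\Big\}.$$ *)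

theory Defs
  imports
    "HOL-Analysis.Analysis"
    "HOL-Library.Poly_Mapping"
    "HOL-Library.Product_Order"
    "HOL-Library.Product_Plus"
    "HOL-Computational_Algebra.Computational_Algebra"
begin

section \<open>Polynomials\<close>

text \<open>Finitely supported functions from monomials (exponent vectors) to coefficients; the ring
  structure is the convolution product of \<^theory>\<open>HOL-Library.Poly_Mapping\<close>.\<close>

type_synonym ('x, 'k) mpoly = "('x \<Rightarrow>\<^sub>0 nat) \<Rightarrow>\<^sub>0 'k"

definition const :: "'k::zero \<Rightarrow> ('x, 'k) mpoly"
  where "const c = Poly_Mapping.single 0 c"

definition eval :: "('x \<Rightarrow> 'k::comm_semiring_1) \<Rightarrow> ('x, 'k) mpoly \<Rightarrow> 'k"
  where "eval a f = (\<Sum>t\<in>Poly_Mapping.keys f. Poly_Mapping.lookup f t *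
                      (\<Prod>x\<in>Poly_Mapping.keys t. a x ^ Poly_Mapping.lookup t x))"

text \<open>A ring viewed as a module over itself: submodules are ideals, spans are generated ideals.\<close>

definition ideal_gen :: "'r::comm_ring_1 set \<Rightarrow> 'r set"
  where "ideal_gen S = module.span (*) S"

definition min_gens :: "'r::comm_ring_1 set \<Rightarrow> nat"
  where "min_gens I = (LEAST n. \<exists>G. finite G \<and> card G = n \<and> ideal_gen G = I)"

section \<open>The bigraded coordinate ring\<close>

text \<open>The constructor \<open>Xlm\<close> stands for the variable $x_{l,m}$.\<close>

datatype var = X10 | X11 | X20 | X21

type_synonym 'k R = "(var, 'k) mpoly"

definition mdeg :: "(var \<Rightarrow>\<^sub>0 nat) \<Rightarrow> nat \<times> nat"
  where "mdeg t = (Poly_Mapping.lookup t X10 + Poly_Mapping.lookup t X11,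
                   Poly_Mapping.lookup t X20 + Poly_Mapping.lookup t X21)"

definition R_comp :: "nat \<times> nat \<Rightarrow> 'k::zero R set"
  where "R_comp i = {f. \<forall>t\<in>Poly_Mapping.keys f. mdeg t = i}"

definition N :: "nat \<times> nat \<Rightarrow> nat"
  where "N i = (fst i + 1) * (snd i + 1)"

text \<open>\<open>has_dim_mod V I n\<close>: the image of the subspace \<open>V\<close> in the quotient by \<open>I\<close> has dimension
  \<open>n\<close>, i.e. it has a basis formed by the residue classes of \<open>n\<close> elements of \<open>V\<close>. (By the
  independence condition, distinct elements of \<open>B\<close> have distinct classes.)\<close>

definition has_dim_mod :: "('x, 'k::field) mpoly set \<Rightarrow> ('x, 'k) mpoly set \<Rightarrow> nat \<Rightarrow> bool"
  where "has_dim_mod V I n \<longleftrightarrow>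
    (\<exists>B. finite B \<and> card B = n \<and> B \<subseteq> V \<and>
         (\<forall>f\<in>V. \<exists>c. f - (\<Sum>b\<in>B. const (c b) * b) \<in> I) \<and>
         (\<forall>c. (\<Sum>b\<in>B. const (c b) * b) \<in> I \<longrightarrow> (\<forall>b\<in>B. c b = 0)))"

section \<open>Points\<close>

definition proj_rel :: "'k::field \<times> 'k \<Rightarrow> 'k \<times> 'k \<Rightarrow> bool"
  where "proj_rel u v \<longleftrightarrow> u \<noteq> (0, 0) \<and> v \<noteq> (0, 0) \<and>
           (\<exists>c. c \<noteq> 0 \<and> fst v = c * fst u \<and> snd v = c * snd u)"

lemma part_equivp_proj_rel: "part_equivp (proj_rel :: 'k::field \<times> 'k \<Rightarrow> _)"
proof (rule part_equivpI)
  have "proj_rel (1, 0) (1 :: 'k, 0)"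
    unfolding proj_rel_def by (auto intro: exI[of _ 1])
  then show "\<exists>u :: 'k \<times> 'k. proj_rel u u" ..
  show "symp (proj_rel :: 'k \<times> 'k \<Rightarrow> _)"
  proof (rule sympI)
    fix u v :: "'k \<times> 'k"
    assume "proj_rel u v"
    then obtain c where "u \<noteq> (0, 0)" "v \<noteq> (0, 0)" "c \<noteq> 0"
      "fst v = c * fst u" "snd v = c * snd u"
      unfolding proj_rel_def by blast
    then show "proj_rel v u"
      unfolding proj_rel_def by (auto intro!: exI[of _ "inverse c"])
  qed
  show "transp (proj_rel :: 'k \<times> 'k \<Rightarrow> _)"
  proof (rule transpI)
    fix u v w :: "'k \<times> 'k"
    assume "proj_rel u v" "proj_rel v w"
    then obtain c d where "u \<noteq> (0, 0)" "w \<noteq> (0, 0)" "c \<noteq> 0" "d \<noteq> 0"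
      "fst v = c * fst u" "snd v = c * snd u" "fst w = d * fst v" "snd w = d * snd v"
      unfolding proj_rel_def by blast
    then show "proj_rel u w"
      unfolding proj_rel_def by (auto intro!: exI[of _ "d * c"])
  qed
qed

quotient_type (overloaded) 'k proj1 = "'k::field \<times> 'k" / partial: proj_rel
  by (rule part_equivp_proj_rel)

type_synonym 'k point = "'k proj1 \<times> 'k proj1"

text \<open>\<open>hcoords a p\<close>: \<open>a\<close> assigns to the four variables a choice of homogeneous coordinates of
  \<open>p\<close>.\<close>

definition hcoords :: "(var \<Rightarrow> 'k::field) \<Rightarrow> 'k point \<Rightarrow> bool"
  where "hcoords a p \<longleftrightarrow>
    (a X10, a X11) \<noteq> (0, 0) \<and> abs_proj1 (a X10, a X11) = fst p \<and>
    (a X20, a X21) \<noteq> (0, 0) \<and> abs_proj1 (a X20, a X21) = snd p"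

definition vanishes_at :: "'k::field R \<Rightarrow> 'k point \<Rightarrow> bool"
  where "vanishes_at f p \<longleftrightarrow> (\<forall>a. hcoords a p \<longrightarrow> eval a f = 0)"

definition vanishing_ideal :: "'k::field point set \<Rightarrow> 'k R set"
  where "vanishing_ideal X =
    ideal_gen {f. (\<exists>i. f \<in> R_comp i) \<and> (\<forall>p\<in>X. vanishes_at f p)}"

definition generic_position :: "nat \<Rightarrow> (nat \<Rightarrow> 'k::field point) \<Rightarrow> bool"
  where "generic_position s P \<longleftrightarrow>
    inj_on P {..<s} \<and>
    (\<forall>i. has_dim_mod (R_comp i) (vanishing_ideal (P ` {..<s})) (min (N i) s))"

section \<open>The Zariski topology on the s-fold product\<close>

definition tuples :: "nat \<Rightarrow> (nat \<Rightarrow> 'k::field point) set"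
  where "tuples s = {..<s} \<rightarrow>\<^sub>E UNIV"

text \<open>Forms on the product of the \<open>2 * s\<close> projective lines: the variables are \<open>(j, x)\<close> with
  \<open>j < s\<close>, and the form is homogeneous in each of the \<open>2 * s\<close> pairs of variables separately.\<close>

definition multiform :: "nat \<Rightarrow> (nat \<times> var, 'k::zero) mpoly \<Rightarrow> bool"
  where "multiform s F \<longleftrightarrow>
    (\<forall>t\<in>Poly_Mapping.keys F. Poly_Mapping.keys t \<subseteq> {..<s} \<times> UNIV) \<and>
    (\<exists>d :: nat \<Rightarrow> nat \<times> nat. \<forall>t\<in>Poly_Mapping.keys F. \<forall>j<s.
       Poly_Mapping.lookup t (j, X10) + Poly_Mapping.lookup t (j, X11) = fst (d j) \<and>
       Poly_Mapping.lookup t (j, X20) + Poly_Mapping.lookup t (j, X21) = snd (d j))"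

definition zero_locus :: "nat \<Rightarrow> (nat \<times> var, 'k::field) mpoly \<Rightarrow> (nat \<Rightarrow> 'k point) set"
  where "zero_locus s F =
    {P \<in> tuples s. \<forall>a. (\<forall>j<s. hcoords (a j) (P j)) \<longrightarrow> eval (\<lambda>(j, x). a j x) F = 0}"

text \<open>The closed sets are the common zero loci of sets of multihomogeneous forms; equivalently, the
  complements of zero loci of single forms, which are closed under binary intersection
  (multiply the forms) and cover the space (take the form 1), are a base of the topology.\<close>

definition zariski :: "nat \<Rightarrow> (nat \<Rightarrow> 'k::field point) topology"
  where "zariski s = topology_generated_by {tuples s - zero_locus s F |F. multiform s F}"

section \<open>The number v(s;1,1)\<close>

definition unit_e :: "nat \<Rightarrow> nat \<times> nat"
  where "unit_e l = (if l = 1 then (1, 0) else (0, 1))"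

text \<open>The order on \<^typ>\<open>nat \<times> nat\<close> is the coordinatewise one of
  \<^theory>\<open>HOL-Library.Product_Order\<close>.\<close>

definition minimal_elements :: "(nat \<times> nat) set \<Rightarrow> (nat \<times> nat) set"
  where "minimal_elements S = {i \<in> S. \<forall>j\<in>S. j \<le> i \<longrightarrow> j = i}"

definition D :: "nat \<Rightarrow> (nat \<times> nat) set"
  where "D s = minimal_elements {i. N i > s}"

definition D_shift :: "nat \<Rightarrow> nat \<Rightarrow> (nat \<times> nat) set"
  where "D_shift s l = (\<lambda>i. i + unit_e l) ` D s"

definition DD_at :: "nat \<times> nat \<Rightarrow> (nat \<times> nat) set"
  where "DD_at i = {j. j \<ge> i} - {i, i + unit_e 1, i + unit_e 2}"

definition DD :: "nat \<Rightarrow> (nat \<times> nat) set"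
  where "DD s = (D_shift s 1 \<union> D_shift s 2) - (\<Union>i\<in>D s. DD_at i)"

definition L :: "nat \<Rightarrow> nat \<times> nat \<Rightarrow> nat set"
  where "L s j = {l \<in> {1, 2}. j \<in> D_shift s l}"

text \<open>For \<open>l \<in> L s j\<close> we have \<open>j \<ge> unit_e l\<close>, so the truncated subtraction \<open>j - unit_e l\<close> is exact.\<close>

definition v11 :: "nat \<Rightarrow> int"
  where "v11 s = (\<Sum>i\<in>D s. int (N i) - int s) +
    (\<Sum>j\<in>DD s. max 0 (int (N j) - int s - (\<Sum>l\<in>L s j. 2 * (int (N (j - unit_e l)) - int s))))"

end

(*
  In an affine chart, forms of bidegree (a,b) are polynomials of degree at most a in x and at most b
  in y. Write d(a,b) = max 0 (N(a,b) - s) for the dimension of I_(a,b) and W_(a,b) for the part of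
  I_(a,b) generated by the components of lower degree. By the graded Nakayama lemma the minimal
  number of generators is the sum of dim I_(a,b) - dim W_(a,b) over all (a,b), and the theorem
  amounts to "maximal rank in every degree":
    dim I_(a,b) - dim W_(a,b) = max 0 (N(a,b) - s - 2 d(a-1,b) - 2 d(a,b-1)).
  The summands I_(a-1,b) + x I_(a-1,b) and I_(a,b-1) + y I_(a,b-1) of W_(a,b) have known dimension
  since I_(a-1,b) and x I_(a-1,b) meet in x I_(a-2,b). Their intersection is governed by the syzygies
  f0 + x f1 + g0 + y g1 = 0 with entries vanishing at the points, and matters only if s = a b + t with
  t <= a, b; it then has to have dimension max 0 (a + b - 1 - 3 t).
  This bound is an open condition on the points, so one set of points for each (a,b) suffices. For a = t
  take general points: then I_(a-1,b) = 0. To pass from (a,b) to (a+1,b), add b points on a line x = xi: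
  the number of independent syzygies grows by at most one, and if it is expected to remain zero, the
  b points can be chosen as the roots of a polynomial of degree b that is not the restriction to the line
  of an element of W_(a,b) (these restrictions form a space of dimension at most b).
*)
theory Submission
  imports Defs "Jordan_Normal_Form.Determinant" "HOL-Library.Function_Algebras"
begin

text \<open>The number a + b - 1 - 3 t is what the dimensions force: for s = a b + t the two
  summands have dimensions at most 2 (a - t) and 2 (b - t), I_(a,b) has dimension a + b + 1 - t, and
  the excess is the unavoidable overlap. Maximal rank means that there are no further syzygies, so
  upper bounds for special points are the goal. The obstacle is the truncation at zero. On the added
  line x = xi the entries g0 and g1 vanish, so f0 = - xi f1 there, and f1 restricts to a multiple of
  the one polynomial whose roots are the b new points; hence at most one syzygy is gained. If a + b
  > 3 t, the bound grows by one as well. If a + b <= 3 t, it has to stay zero, and the new points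
  must exclude the extra syzygy: dividing it by x - xi gives f1 = - (h + g0' + y g1') with h, g0',
  g1' from the old spaces, whose restrictions span at most (a - t) + 2 (b - t) <= b dimensions,
  while the candidates for f1, the polynomials with b distinct roots, span b + 1.\<close>

hide_const (open) Module.smult

section \<open>Finite-dimensional subspaces\<close>

context vector_space
begin

text \<open>The ambient polynomial spaces are infinite-dimensional, and there \<open>dim\<close> is
  0 for any set whose span has no finite basis. Finiteness is therefore tracked set by set;
  otherwise inequalities between dimensions would fail.\<close>

definition fin_dim :: "'b set \<Rightarrow> bool"
  where "fin_dim V \<longleftrightarrow> (\<exists>B. finite B \<and> V \<subseteq> span B)"

lemma fin_dim_subset: "local.fin_dim W \<Longrightarrow> V \<subseteq> W \<Longrightarrow> local.fin_dim V"
  unfolding fin_dim_def by blast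

lemma fin_dim_basis:
  assumes "local.fin_dim V"
  obtains B where "B \<subseteq> V" "independent B" "V \<subseteq> span B" "card B = dim V" "finite B"
proof -
  obtain B where B: "B \<subseteq> V" "independent B" "V \<subseteq> span B" "card B = dim V"
    using basis_exists by blast
  obtain T where "finite T" "V \<subseteq> span T"
    using assms unfolding fin_dim_def by blast
  then have "finite B"
    using independent_span_bound[of T B] B by blast
  then show ?thesis using B that by blast
qed

lemma card_le_dim:
  assumes "local.fin_dim V" "B \<subseteq> span V" "independent B"
  shows "finite B" "card B \<le> dim V"
proof -
  obtain C where C: "C \<subseteq> V" "independent C" "V \<subseteq> span C" "card C = dim V" "finite C"
    using fin_dim_basis[OF assms(1)] .
  have "B \<subseteq> span C"
    using assms(2) C(3) by (meson span_minimal subspace_span subset_trans)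
  then show "finite B" "card B \<le> dim V"
    using independent_span_bound[OF C(5) assms(3)] C(4) by auto
qed

lemma dim_mono_fin_dim:
  assumes "local.fin_dim W" "V \<subseteq> W"
  shows "dim V \<le> dim W"
proof -
  obtain B where B: "B \<subseteq> V" "independent B" "V \<subseteq> span B" "card B = dim V"
    using basis_exists by blast
  have "B \<subseteq> span W"
    using subset_trans[OF subset_trans[OF B(1) assms(2)] span_superset] .
  then show ?thesis using card_le_dim[OF assms(1) _ B(2)] B(4) by simp
qed

lemma fin_dimI: "finite B \<Longrightarrow> V \<subseteq> span B \<Longrightarrow> local.fin_dim V"
  unfolding fin_dim_def by blast

lemma sum_scale_eq_zeroD:
  assumes "independent B" "finite B" "(\<Sum>b\<in>B. scale (c b) b) = 0" "b \<in> B"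
  shows "c b = 0"
  using assms unfolding independent_explicit_module by blast

text \<open>A basis of V/W without forming the quotient: extend a basis of W to one of V and keep
  the new members. The last two facts have the shape of \<open>has_dim_mod\<close>, and they also
  describe the new generators in each bidegree.\<close>

lemma complement_basis:
  assumes "local.fin_dim V" "subspace V" "subspace W" "W \<subseteq> V"
  obtains C where "finite C" "card C = dim V - dim W" "dim W \<le> dim V" "C \<subseteq> V"
    "\<forall>v\<in>V. \<exists>c. v - (\<Sum>b\<in>C. scale (c b) b) \<in> W"
    "\<forall>c. (\<Sum>b\<in>C. scale (c b) b) \<in> W \<longrightarrow> (\<forall>b\<in>C. c b = 0)"
proof -
  obtain B where B: "B \<subseteq> W" "independent B" "W \<subseteq> span B" "card B = dim W" "finite B"
    using fin_dim_basis[OF fin_dim_subset[OF assms(1,4)]] .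
  obtain A where A: "B \<subseteq> A" "A \<subseteq> V" "independent A" "V \<subseteq> span A"
    using maximal_independent_subset_extend[of B V] B assms(4) by blast
  have "finite A" using card_le_dim[OF assms(1) _ A(3)] A(2) span_superset by blast
  have cA: "card A = dim V"
    using basis_card_eq_dim[OF A(2,4,3)] .
  have spB: "span B = W"
    using B(1,3) assms(3) by (simp add: span_minimal subset_antisym)
  define C where "C = A - B"
  have fin: "finite C" "C \<subseteq> V" "card C = dim V - dim W" "dim W \<le> dim V"
    using \<open>finite A\<close> A(1,2) cA B(4,5) card_mono[OF \<open>finite A\<close> A(1)]
      card_Diff_subset[OF B(5) A(1)] unfolding C_def by auto
  show ?thesis
  proof (rule that[OF fin(1,3,4,2)]; intro ballI allI impI)
    fix v assume "v \<in> V"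
    then have "v \<in> span A" using A(4) by blast
    then obtain u where u: "v = (\<Sum>a\<in>A. scale (u a) a)"
      using span_finite[OF \<open>finite A\<close>] by auto
    have "v = (\<Sum>a\<in>C. scale (u a) a) + (\<Sum>a\<in>B. scale (u a) a)"
      unfolding u C_def using sum.subset_diff[OF A(1) \<open>finite A\<close>] by simp
    then have "v - (\<Sum>b\<in>C. scale (u b) b) = (\<Sum>a\<in>B. scale (u a) a)" by simp
    also have "\<dots> \<in> W"
      unfolding spB[symmetric] by (intro span_sum span_scale span_base)
    finally show "\<exists>c. v - (\<Sum>b\<in>C. scale (c b) b) \<in> W" by blast
  next
    fix c b assume "(\<Sum>b\<in>C. scale (c b) b) \<in> W" and bC: "b \<in> C"
    from this(1) have "(\<Sum>b\<in>C. scale (c b) b) \<in> span B" by (simp add: spB)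
    then obtain u where u: "(\<Sum>b\<in>C. scale (c b) b) = (\<Sum>b\<in>B. scale (u b) b)"
      using span_finite[OF B(5)] by auto
    define w where "w b = (if b \<in> B then - u b else c b)" for b
    have "(\<Sum>b\<in>A. scale (w b) b) = (\<Sum>a\<in>C. scale (w a) a) + (\<Sum>a\<in>B. scale (w a) a)"
      unfolding C_def using sum.subset_diff[OF A(1) \<open>finite A\<close>] by simp
    also have "(\<Sum>a\<in>C. scale (w a) a) = (\<Sum>a\<in>C. scale (c a) a)"
      by (intro sum.cong) (auto simp: w_def C_def)
    also have "(\<Sum>a\<in>B. scale (w a) a) = - (\<Sum>a\<in>B. scale (u a) a)"
      unfolding sum_negf[symmetric] by (intro sum.cong) (auto simp: w_def)
    finally have "(\<Sum>b\<in>A. scale (w b) b) = 0" using u by simp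
    then have "\<forall>b\<in>A. w b = 0"
      using sum_scale_eq_zeroD[OF A(3) \<open>finite A\<close>] by blast
    then show "c b = 0"
      using bC unfolding w_def C_def by force
  qed
qed

lemma fin_dim_zero: "local.fin_dim {0}"
  unfolding fin_dim_def by (intro exI[of _ "{}"]) auto

lemma dim_zero: "dim {0} = 0"
  using dim_le_card[of "{0}" "{}"] by simp

lemma dim_eq_0D:
  assumes "local.fin_dim V" "dim V = 0"
  shows "V \<subseteq> {0}"
proof -
  obtain B where B: "B \<subseteq> V" "independent B" "V \<subseteq> span B" "card B = dim V" "finite B"
    using fin_dim_basis[OF assms(1)] .
  then have "B = {}" using assms(2) by simp
  then show ?thesis using B(3) by simp
qed

definition set_sum :: "'b set \<Rightarrow> 'b set \<Rightarrow> 'b set"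
  where "set_sum S T = {x + y |x y. x \<in> S \<and> y \<in> T}"

lemma subspace_set_sum: "subspace S \<Longrightarrow> subspace T \<Longrightarrow> subspace (local.set_sum S T)"
  unfolding set_sum_def by (rule subspace_sums)

lemma fin_dim_set_sum:
  assumes "local.fin_dim S" "local.fin_dim T" shows "local.fin_dim (local.set_sum S T)"
proof -
  obtain A B where "finite A" "S \<subseteq> span A" "finite B" "T \<subseteq> span B"
    using assms unfolding fin_dim_def by blast
  then have "finite (A \<union> B)" "local.set_sum S T \<subseteq> span (A \<union> B)"
    using span_mono[of A "A \<union> B"] span_mono[of B "A \<union> B"]
    unfolding set_sum_def by (auto intro!: span_add)
  then show ?thesis by (rule fin_dimI)
qed

lemma dim_set_sum_le:
  assumes "local.fin_dim S" "local.fin_dim T" shows "dim (local.set_sum S T) \<le> dim S + dim T"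
proof -
  obtain A where A: "S \<subseteq> span A" "card A = dim S" "finite A"
    using fin_dim_basis[OF assms(1)] by metis
  obtain B where B: "T \<subseteq> span B" "card B = dim T" "finite B"
    using fin_dim_basis[OF assms(2)] by metis
  have "local.set_sum S T \<subseteq> span (A \<union> B)"
    using A(1) B(1) span_mono[of A "A \<union> B"] span_mono[of B "A \<union> B"]
    unfolding set_sum_def by (auto intro!: span_add)
  then have "dim (local.set_sum S T) \<le> card (A \<union> B)"
    using A B by (intro dim_le_card) auto
  also have "\<dots> \<le> card A + card B" by (rule card_Un_le)
  finally show ?thesis using A B by simp
qed

end

section \<open>Linear maps on finite-dimensional sets inside possibly infinite-dimensional
  spaces\<close>

context vector_space_pair
begin

lemma fin_dim_image:
  assumes "Vector_Spaces.linear s1 s2 f" "vs1.fin_dim V"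
  shows "vs2.fin_dim (f ` V)"
proof -
  obtain B where B: "finite B" "V \<subseteq> vs1.span B" using assms(2) unfolding vs1.fin_dim_def by blast
  have "f ` V \<subseteq> vs2.span (f ` B)"
    using B(2) linear_span_image[OF assms(1), of B] by blast
  then show ?thesis using B(1) by (intro vs2.fin_dimI) auto
qed

lemma dim_image_le_fin_dim:
  assumes "Vector_Spaces.linear s1 s2 f" "vs1.fin_dim V"
  shows "vs2.dim (f ` V) \<le> vs1.dim V"
proof -
  obtain B where B: "finite B" "V \<subseteq> vs1.span B" "card B = vs1.dim V"
    using vs1.fin_dim_basis[OF assms(2)] by metis
  have "f ` V \<subseteq> vs2.span (f ` B)"
    using B(2) linear_span_image[OF assms(1), of B] by blast
  then have "vs2.dim (f ` V) \<le> card (f ` B)" using B(1) by (intro vs2.dim_le_card) auto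
  also have "\<dots> \<le> card B" using B(1) by (rule card_image_le)
  finally show ?thesis using B(3) by simp
qed

text \<open>Finiteness of V is a conclusion here: preimages of a basis of the image together with a
  basis of the kernel span V. This makes \<open>PP\<close> and \<open>HH\<close> finite-dimensional
  by induction.\<close>

lemma fin_dim_rank_nullity:
  assumes f: "Vector_Spaces.linear s1 s2 f" and "vs1.subspace V"
    and im: "vs2.fin_dim (f ` V)" and ker: "vs1.fin_dim {v \<in> V. f v = 0}"
  shows "vs1.fin_dim V" "vs1.dim V = vs2.dim (f ` V) + vs1.dim {v \<in> V. f v = 0}"
proof -
  interpret lf: Vector_Spaces.linear s1 s2 f by (rule f)
  let ?K = "{v \<in> V. f v = 0}"
  obtain B where B: "B \<subseteq> f ` V" "vs2.independent B" "f ` V \<subseteq> vs2.span B" "card B = vs2.dim (f ` V)"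
      "finite B"
    using vs2.fin_dim_basis[OF im] .
  obtain A where A: "A \<subseteq> ?K" "vs1.independent A" "?K \<subseteq> vs1.span A" "card A = vs1.dim ?K" "finite A"
    using vs1.fin_dim_basis[OF ker] .
  define g where "g b = (SOME v. v \<in> V \<and> f v = b)" for b
  have g: "g b \<in> V" "f (g b) = b" if "b \<in> B" for b
    using someI_ex[of "\<lambda>v. v \<in> V \<and> f v = b"] B(1) that unfolding g_def by auto
  have injg: "inj_on g B" by (metis g(2) inj_onI)
  have sumg: "(\<Sum>b\<in>B. u b *a g b) \<in> V" for u
    using g assms(2) by (intro vs1.subspace_sum vs1.subspace_scale) auto
  have spn: "V \<subseteq> vs1.span (g ` B \<union> A)"
  proof
    fix v assume v: "v \<in> V"
    then have "f v \<in> vs2.span B" using B by blast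
    then obtain u where u: "f v = (\<Sum>b\<in>B. u b *b b)"
      using vs2.span_finite[OF B(5)] by auto
    let ?w = "\<Sum>b\<in>B. u b *a g b"
    have "f ?w = f v"
      unfolding u lf.sum lf.scale by (intro sum.cong) (auto simp: g)
    then have "v - ?w \<in> ?K"
      using v sumg assms(2) by (auto simp: lf.diff vs1.subspace_diff)
    then have "v - ?w \<in> vs1.span (g ` B \<union> A)"
      using A(3) vs1.span_mono[of A "g ` B \<union> A"] by blast
    moreover have "?w \<in> vs1.span (g ` B \<union> A)"
      by (intro vs1.span_sum vs1.span_scale vs1.span_base) auto
    ultimately have "(v - ?w) + ?w \<in> vs1.span (g ` B \<union> A)" by (rule vs1.span_add)
    then show "v \<in> vs1.span (g ` B \<union> A)" by simp
  qed
  have fin: "finite (g ` B \<union> A)" using A(5) B(5) by simp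
  show finV: "vs1.fin_dim V" using spn fin by (rule vs1.fin_dimI[rotated])
  have disj: "g ` B \<inter> A = {}"
  proof -
    have False if "b \<in> B" "g b \<in> A" for b
    proof -
      have "b = 0" using that A(1) g(2)[of b] by auto
      then show False using vs2.dependent_zero B(2) that(1) by blast
    qed
    then show ?thesis by blast
  qed
  have "vs1.independent (g ` B \<union> A)"
  proof (rule vs1.independent_if_scalars_zero[OF fin])
    fix c x assume c: "(\<Sum>x\<in>g ` B \<union> A. c x *a x) = 0" and x: "x \<in> g ` B \<union> A"
    have split: "(\<Sum>b\<in>B. c (g b) *a g b) + (\<Sum>x\<in>A. c x *a x) = 0"
      using c disj A(5) B(5) injg by (simp add: sum.union_disjoint sum.reindex o_def)
    have "f (\<Sum>x\<in>A. c x *a x) = 0"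
      unfolding lf.sum lf.scale using A(1) by (intro sum.neutral) auto
    then have "0 = f (\<Sum>b\<in>B. c (g b) *a g b)"
      using arg_cong[OF split, of f] by (simp add: lf.add)
    also have "\<dots> = (\<Sum>b\<in>B. c (g b) *b b)"
      unfolding lf.sum lf.scale by (intro sum.cong) (auto simp: g)
    finally have z: "\<forall>b\<in>B. c (g b) = 0"
      using vs2.sum_scale_eq_zeroD[OF B(2,5)] by metis
    then have "(\<Sum>x\<in>A. c x *a x) = 0" using split by simp
    then have "\<forall>x\<in>A. c x = 0"
      using vs1.sum_scale_eq_zeroD[OF A(2,5)] by metis
    then show "c x = 0" using z x by blast
  qed
  then have "card (g ` B \<union> A) = vs1.dim V"
    using spn g A(1) by (intro vs1.basis_card_eq_dim) auto
  then show "vs1.dim V = vs2.dim (f ` V) + vs1.dim ?K"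
    using disj A B injg by (simp add: card_Un_disjoint card_image)
qed

text \<open>The form used for counting, where image and kernel are known only up to inclusion in
  spaces of bounded dimension.\<close>

lemma dim_le_image_ker:
  assumes "Vector_Spaces.linear s1 s2 f" "vs1.subspace V" "vs2.fin_dim W" "f ` V \<subseteq> W" "vs1.fin_dim K"
    "{v \<in> V. f v = 0} \<subseteq> K"
  shows "vs1.fin_dim V" "vs1.dim V \<le> vs2.dim W + vs1.dim K"
proof -
  have im: "vs2.fin_dim (f ` V)" and ker: "vs1.fin_dim {v \<in> V. f v = 0}"
    using assms vs1.fin_dim_subset vs2.fin_dim_subset by blast+
  note rn = fin_dim_rank_nullity[OF assms(1,2) im ker]
  show "vs1.fin_dim V" by (rule rn(1))
  show "vs1.dim V \<le> vs2.dim W + vs1.dim K"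
    using rn(2) vs1.dim_mono_fin_dim[OF assms(5,6)] vs2.dim_mono_fin_dim[OF assms(3,4)] by simp
qed

lemma dim_image_inj_fin_dim:
  assumes "Vector_Spaces.linear s1 s2 f" "vs1.subspace V" "vs1.fin_dim V" "\<And>v. v \<in> V \<Longrightarrow> f v = 0 \<Longrightarrow> v = 0"
  shows "vs2.dim (f ` V) = vs1.dim V"
proof -
  have "{v \<in> V. f v = 0} = {0}"
    using assms(4) linear_0[OF assms(1)] vs1.subspace_0[OF assms(2)] by blast
  then show ?thesis
    using fin_dim_rank_nullity(2)[OF assms(1,2) fin_dim_image[OF assms(1,3)]] vs1.fin_dim_zero vs1.dim_zero
    by simp
qed

end

section \<open>Sums, intersections and independence modulo a subspace\<close>

context vector_space
begin

text \<open>A basis of S and a basis of T modulo the intersection are disjoint and together form a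
  basis of the sum.\<close>

lemma dim_set_sum_Int_fin_dim:
  assumes "subspace S" "subspace T" "local.fin_dim S" "local.fin_dim T"
  shows "dim (local.set_sum S T) + dim (S \<inter> T) = dim S + dim T"
proof -
  obtain B where B: "B \<subseteq> S \<inter> T" "independent B" "S \<inter> T \<subseteq> span B" "card B = dim (S \<inter> T)" "finite B"
    using fin_dim_basis[OF fin_dim_subset[OF assms(3) Int_lower1[of S T]]] .
  obtain C where C: "finite C" "card C = dim T - dim (S \<inter> T)" "dim (S \<inter> T) \<le> dim T" "C \<subseteq> T"
      "\<forall>v\<in>T. \<exists>c. v - (\<Sum>b\<in>C. scale (c b) b) \<in> S \<inter> T"
      "\<forall>c. (\<Sum>b\<in>C. scale (c b) b) \<in> S \<inter> T \<longrightarrow> (\<forall>b\<in>C. c b = 0)"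
    using complement_basis[OF assms(4,2) subspace_inter[OF assms(1,2)] Int_lower2] .
  obtain A where A: "A \<subseteq> S" "independent A" "S \<subseteq> span A" "card A = dim S" "finite A"
    using fin_dim_basis[OF assms(3)] .
  have spA: "span A \<subseteq> S" using A(1) assms(1) span_minimal by blast
  have disj: "A \<inter> C = {}"
  proof -
    have False if "x \<in> A" "x \<in> C" for x
    proof -
      have "(\<Sum>b\<in>C. scale (if b = x then 1 else 0) b) = (\<Sum>b\<in>C. if b = x then b else 0)"
        by (intro sum.cong) auto
      also have "\<dots> = x" using that C(1) by (simp add: sum.delta)
      finally have "(\<Sum>b\<in>C. scale (if b = x then 1 else 0) b) \<in> S \<inter> T"
        using that A C(4) by auto
      then have "(1 :: 'a) = 0" using C(6)[rule_format, OF _ that(2), of "\<lambda>b. if b = x then 1 else 0"] by simp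
      then show False by simp
    qed
    then show ?thesis by blast
  qed
  have sub: "A \<union> C \<subseteq> local.set_sum S T"
  proof
    fix x assume "x \<in> A \<union> C"
    then consider "x \<in> S" | "x \<in> T" using A C(4) by auto
    then show "x \<in> local.set_sum S T"
    proof cases
      case 1
      then have "x + 0 \<in> local.set_sum S T" unfolding set_sum_def
        using subspace_0[OF assms(2)] by blast
      then show ?thesis by simp
    next
      case 2
      then have "0 + x \<in> local.set_sum S T" unfolding set_sum_def
        using subspace_0[OF assms(1)] by blast
      then show ?thesis by simp
    qed
  qed
  have spn: "local.set_sum S T \<subseteq> span (A \<union> C)"
  proof
    fix z assume "z \<in> local.set_sum S T"
    then obtain x y where z: "z = x + y" "x \<in> S" "y \<in> T" unfolding set_sum_def by blast
    obtain c where c: "y - (\<Sum>b\<in>C. scale (c b) b) \<in> S" using C(5) z(3) by blast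
    have m: "S \<subseteq> span (A \<union> C)" using A(3) span_mono[of A "A \<union> C"] by blast
    have "(\<Sum>b\<in>C. scale (c b) b) \<in> span (A \<union> C)"
      by (intro span_sum span_scale span_base) auto
    then have "x + ((y - (\<Sum>b\<in>C. scale (c b) b)) + (\<Sum>b\<in>C. scale (c b) b)) \<in> span (A \<union> C)"
      using m c z by (intro span_add) auto
    then show "z \<in> span (A \<union> C)" by (simp add: z)
  qed
  have "independent (A \<union> C)"
  proof (rule independent_if_scalars_zero)
    show "finite (A \<union> C)" using A C by simp
    fix c x assume c: "(\<Sum>x\<in>A \<union> C. scale (c x) x) = 0" and x: "x \<in> A \<union> C"
    have split: "(\<Sum>x\<in>A. scale (c x) x) + (\<Sum>x\<in>C. scale (c x) x) = 0"
      using c disj A C by (simp add: sum.union_disjoint)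
    have "(\<Sum>x\<in>A. scale (c x) x) \<in> S"
      using A assms(1) by (intro subspace_sum subspace_scale) auto
    moreover have "(\<Sum>x\<in>C. scale (c x) x) = - (\<Sum>x\<in>A. scale (c x) x)"
      using split by (metis add.commute add_eq_0_iff)
    moreover have "(\<Sum>x\<in>C. scale (c x) x) \<in> T"
      using C assms(2) by (intro subspace_sum subspace_scale) auto
    ultimately have "(\<Sum>x\<in>C. scale (c x) x) \<in> S \<inter> T"
      using subspace_neg[OF assms(1)] by auto
    then have z: "\<forall>b\<in>C. c b = 0" using C(6) by blast
    then have "(\<Sum>x\<in>A. scale (c x) x) = 0" using split by simp
    then have "\<forall>x\<in>A. c x = 0" using sum_scale_eq_zeroD[OF A(2,5)] by metis
    then show "c x = 0" using z x by blast
  qed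
  then have "card (A \<union> C) = dim (local.set_sum S T)"
    using sub spn by (intro basis_card_eq_dim)
  then show ?thesis using A C disj by (simp add: card_Un_disjoint)
qed

text \<open>The lower bound in the Nakayama argument: replacing each b by a congruent
  \<open>h b\<close> in the span of G preserves independence, since a relation among the
  \<open>h b\<close> is a relation among the b modulo W.\<close>

lemma card_le_mod_span:
  assumes "subspace W" "finite B" "finite G"
    and "\<And>b. b \<in> B \<Longrightarrow> \<exists>g\<in>span G. b - g \<in> W"
    and "\<And>c. (\<Sum>b\<in>B. scale (c b) b) \<in> W \<Longrightarrow> (\<forall>b\<in>B. c b = 0)"
  shows "card B \<le> card G"
proof -
  obtain h where h: "\<And>b. b \<in> B \<Longrightarrow> h b \<in> span G" "\<And>b. b \<in> B \<Longrightarrow> b - h b \<in> W"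
    using assms(4) by metis
  have ind: "\<forall>b\<in>B. c b = 0" if "(\<Sum>b\<in>B. scale (c b) (h b)) = 0" for c
  proof -
    have "(\<Sum>b\<in>B. scale (c b) (b - h b)) \<in> W"
      using h assms(1) by (intro subspace_sum subspace_scale) auto
    also have "(\<Sum>b\<in>B. scale (c b) (b - h b)) = (\<Sum>b\<in>B. scale (c b) b)"
      using that by (simp add: scale_right_diff_distrib sum_subtractf)
    finally show ?thesis by (rule assms(5))
  qed
  have inj: "inj_on h B"
  proof (rule inj_onI, rule ccontr)
    fix a b assume ab: "a \<in> B" "b \<in> B" "h a = h b" "a \<noteq> b"
    \<comment> \<open>Equal images would give the relation with coefficients 1 and -1, so passing to
      the image set loses no element.\<close>
    define c where "c x = (if x = a then 1 else if x = b then - 1 else 0 :: 'a)" for x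
    have "(\<Sum>x\<in>B. scale (c x) (h x)) = (\<Sum>x\<in>{a,b}. scale (c x) (h x))"
      using ab assms(2) by (intro sum.mono_neutral_right) (auto simp: c_def)
    also have "\<dots> = 0" using ab by (simp add: c_def)
    finally have "c a = 0" using ind ab(1) by blast
    then show False by (simp add: c_def)
  qed
  have "independent (h ` B)"
  proof (rule independent_if_scalars_zero)
    show "finite (h ` B)" using assms(2) by simp
    fix c x assume "(\<Sum>x\<in>h ` B. scale (c x) x) = 0" "x \<in> h ` B"
    then show "c x = 0" using ind[of "\<lambda>b. c (h b)"] by (auto simp: sum.reindex[OF inj])
  qed
  moreover have "h ` B \<subseteq> span G" using h by blast
  ultimately have "card (h ` B) \<le> card G"
    using independent_span_bound[OF assms(3)] by blast
  then show ?thesis by (simp add: card_image[OF inj])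
qed

end

context vector_space
begin

lemma vector_space_field: "vector_space ((*) :: 'a \<Rightarrow> 'a \<Rightarrow> 'a)"
  by unfold_locales (auto simp: algebra_simps)

lemma linear_functionalI:
  assumes "\<And>v w. f (v + w) = f v + f w" "\<And>c v. f (scale c v) = c * f v"
  shows "Vector_Spaces.linear scale (*) f"
  using assms vector_space_field vector_space_axioms by (auto simp: Vector_Spaces.linear_iff)

text \<open>The image of a functional lies in a line. With evaluation at a point as functional, this
  is the unit step in counting the conditions that points impose.\<close>

lemma dim_functional_kernel:
  assumes f: "Vector_Spaces.linear scale (*) f" and V: "local.fin_dim V" "subspace V"
  shows "dim V \<le> Suc (dim {v \<in> V. f v = 0})"
    and "v \<in> V \<Longrightarrow> f v \<noteq> 0 \<Longrightarrow> dim V = Suc (dim {v \<in> V. f v = 0})"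
proof -
  interpret pr: vector_space_pair scale "(*) :: 'a \<Rightarrow> 'a \<Rightarrow> 'a"
    using vector_space_field by unfold_locales
  have fdk: "vector_space_over_itself.fin_dim X" for X :: "'a set"
    by (rule vector_space_over_itself.fin_dimI[of "{1}"])
      (auto simp: vector_space_over_itself.span_singleton)
  have ker: "local.fin_dim {v \<in> V. f v = 0}"
    by (rule fin_dim_subset[OF V(1)]) auto
  note rn = pr.fin_dim_rank_nullity(2)[OF f V(2) fdk ker]
  have le1: "vector_space_over_itself.dim (f ` V) \<le> 1"
    using vector_space_over_itself.dim_subset_UNIV[of "f ` V"]
    by (simp add: vector_space_over_itself.dimension_def)
  then show "dim V \<le> Suc (dim {v \<in> V. f v = 0})" using rn le1 by simp
  show "dim V = Suc (dim {v \<in> V. f v = 0})" if v: "v \<in> V" "f v \<noteq> 0"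
  proof -
    have "\<not> f ` V \<subseteq> {0}" using v by blast
    then have "vector_space_over_itself.dim (f ` V) \<noteq> 0" using vector_space_over_itself.dim_eq_0D[OF fdk] by blast
    then show ?thesis using rn le1 by linarith
  qed
qed

end

section \<open>Bivariate polynomials of bounded bidegree\<close>

type_synonym 'k poly2 = "'k poly poly"
type_synonym 'k tuple = "nat \<Rightarrow> 'k poly poly"

definition ev :: "'k::field \<times> 'k \<Rightarrow> 'k poly2 \<Rightarrow> 'k"
  where "ev z p = poly (poly p [:fst z:]) (snd z)"

lemma ev_simps [simp]:
  "ev z 0 = 0" "ev z 1 = 1" "ev z (p + q) = ev z p + ev z q" "ev z (p - q) = ev z p - ev z q"
  "ev z (- p) = - ev z p" "ev z (p * q) = ev z p * ev z q" "ev z (smult [:c:] p) = c * ev z p"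
  by (auto simp: ev_def)

lemma ev_prod: "ev z (prod f A) = (\<Prod>x\<in>A. ev z (f x))"
  by (simp add: ev_def poly_prod)

text \<open>On \<open>poly2\<close> the operation \<open>smult\<close> takes scalars from k[y];
  composing it with constant polynomials makes k[x,y], and below the tuples over it, vector spaces
  over k.\<close>

interpretation pp: vector_space "\<lambda>(c::'k::field) (p::'k poly2). smult [:c:] p"
  by unfold_locales (auto simp: smult_add_right smult_add_left[symmetric] one_pCons[symmetric] mult.commute)

interpretation up: vector_space "smult :: 'k::field \<Rightarrow> 'k poly \<Rightarrow> 'k poly"
  by unfold_locales (auto simp: smult_add_right smult_add_left)

interpretation tup: vector_space "\<lambda>(c::'k::field) (v::'k tuple) i. smult [:c:] (v i)"
  by unfold_locales (auto simp: fun_eq_iff mult.commute smult_add_right smult_add_left[symmetric] one_pCons[symmetric] mult.commute)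

interpretation pp_pp: vector_space_pair "\<lambda>(c::'k::field) (p::'k poly2). smult [:c:] p"
  "\<lambda>(c::'k::field) (p::'k poly2). smult [:c:] p" by unfold_locales

interpretation pp_up: vector_space_pair "\<lambda>(c::'k::field) (p::'k poly2). smult [:c:] p"
  "smult :: 'k \<Rightarrow> 'k poly \<Rightarrow> 'k poly" by unfold_locales

interpretation tup_up: vector_space_pair "\<lambda>(c::'k::field) (v::'k tuple) i. smult [:c:] (v i)"
  "smult :: 'k \<Rightarrow> 'k poly \<Rightarrow> 'k poly" by unfold_locales

interpretation tup_pp: vector_space_pair "\<lambda>(c::'k::field) (v::'k tuple) i. smult [:c:] (v i)"
  "\<lambda>(c::'k::field) (p::'k poly2). smult [:c:] p" by unfold_locales

interpretation tup_tup: vector_space_pair "\<lambda>(c::'k::field) (v::'k tuple) i. smult [:c:] (v i)"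
  "\<lambda>(c::'k::field) (v::'k tuple) i. smult [:c:] (v i)" by unfold_locales

text \<open>The bounds \<open>A\<close> and \<open>B\<close> are strict, so that \<open>PP A B\<close> is the chart version of the forms of bidegree
  \<open>(A - 1, B - 1)\<close> and \<open>PP 0 B\<close> is the zero space. The outer variable is \<open>x\<close>, the inner one \<open>y\<close>.\<close>

definition UP :: "nat \<Rightarrow> 'k::field poly set"
  where "UP B = {q. \<forall>j. coeff q j \<noteq> 0 \<longrightarrow> j < B}"

definition PP :: "nat \<Rightarrow> nat \<Rightarrow> 'k::field poly2 set"
  where "PP A B = {p. \<forall>i j. coeff (coeff p i) j \<noteq> 0 \<longrightarrow> i < A \<and> j < B}"

definition II :: "nat \<Rightarrow> nat \<Rightarrow> ('k::field \<times> 'k) set \<Rightarrow> 'k poly2 set"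
  where "II A B Z = {p \<in> PP A B. \<forall>z\<in>Z. ev z p = 0}"

lemma subspace_UP: "up.subspace (UP B)"
  by (rule up.subspaceI) (auto simp: UP_def, metis add.right_neutral)

lemma subspace_PP: "pp.subspace (PP A B)"
  by (rule pp.subspaceI) (auto simp: PP_def, (metis add.right_neutral)+)

lemma subspace_II: "pp.subspace (II A B Z)"
  using subspace_PP[of A B, unfolded pp.subspace_def]
  by (intro pp.subspaceI) (auto simp: II_def)

lemma UP_0: "UP 0 = {0}"
  by (auto simp: UP_def poly_eq_iff)

lemma PP_0: "PP 0 B = {0}" "PP A 0 = {0}"
  by (auto simp: PP_def poly_eq_iff)

lemma linear_coeff: "Vector_Spaces.linear smult (*) (\<lambda>q. coeff q n :: 'k::field)"
  by (rule up.linear_functionalI) auto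

lemma UP_Suc_kernel: "{q \<in> UP (Suc n). coeff q n = 0} = UP n"
  by (auto simp: UP_def less_Suc_eq)

lemma fin_dim_UP: "up.fin_dim (UP n :: 'k::field poly set)"
proof (rule up.fin_dimI)
  show "finite ((\<lambda>i. monom (1::'k) i) ` {..<n})" by simp
  show "(UP n :: 'k poly set) \<subseteq> up.span ((\<lambda>i. monom 1 i) ` {..<n})"
  proof
    fix q :: "'k poly" assume q: "q \<in> UP n"
    have "q = (\<Sum>i\<le>degree q. monom (coeff q i) i)" by (rule poly_as_sum_of_monoms[symmetric])
    also have "\<dots> = (\<Sum>i\<le>degree q. smult (coeff q i) (monom 1 i))"
      by (simp add: smult_monom)
    also have "\<dots> \<in> up.span ((\<lambda>i. monom 1 i) ` {..<n})"
    proof (rule up.span_sum)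
      fix i
      show "smult (coeff q i) (monom 1 i) \<in> up.span ((\<lambda>i. monom 1 i) ` {..<n})"
      proof (cases "coeff q i = 0")
        case False
        then have "i < n" using q by (auto simp: UP_def)
        then show ?thesis by (intro up.span_scale up.span_base) auto
      qed (simp add: up.span_zero)
    qed
    finally show "q \<in> up.span ((\<lambda>i. monom 1 i) ` {..<n})" .
  qed
qed

lemma dim_UP: "up.dim (UP n :: 'k::field poly set) = n"
proof (induction n)
  case 0
  then show ?case by (simp add: UP_0 up.dim_zero)
next
  case (Suc n)
  have "(monom 1 n :: 'k poly) \<in> UP (Suc n)" by (auto simp: UP_def split: if_splits)
  then have "up.dim (UP (Suc n) :: 'k poly set) = Suc (up.dim {q \<in> UP (Suc n) :: 'k poly set. coeff q n = 0})"
    by (intro up.dim_functional_kernel(2)[OF linear_coeff fin_dim_UP subspace_UP]) auto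
  then show ?case by (simp add: Suc UP_Suc_kernel)
qed

lemma linear_coeff_pp: "Vector_Spaces.linear (\<lambda>(c::'k::field) p. smult [:c:] p) smult (\<lambda>p. coeff p n)"
  using pp.vector_space_axioms up.vector_space_axioms
  by (auto simp: Vector_Spaces.linear_iff)

lemma PP_Suc_kernel: "{p \<in> PP (Suc A) B. coeff p A = 0} = (PP A B :: 'k::field poly2 set)"
proof (rule Set.set_eqI)
  fix p :: "'k poly2"
  have "i \<noteq> A" if "coeff p A = 0" "coeff (coeff p i) j \<noteq> 0" for i j
    using that by auto
  moreover have "coeff p A = 0" if "\<forall>i j. coeff (coeff p i) j \<noteq> 0 \<longrightarrow> i < A \<and> j < B"
    using that by (metis coeff_0 less_irrefl poly_eq_iff)
  ultimately show "p \<in> {p \<in> PP (Suc A) B. coeff p A = 0} \<longleftrightarrow> p \<in> PP A B"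
    unfolding PP_def less_Suc_eq by blast
qed

lemma coeff_image_PP: "(\<lambda>p. coeff p A) ` PP (Suc A) B = (UP B :: 'k::field poly set)"
proof (rule subset_antisym)
  show "(\<lambda>p. coeff p A) ` PP (Suc A) B \<subseteq> (UP B :: 'k poly set)" by (auto simp: PP_def UP_def)
  show "(UP B :: 'k poly set) \<subseteq> (\<lambda>p. coeff p A) ` PP (Suc A) B"
  proof
    fix q :: "'k poly" assume "q \<in> UP B"
    then have "monom q A \<in> PP (Suc A) B" by (auto simp: PP_def UP_def split: if_splits)
    then show "q \<in> (\<lambda>p. coeff p A) ` PP (Suc A) B" by (intro image_eqI[of _ _ "monom q A"]) auto
  qed
qed

text \<open>The coefficient of x^A maps onto the polynomials in y of degree below B with kernel
  \<open>PP A B\<close>, so each step adds B.\<close>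

lemma dim_PP:
  shows "pp.fin_dim (PP A B :: 'k::field poly2 set)" "pp.dim (PP A B :: 'k poly2 set) = A * B"
proof (induction A)
  case 0
  show "pp.fin_dim (PP 0 B :: 'k poly2 set)" "pp.dim (PP 0 B :: 'k poly2 set) = 0 * B"
    by (simp_all add: PP_0 pp.dim_zero pp.fin_dim_zero)
next
  case (Suc A)
  have im: "up.fin_dim ((\<lambda>p. coeff p A) ` PP (Suc A) B :: 'k poly set)"
    by (simp add: coeff_image_PP fin_dim_UP)
  have ker: "pp.fin_dim {p \<in> PP (Suc A) B :: 'k poly2 set. coeff p A = 0}"
    by (simp add: PP_Suc_kernel Suc)
  note rn = pp_up.fin_dim_rank_nullity[OF linear_coeff_pp subspace_PP im ker]
  show "pp.fin_dim (PP (Suc A) B :: 'k poly2 set)" by (rule rn(1))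
  show "pp.dim (PP (Suc A) B :: 'k poly2 set) = Suc A * B"
    using rn(2) by (simp add: PP_Suc_kernel Suc coeff_image_PP dim_UP)
qed

lemma fin_dim_II: "pp.fin_dim (II A B Z)"
  by (rule pp.fin_dim_subset[OF dim_PP(1)]) (auto simp: II_def)

lemma linear_ev: "Vector_Spaces.linear (\<lambda>(c::'k::field) p. smult [:c:] p) (*) (ev z)"
  by (rule pp.linear_functionalI) auto

lemma II_insert: "II A B (insert z Z) = {p \<in> II A B Z. ev z p = 0}"
  by (auto simp: II_def)

lemma II_empty: "II A B {} = PP A B"
  by (auto simp: II_def)

lemma dim_II_ge:
  assumes "finite Z"
  shows "A * B \<le> pp.dim (II A B Z) + card Z"
  using assms
proof (induction Z)
  case empty
  then show ?case by (simp add: II_empty dim_PP)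
next
  case (insert z Z)
  have "pp.dim (II A B Z) \<le> Suc (pp.dim (II A B (insert z Z)))"
    unfolding II_insert by (rule pp.dim_functional_kernel(1)[OF linear_ev fin_dim_II subspace_II])
  then show ?case using insert by simp
qed

lemma dim_II_insert:
  assumes "p \<in> II A B Z" "ev z p \<noteq> 0"
  shows "pp.dim (II A B Z) = Suc (pp.dim (II A B (insert z Z)))"
  unfolding II_insert using assms
  by (rule pp.dim_functional_kernel(2)[OF linear_ev fin_dim_II subspace_II])

lemma exists_ev_nonzero:
  fixes q :: "'k::field_char_0 poly2"
  assumes "q \<noteq> 0"
  obtains z where "ev z q \<noteq> 0"
proof -
  \<comment> \<open>These x are the constant roots of q as a polynomial over the domain
    k[y].\<close>
  have "finite {x. poly q [:x:] = 0}"
  proof (rule finite_subset)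
    show "{x. poly q [:x:] = 0} \<subseteq> (\<lambda>r. coeff r 0) ` {r. poly q r = 0}"
      by (force intro: image_eqI[of _ _ "[:_:]"])
    show "finite ((\<lambda>r. coeff r 0) ` {r. poly q r = 0})"
      using poly_roots_finite[OF assms] by simp
  qed
  then obtain x where "poly q [:x:] \<noteq> 0"
    using ex_new_if_finite[OF infinite_UNIV_char_0] by blast
  then obtain y where "poly (poly q [:x:]) y \<noteq> 0"
    using ex_new_if_finite[OF infinite_UNIV_char_0 poly_roots_finite] by blast
  then show ?thesis using that[of "(x, y)"] by (simp add: ev_def)
qed

text \<open>Greedy choice: pick a nonzero polynomial from each of the finitely many nonzero spaces
  and place the next point off all their zero sets; each of these spaces then loses exactly one
  dimension.\<close>

lemma exists_general_points:
  fixes \<Delta> :: "(nat \<times> nat) set"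
  assumes "finite \<Delta>"
  shows "\<exists>Z :: ('k::field_char_0 \<times> 'k) set. finite Z \<and> card Z = n \<and>
    (\<forall>(A, B)\<in>\<Delta>. pp.dim (II A B Z) \<le> A * B - n)"
proof (induction n)
  case 0
  show ?case by (intro exI[of _ "{}"]) (auto simp: II_empty dim_PP)
next
  case (Suc n)
  then obtain Z :: "('k \<times> 'k) set" where Z: "finite Z" "card Z = n"
      "\<And>A B. (A, B) \<in> \<Delta> \<Longrightarrow> pp.dim (II A B Z) \<le> A * B - n" by fast
  \<comment> \<open>The value 1 stands in for spaces that are already zero and keeps the product
    nonzero.\<close>
  define g where "g \<delta> = (if II (fst \<delta>) (snd \<delta>) Z \<subseteq> {0} then 1
    else SOME p. p \<in> II (fst \<delta>) (snd \<delta>) Z \<and> p \<noteq> 0)" for \<delta>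
  have g: "g \<delta> \<noteq> 0" "\<not> II (fst \<delta>) (snd \<delta>) Z \<subseteq> {0} \<Longrightarrow> g \<delta> \<in> II (fst \<delta>) (snd \<delta>) Z" for \<delta>
    using someI_ex[of "\<lambda>p. p \<in> II (fst \<delta>) (snd \<delta>) Z \<and> p \<noteq> 0"] by (auto simp: g_def)
  \<comment> \<open>The linear factors force a first coordinate that does not occur in Z, so the
    point is new.\<close>
  define q where "q = (\<Prod>\<delta>\<in>\<Delta>. g \<delta>) * (\<Prod>z\<in>Z. [:[:- fst z:], 1:])"
  have "q \<noteq> 0" using g Z(1) assms by (auto simp: q_def)
  then obtain z where "ev z q \<noteq> 0" by (rule exists_ev_nonzero)
  then have nz: "ev z (g \<delta>) \<noteq> 0" if "\<delta> \<in> \<Delta>" for \<delta>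
    using that assms by (auto simp: q_def ev_prod)
  have "z \<notin> Z"
  proof
    assume "z \<in> Z"
    then have "(\<Prod>w\<in>Z. ev z [:[:- fst w:], 1:]) = 0"
      using Z(1) by (auto simp: ev_def intro!: prod_zero bexI[of _ z])
    then show False using \<open>ev z q \<noteq> 0\<close> by (simp add: q_def ev_prod)
  qed
  show ?case
  proof (intro exI[of _ "insert z Z"] conjI ballI, goal_cases)
    case (3 \<delta>)
    obtain A B where \<delta>: "\<delta> = (A, B)" by force
    have "pp.dim (II A B (insert z Z)) \<le> A * B - Suc n"
    proof (cases "II A B Z \<subseteq> {0}")
      case True
      then have "II A B (insert z Z) \<subseteq> {0}" by (auto simp: II_insert)
      then have "pp.dim (II A B (insert z Z)) \<le> pp.dim {0 :: 'k poly2}"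
        by (intro pp.dim_mono_fin_dim pp.fin_dim_zero)
      then show ?thesis by (simp add: pp.dim_zero)
    next
      case False
      then have "pp.dim (II A B Z) = Suc (pp.dim (II A B (insert z Z)))"
        using g(2)[of \<delta>] nz[of \<delta>] 3 \<delta> by (intro dim_II_insert[of "g \<delta>"]) auto
      then show ?thesis using Z(3) 3 \<delta> by fastforce
    qed
    then show ?case by (simp add: \<delta>)
  qed (use Z \<open>z \<notin> Z\<close> in auto)
qed

section \<open>Restriction to vertical lines\<close>

definition res :: "'k::field \<Rightarrow> 'k poly2 \<Rightarrow> 'k poly"
  where "res \<xi> p = poly p [:\<xi>:]"

definition vline :: "'k::field \<Rightarrow> 'k poly2"
  where "vline \<xi> = [:[:- \<xi>:], 1:]"

lemma res_simps [simp]: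
  "res \<xi> 0 = 0" "res \<xi> (p + q) = res \<xi> p + res \<xi> q" "res \<xi> (p - q) = res \<xi> p - res \<xi> q"
  "res \<xi> (- p) = - res \<xi> p" "res \<xi> (p * q) = res \<xi> p * res \<xi> q" "res \<xi> (smult [:c:] p) = smult c (res \<xi> p)"
  "res \<xi> (vline \<xi>) = 0"
  by (auto simp: res_def vline_def)

lemma ev_res: "ev (\<xi>, y) p = poly (res \<xi> p) y"
  by (simp add: ev_def res_def)

lemma ev_vline [simp]: "ev z (vline \<xi>) = fst z - \<xi>"
  by (simp add: ev_def vline_def)

lemma vline_nonzero [simp]: "vline \<xi> \<noteq> 0"
  by (simp add: vline_def)

lemma linear_res: "Vector_Spaces.linear (\<lambda>(c::'k::field) p. smult [:c:] p) smult (res \<xi>)"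
  using pp.vector_space_axioms up.vector_space_axioms
  by (auto simp: Vector_Spaces.linear_iff)

lemma linear_mult_pp: "Vector_Spaces.linear (\<lambda>(c::'k::field) p. smult [:c:] p) (\<lambda>c p. smult [:c:] p) (\<lambda>p. q * p)"
  using pp.vector_space_axioms
  by (auto simp: Vector_Spaces.linear_iff algebra_simps)

lemma res_in_UP:
  assumes "p \<in> PP A B"
  shows "res \<xi> p \<in> UP B"
proof -
  have "coeff (res \<xi> p) j = 0" if "\<not> j < B" for j
  proof -
    have "coeff (res \<xi> p) j = (\<Sum>i\<le>degree p. coeff (coeff p i * [:\<xi>:] ^ i) j)"
      by (simp add: res_def poly_altdef coeff_sum)
    also have "\<dots> = 0"
      using assms that by (intro sum.neutral) (auto simp: PP_def poly_const_pow)
    finally show ?thesis .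
  qed
  then show ?thesis by (auto simp: UP_def)
qed

text \<open>Division by x - \<xi> must also preserve the bound in y, which the degree in x does not
  control.\<close>

lemma divide_vline:
  assumes p: "p \<in> PP A B" and "res \<xi> p = 0"
  obtains h where "h \<in> PP (A - 1) B" "p = vline \<xi> * h"
proof -
  have "[:- [:\<xi>:], 1:] dvd p"
    using assms(2) by (simp add: res_def poly_eq_0_iff_dvd)
  then obtain h where h: "p = vline \<xi> * h"
    by (auto simp: vline_def elim: dvdE)
  have c: "coeff p (Suc i) = coeff h i - smult \<xi> (coeff h (Suc i))" for i
    by (simp add: h vline_def)
  have "coeff (coeff h i) j = 0" if bad: "\<not> (i < A - 1 \<and> j < B)" for i j
  proof -
    \<comment> \<open>Outside the claimed range the coefficients of p vanish, so those of h satisfy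
      h_i = \<xi> h_(i+1); iterating past the degree of h gives 0.\<close>
    have "coeff (coeff h i) j = \<xi> ^ n * coeff (coeff h (i + n)) j" for n
    proof (induction n)
      case (Suc n)
      have "coeff (coeff p (Suc (i + n))) j = 0"
      proof (rule ccontr)
        assume "coeff (coeff p (Suc (i + n))) j \<noteq> 0"
        then have "Suc (i + n) < A \<and> j < B" using p by (auto simp: PP_def)
        then show False using bad by auto
      qed
      then have "coeff (coeff h (i + n)) j = \<xi> * coeff (coeff h (Suc (i + n))) j"
        using arg_cong[OF c[of "i + n"], of "\<lambda>q. coeff q j"] by simp
      then show ?case using Suc by simp
    qed simp
    from this[of "Suc (degree h)"] show ?thesis
      by (simp add: coeff_eq_0)
  qed
  then have "h \<in> PP (A - 1) B" by (auto simp: PP_def)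
  then show ?thesis using h that by blast
qed

text \<open>Points off the line are not zeros of x - \<xi>, so the quotient still vanishes at them:
  this leads from the enlarged point set back to the old one.\<close>

lemma divide_vline_II:
  assumes "p \<in> II A B Z'" "Z \<subseteq> Z'" "\<And>z. z \<in> Z \<Longrightarrow> fst z \<noteq> \<xi>" "res \<xi> p = 0"
  shows "p \<in> (*) (vline \<xi>) ` II (A - 1) B Z"
proof -
  have "p \<in> PP A B" using assms(1) by (simp add: II_def)
  then obtain h where h: "h \<in> PP (A - 1) B" "p = vline \<xi> * h"
    using divide_vline assms(4) by blast
  have "ev z h = 0" if "z \<in> Z" for z
  proof -
    have "ev z p = 0" using assms(1,2) that by (auto simp: II_def)
    then show ?thesis using assms(3)[OF that] by (simp add: h(2))
  qed
  then show ?thesis using h by (auto simp: II_def)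
qed

lemma UP_roots_eq_0:
  assumes "q \<in> UP n" "finite E" "n \<le> card E" "\<And>y. y \<in> E \<Longrightarrow> poly q y = 0"
  shows "q = 0"
proof (rule ccontr)
  assume "q \<noteq> 0"
  then have "card E \<le> card {y. poly q y = 0}"
    using assms by (intro card_mono poly_roots_finite) auto
  also have "\<dots> \<le> degree q" using \<open>q \<noteq> 0\<close> by (rule card_poly_roots_bound)
  also have "\<dots> < n" using assms(1) \<open>q \<noteq> 0\<close> by (auto simp: UP_def)
  finally show False using assms(3) by simp
qed

section \<open>Polynomials in one variable with prescribed roots\<close>

definition root_poly :: "'k::field set \<Rightarrow> 'k poly"
  where "root_poly E = (\<Prod>\<eta>\<in>E. [:- \<eta>, 1:])"

lemma root_poly:
  assumes "finite E"
  shows "degree (root_poly E) = card E" "coeff (root_poly E) (card E) = 1"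
    "root_poly E \<in> UP (Suc (card E))"
proof -
  show d: "degree (root_poly E) = card E"
    unfolding root_poly_def by (subst degree_prod_eq_sum_degree) auto
  have "lead_coeff (root_poly E) = 1"
    unfolding root_poly_def by (subst lead_coeff_prod) (simp add: prod.neutral)
  then show "coeff (root_poly E) (card E) = 1" using d by simp
  show "root_poly E \<in> UP (Suc (card E))"
    using d le_degree[of "root_poly E"] by (simp add: UP_def less_Suc_eq_le)
qed

text \<open>Subtracting the multiple of \<open>root_poly E\<close> with the same top coefficient
  leaves a polynomial of degree below the number of its roots.\<close>

lemma UP_with_roots:
  assumes "q \<in> UP (Suc (card E))" "finite E" "\<And>y. y \<in> E \<Longrightarrow> poly q y = 0"
  shows "q = smult (coeff q (card E)) (root_poly E)"
proof -
  let ?r = "q - smult (coeff q (card E)) (root_poly E)"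
  have "smult (coeff q (card E)) (root_poly E) \<in> UP (Suc (card E))"
    using subspace_UP root_poly(3)[OF assms(2)] up.subspace_scale by blast
  then have "?r \<in> UP (Suc (card E))"
    using subspace_UP assms(1) up.subspace_diff by blast
  moreover have "coeff ?r (card E) = 0" by (simp add: root_poly(2)[OF assms(2)])
  ultimately have "?r \<in> UP (card E)" using UP_Suc_kernel by blast
  moreover have "poly ?r y = 0" if "y \<in> E" for y
    using that assms by (auto simp: root_poly_def poly_prod intro!: prod_zero)
  ultimately have "?r = 0" using UP_roots_eq_0[OF _ assms(2) order_refl] by blast
  then show ?thesis by simp
qed

lemma dim_UP_with_roots:
  assumes "finite E"
  shows "up.dim {q \<in> UP (Suc (card E)). \<forall>y\<in>E. poly q y = 0} \<le> 1"
proof -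
  have "{q \<in> UP (Suc (card E)). \<forall>y\<in>E. poly q y = 0} \<subseteq> up.span {root_poly E}"
  proof
    fix q assume "q \<in> {q \<in> UP (Suc (card E)). \<forall>y\<in>E. poly q y = 0}"
    then have "q = smult (coeff q (card E)) (root_poly E)" using UP_with_roots assms by blast
    then show "q \<in> up.span {root_poly E}"
      by (metis insertI1 up.span_base up.span_scale)
  qed
  then show ?thesis using up.dim_le_card[of _ "{root_poly E}"] by simp
qed

text \<open>Differences of root polynomials sharing all but one root lower the number of roots, so the
  polynomials with \<open>b\<close> distinct roots already span everything of degree at most \<open>b\<close>.\<close>

lemma root_polys_span:
  fixes S :: "'k::field_char_0 poly set"
  assumes S: "up.subspace S" and "\<And>E. finite E \<Longrightarrow> card E = b \<Longrightarrow> root_poly E \<in> S"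
  shows "UP (Suc b) \<subseteq> S"
proof -
  have roots: "\<forall>E. finite E \<longrightarrow> card E = k \<longrightarrow> root_poly E \<in> S" if "k \<le> b" for k
    using that
  proof (induction k rule: inc_induct)
    case base
    then show ?case using assms(2) by blast
  next
    case (step k)
    show ?case
    proof (intro allI impI)
      fix E :: "'k set" assume E: "finite E" "card E = k"
      obtain \<eta> where \<eta>: "\<eta> \<notin> E" using ex_new_if_finite[OF infinite_UNIV_char_0 E(1)] by blast
      obtain \<theta> where \<theta>: "\<theta> \<notin> insert \<eta> E"
        using ex_new_if_finite[OF infinite_UNIV_char_0, of "insert \<eta> E"] E(1) by auto
      have "root_poly (insert \<eta> E) \<in> S" "root_poly (insert \<theta> E) \<in> S"
        using step.IH E \<eta> \<theta> by auto
      then have "smult (inverse (\<theta> - \<eta>)) (root_poly (insert \<eta> E) - root_poly (insert \<theta> E)) \<in> S"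
        using S by (meson up.subspace_diff up.subspace_scale)
      also have "root_poly (insert \<eta> E) - root_poly (insert \<theta> E) = smult (\<theta> - \<eta>) (root_poly E)"
      proof -
        have "root_poly (insert \<eta> E) - root_poly (insert \<theta> E)
            = ([:- \<eta>, 1:] - [:- \<theta>, 1:]) * root_poly E"
          using E \<eta> \<theta> unfolding left_diff_distrib root_poly_def by (simp del: mult_pCons_left)
        also have "[:- \<eta>, 1:] - [:- \<theta>, 1:] = [:\<theta> - \<eta>:]" by simp
        also have "[:\<theta> - \<eta>:] * root_poly E = smult (\<theta> - \<eta>) (root_poly E)" by simp
        finally show ?thesis .
      qed
      finally show "root_poly E \<in> S" using \<theta> by simp
    qed
  qed
  \<comment> \<open>Root polynomials are monic and now available in every degree up to b, so top
    coefficients can be removed one after the other.\<close>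
  have "UP k \<subseteq> S" if "k \<le> Suc b" for k
    using that
  proof (induction k)
    case 0
    then show ?case using up.subspace_0[OF S] by (simp add: UP_0)
  next
    case (Suc k)
    show ?case
    proof
      fix q :: "'k poly" assume q: "q \<in> UP (Suc k)"
      obtain E :: "'k set" where E: "finite E" "card E = k"
        using infinite_arbitrarily_large[OF infinite_UNIV_char_0] by blast
      have rS: "root_poly E \<in> S" using roots E Suc.prems by auto
      have "q - smult (coeff q k) (root_poly E) \<in> UP (Suc k)"
        using q subspace_UP root_poly(3)[OF E(1)] E(2) by (meson up.subspace_diff up.subspace_scale)
      moreover have "coeff (q - smult (coeff q k) (root_poly E)) k = 0"
        using root_poly(2)[OF E(1)] E(2) by simp
      ultimately have "q - smult (coeff q k) (root_poly E) \<in> UP k"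
        using UP_Suc_kernel by blast
      then have "q - smult (coeff q k) (root_poly E) \<in> S" using Suc by auto
      then have "(q - smult (coeff q k) (root_poly E)) + smult (coeff q k) (root_poly E) \<in> S"
        using S rS by (meson up.subspace_add up.subspace_scale)
      then show "q \<in> S" by simp
    qed
  qed
  then show ?thesis by blast
qed

section \<open>Syzygies between the two multiplication maps\<close>

definition XX :: "'k::field poly2" where "XX = [:0, 1:]"
definition YY :: "'k::field poly2" where "YY = [:[:0, 1:]:]"

lemma ev_XX [simp]: "ev z XX = fst z" and ev_YY [simp]: "ev z YY = snd z"
  by (simp_all add: ev_def XX_def YY_def)

lemma PP_closed:
  "0 \<in> PP A B" "p \<in> PP A B \<Longrightarrow> q \<in> PP A B \<Longrightarrow> p + q \<in> PP A B" "p \<in> PP A B \<Longrightarrow> smult [:c:] p \<in> PP A B"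
  by (rule pp.subspace_0[OF subspace_PP], rule pp.subspace_add[OF subspace_PP], assumption+,
      rule pp.subspace_scale[OF subspace_PP])

text \<open>The expression f0 x_{1,0} + f1 x_{1,1} + g0 x_{2,0} + g1 x_{2,1} in the chart x_{1,0} =
  x_{2,0} = 1.\<close>

definition syz :: "'k::field tuple \<Rightarrow> 'k poly2"
  where "syz v = v 0 + XX * v 1 + v 2 + YY * v 3"

lemma syz_simps [simp]:
  "syz 0 = 0" "syz (v + w) = syz v + syz w" "syz (\<lambda>i. smult [:c:] (v i)) = smult [:c:] (syz v)"
  "syz (\<lambda>i. q * v i) = q * syz v"
  unfolding syz_def
  by (simp_all only: plus_fun_apply zero_fun_apply distrib_left mult_smult_right smult_add_right
      mult.left_commute add_ac mult_zero_right add_0_left)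

lemma XX_vline: "XX = vline \<xi> + [:[:\<xi>:]:]"
  by (simp add: vline_def XX_def)

text \<open>A tuple \<open>(f\<^sub>0, f\<^sub>1, g\<^sub>0, g\<^sub>1)\<close> is encoded as a function that is zero from index 4 on.\<close>

definition HH :: "nat \<Rightarrow> nat \<Rightarrow> 'k::field tuple set"
  where "HH a b = {v. v 0 \<in> PP a (b + 1) \<and> v 1 \<in> PP a (b + 1) \<and> v 2 \<in> PP (a + 1) b \<and>
    v 3 \<in> PP (a + 1) b \<and> (\<forall>i\<ge>4. v i = 0) \<and> syz v = 0}"

text \<open>Separated from \<open>HH\<close>, which does not depend on the points:
  \<open>open_dim_bound\<close> works with a fixed space on which the points impose linear
  conditions.\<close>

definition KK :: "nat \<Rightarrow> nat \<Rightarrow> ('k::field \<times> 'k) set \<Rightarrow> 'k tuple set"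
  where "KK a b Z = {v \<in> HH a b. \<forall>z\<in>Z. \<forall>i<4. ev z (v i) = 0}"

lemma less_4: "(\<forall>i<4::nat. P i) \<longleftrightarrow> P 0 \<and> P 1 \<and> P 2 \<and> P 3"
  by (auto simp: eval_nat_numeral All_less_Suc)

lemma KK_iff:
  "v \<in> KK a b Z \<longleftrightarrow> v 0 \<in> II a (b + 1) Z \<and> v 1 \<in> II a (b + 1) Z \<and> v 2 \<in> II (a + 1) b Z \<and>
    v 3 \<in> II (a + 1) b Z \<and> (\<forall>i\<ge>4. v i = 0) \<and> syz v = 0"
  unfolding KK_def HH_def less_4 by (auto simp: II_def)

lemma smult_const_eq: "smult [:c:] p = [:[:c:]:] * (p :: 'k::field poly2)"
  by simp

lemma subspace_HH: "tup.subspace (HH a b)"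
  by (rule tup.subspaceI) (auto simp: HH_def PP_closed)

lemma subspace_KK: "tup.subspace (KK a b Z)"
proof (rule tup.subspaceI)
  show "0 \<in> KK a b Z" using tup.subspace_0[OF subspace_HH] by (auto simp: KK_def)
  show "v + w \<in> KK a b Z" if "v \<in> KK a b Z" "w \<in> KK a b Z" for v w :: "'a tuple"
    using tup.subspace_add[OF subspace_HH] that by (auto simp: KK_def)
  show "(\<lambda>i. smult [:c:] (v i)) \<in> KK a b Z" if "v \<in> KK a b Z" for v :: "'a tuple" and c
    using tup.subspace_scale[OF subspace_HH] that by (auto simp: KK_def)
qed

lemma linear_component:
  "Vector_Spaces.linear (\<lambda>(c::'k::field) (v::'k tuple) i. smult [:c:] (v i)) (\<lambda>c p. smult [:c:] p) (\<lambda>v. v n)"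
  using tup.vector_space_axioms pp.vector_space_axioms
  by (auto simp: Vector_Spaces.linear_iff)

lemma linear_res_component:
  "Vector_Spaces.linear (\<lambda>(c::'k::field) (v::'k tuple) i. smult [:c:] (v i)) smult (\<lambda>v. res \<xi> (v n))"
  using tup.vector_space_axioms up.vector_space_axioms
  by (auto simp: Vector_Spaces.linear_iff)

lemma linear_mult_tup:
  "Vector_Spaces.linear (\<lambda>(c::'k::field) (v::'k tuple) i. smult [:c:] (v i)) (\<lambda>c v i. smult [:c:] (v i)) (\<lambda>v i. q * v i)"
  using tup.vector_space_axioms
  by (auto simp: Vector_Spaces.linear_iff fun_eq_iff distrib_left)

lemma fin_dim_HH: "tup.fin_dim (HH a b :: 'k::field tuple set)"
proof -
  \<comment> \<open>Tuples supported on the first n entries, so that the induction removes one entry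
    at a time.\<close>
  define V where "V n = {v :: 'k tuple. (\<forall>i<n. v i \<in> PP (a + 1) (b + 1)) \<and> (\<forall>i\<ge>n. v i = 0)}" for n
  have sV: "tup.subspace (V n)" for n
    by (rule tup.subspaceI) (auto simp: V_def PP_closed)
  have "tup.fin_dim (V n)" for n
  proof (induction n)
    case 0
    have "V 0 = {0}" by (auto simp: V_def)
    then show ?case by (simp add: tup.fin_dim_zero)
  next
    case (Suc n)
    have im: "(\<lambda>v. v n) ` V (Suc n) \<subseteq> PP (a + 1) (b + 1)" by (auto simp: V_def)
    have ker: "{v \<in> V (Suc n). v n = 0} \<subseteq> V n"
      by (auto simp: V_def) (metis Suc_le_eq le_neq_implies_less)
    show ?case
      by (rule tup_pp.dim_le_image_ker(1)[OF linear_component sV dim_PP(1) im Suc ker])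
  qed
  moreover have mono: "PP a (b + 1) \<subseteq> (PP (a + 1) (b + 1) :: 'k poly2 set)"
    "PP (a + 1) b \<subseteq> (PP (a + 1) (b + 1) :: 'k poly2 set)"
    unfolding PP_def Suc_eq_plus1[symmetric] by (blast intro: less_SucI)+
  then have "HH a b \<subseteq> V 4"
    unfolding HH_def V_def less_4 by blast
  ultimately show ?thesis using tup.fin_dim_subset by blast
qed

lemma fin_dim_KK: "tup.fin_dim (KK a b Z)"
  by (rule tup.fin_dim_subset[OF fin_dim_HH]) (auto simp: KK_def)

section \<open>Existence of point sets with few syzygies\<close>

text \<open>The bounds are the dimensions expected for \<open>a * b + t\<close> points; in each of them the truncated
  subtraction plays the role of \<open>max 0\<close>.\<close>

definition good_points :: "nat \<Rightarrow> nat \<Rightarrow> nat \<Rightarrow> ('k::field \<times> 'k) set \<Rightarrow> bool"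
  where "good_points a b t Z \<longleftrightarrow> finite Z \<and> card Z = a * b + t \<and>
    pp.dim (II (a + 1) b Z) \<le> b - t \<and> pp.dim (II a (b + 1) Z) \<le> a - t \<and>
    tup.dim (KK a b Z) \<le> a + b - 1 - 3 * t"

text \<open>For a = t the number of points is t (b + 1), the dimension of
  \<open>PP t (b + 1)\<close>, so general points force f0 = f1 = 0. A syzygy is then g0 = - y g1,
  determined by g1, whose degree bound in y is lower by one, and (t + 1) (b - 1) - t (b + 1) = b - 1
  - 2 t is the required bound.\<close>

lemma good_points_base:
  assumes "t \<le> b"
  obtains Z :: "('k::field_char_0 \<times> 'k) set" where "good_points t b t Z"
proof -
  obtain Z :: "('k \<times> 'k) set" where fZ: "finite Z" "card Z = t * (b + 1)" and
    Z: "\<forall>(A, B)\<in>{(t, b + 1), (t + 1, b), (t + 1, b - 1)}. pp.dim (II A B Z) \<le> A * B - t * (b + 1)"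
    using exists_general_points[of "{(t, b + 1), (t + 1, b), (t + 1, b - 1)}" "t * (b + 1)"] by blast
  have Z1: "pp.dim (II t (b + 1) Z) = 0" and Z2: "pp.dim (II (t + 1) b Z) \<le> b - t"
    and Z3: "pp.dim (II (t + 1) (b - 1) Z) \<le> (t + 1) * (b - 1) - t * (b + 1)"
    using Z by (cases b; auto simp: algebra_simps)+
  have I0: "II t (b + 1) Z \<subseteq> {0}" using pp.dim_eq_0D[OF fin_dim_II Z1] .
  have im: "(\<lambda>v. v 3) ` KK t b Z \<subseteq> II (t + 1) (b - 1) Z"
  proof
    fix p assume "p \<in> (\<lambda>v. v 3) ` KK t b Z"
    then obtain v where v: "v \<in> KK t b Z" "p = v 3" by blast
    have "v 0 = 0" "v 1 = 0" using v(1) I0 unfolding KK_iff by auto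
    then have eq: "v 2 = - (YY * p)" and p: "p \<in> II (t + 1) b Z" and v2: "v 2 \<in> PP (t + 1) b"
      using v unfolding KK_iff syz_def by (auto simp: II_def add_eq_0_iff2)
    have "i < t + 1 \<and> j < b - 1" if "coeff (coeff p i) j \<noteq> 0" for i j
    proof -
      have "coeff (coeff (v 2) i) (Suc j) \<noteq> 0" using that by (simp add: eq YY_def)
      then show ?thesis using v2 unfolding PP_def by fastforce
    qed
    then show "p \<in> II (t + 1) (b - 1) Z" using p unfolding II_def PP_def by blast
  qed
  have ker: "{v \<in> KK t b Z. v 3 = 0} \<subseteq> {0}"
  proof
    fix v assume v: "v \<in> {v \<in> KK t b Z. v 3 = 0}"
    then have "v 0 = 0" "v 1 = 0" "v 3 = 0" "\<forall>i\<ge>4. v i = 0" using I0 unfolding KK_iff by auto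
    moreover from this have "v 2 = 0" using v unfolding KK_iff syz_def by simp
    ultimately have "v i = 0" for i
      using less_4[of "\<lambda>i. v i = 0"] by (cases "i < 4") auto
    then show "v \<in> {0}" by auto
  qed
  have "tup.dim (KK t b Z) \<le> pp.dim (II (t + 1) (b - 1) Z) + tup.dim ({0} :: 'k tuple set)"
    by (rule tup_pp.dim_le_image_ker(2)[OF linear_component subspace_KK fin_dim_II im tup.fin_dim_zero ker])
  also have "\<dots> \<le> (t + 1) * (b - 1) - t * (b + 1)" using Z3 by (simp add: tup.dim_zero)
  also have "\<dots> \<le> t + b - 1 - 3 * t"
    by (cases b) (auto simp: algebra_simps)
  finally have "good_points t b t Z"
    using fZ Z1 Z2 by (auto simp: good_points_def)
  then show ?thesis by (rule that)
qed

lemma II_zero_res: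
  assumes "p \<in> II A B Z'" "B \<le> card E" "finite E" "{\<xi>} \<times> E \<subseteq> Z'"
  shows "res \<xi> p = 0"
proof (rule UP_roots_eq_0[OF _ assms(3,2)])
  show "res \<xi> p \<in> UP B" using assms(1) res_in_UP by (auto simp: II_def)
  fix y assume "y \<in> E"
  then show "poly (res \<xi> p) y = 0"
    using assms(1,4) by (auto simp: II_def ev_res[symmetric])
qed

lemma II_res_root_poly:
  assumes "p \<in> II A (Suc (card E)) Z'" "finite E" "{\<xi>} \<times> E \<subseteq> Z'"
  shows "res \<xi> p \<in> {q \<in> UP (Suc (card E)). \<forall>y\<in>E. poly q y = 0}"
  using assms res_in_UP[of p] by (auto simp: II_def ev_res[symmetric])

text \<open>The set \<open>V\<close> below consists of the restrictions to the new line that occur in syzygies not divisible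
  by its equation.\<close>

lemma good_points_step:
  fixes Z :: "('k::field_char_0 \<times> 'k) set"
  assumes Z: "good_points a b t Z" and t: "t \<le> a" "t \<le> b"
  obtains Z' :: "('k \<times> 'k) set" where "good_points (a + 1) b t Z'"
proof -
  have fZ: "finite Z" "card Z = a * b + t" and d1: "pp.dim (II (a + 1) b Z) \<le> b - t"
    and d2: "pp.dim (II a (b + 1) Z) \<le> a - t" and dK: "tup.dim (KK a b Z) \<le> a + b - 1 - 3 * t"
    using Z by (auto simp: good_points_def)
  obtain \<xi> where "\<xi> \<notin> fst ` Z"
    using ex_new_if_finite[OF infinite_UNIV_char_0, of "fst ` Z"] fZ(1) by blast
  then have \<xi>: "fst z \<noteq> \<xi>" if "z \<in> Z" for z using that by blast
  \<comment> \<open>Dividing a syzygy on the enlarged set by x - \<xi> will express its second entry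
    as - (h + g0 + y g1) with h, g0, g1 from the spaces summed here.\<close>
  define S where "S = pp.set_sum (II a (b + 1) Z) (pp.set_sum (II (a + 1) b Z) ((*) YY ` II (a + 1) b Z))"
  define V where "V = res \<xi> ` S"
  have sS: "pp.subspace S"
    unfolding S_def
    by (intro pp.subspace_set_sum subspace_II pp_pp.linear_subspace_image[OF linear_mult_pp])
  have fY: "pp.fin_dim ((*) YY ` II (a + 1) b Z)"
    by (rule pp_pp.fin_dim_image[OF linear_mult_pp fin_dim_II])
  have fS: "pp.fin_dim S"
    unfolding S_def by (intro pp.fin_dim_set_sum fin_dim_II fY)
  have "pp.dim S \<le> pp.dim (II a (b + 1) Z) + (pp.dim (II (a + 1) b Z) + pp.dim ((*) YY ` II (a + 1) b Z))"
    unfolding S_def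
    by (intro order_trans[OF pp.dim_set_sum_le] add_left_mono pp.dim_set_sum_le pp.fin_dim_set_sum
        fin_dim_II fY)
  also have "\<dots> \<le> (a - t) + ((b - t) + (b - t))"
    using d1 d2 pp_pp.dim_image_le_fin_dim[OF linear_mult_pp fin_dim_II, of YY "a + 1" b Z] by linarith
  finally have dS: "pp.dim S \<le> (a - t) + ((b - t) + (b - t))" .
  have sV: "up.subspace V"
    unfolding V_def using sS by (rule pp_up.linear_subspace_image[OF linear_res])
  have dV: "up.dim V \<le> (a - t) + ((b - t) + (b - t))"
    unfolding V_def using pp_up.dim_image_le_fin_dim[OF linear_res fS, of \<xi>] dS by linarith
  have fV: "up.fin_dim V"
    unfolding V_def by (rule pp_up.fin_dim_image[OF linear_res fS])
  \<comment> \<open>The condition a + b <= 3 t says that the bound for a + 1 is zero; in that case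
    the new points have to avoid V.\<close>
  have "\<exists>E. finite E \<and> card E = b \<and> (a + b \<le> 3 * t \<longrightarrow> root_poly E \<notin> V)"
  proof (cases "a + b \<le> 3 * t")
    case True
    have "\<not> UP (Suc b) \<subseteq> V"
    proof
      assume "UP (Suc b) \<subseteq> V"
      then have "Suc b \<le> up.dim V" using up.dim_mono_fin_dim[OF fV] dim_UP by metis
      \<comment> \<open>(a - t) + 2 (b - t) = b + (a + b - 3 t) <= b, whereas
        \<open>UP (Suc b)\<close> has dimension b + 1.\<close>
      then show False using dV True t by linarith
    qed
    then show ?thesis using root_polys_span[OF sV, of b] by blast
  next
    case False
    then show ?thesis using infinite_arbitrarily_large[OF infinite_UNIV_char_0, of b] by blast
  qed
  then obtain E where E: "finite E" "card E = b" and EV: "a + b \<le> 3 * t \<Longrightarrow> root_poly E \<notin> V" by blast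
  define Z' where "Z' = Z \<union> {\<xi>} \<times> E"
  have sub: "Z \<subseteq> Z'" "{\<xi>} \<times> E \<subseteq> Z'" by (auto simp: Z'_def)
  have div0: "p \<in> (*) (vline \<xi>) ` II (A - 1) B Z" if "p \<in> II A B Z'" "res \<xi> p = 0" for A B p
    using divide_vline_II[OF that(1) sub(1) \<xi> that(2)] .
  have "Z \<inter> {\<xi>} \<times> E = {}" using \<xi> by force
  then have card: "finite Z'" "card Z' = (a + 1) * b + t"
    using fZ E by (simp_all add: Z'_def card_Un_disjoint card_cartesian_product)
  let ?W = "{q \<in> UP (Suc (card E)). \<forall>y\<in>E. poly q y = 0}"
  have fW: "up.fin_dim ?W" by (rule up.fin_dim_subset[OF fin_dim_UP]) auto
  note dW = dim_UP_with_roots[OF E(1)]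
  \<comment> \<open>With degree below b in y, vanishing at b points of the line means vanishing on
    it.\<close>
  have b1: "pp.dim (II (a + 2) b Z') \<le> b - t"
  proof -
    have "II (a + 2) b Z' \<subseteq> (*) (vline \<xi>) ` II (a + 1) b Z"
      using div0[of _ "a + 2" b] II_zero_res[OF _ _ E(1) sub(2)] E(2) by auto
    then have "pp.dim (II (a + 2) b Z') \<le> pp.dim ((*) (vline \<xi>) ` II (a + 1) b Z)"
      by (intro pp.dim_mono_fin_dim pp_pp.fin_dim_image[OF linear_mult_pp fin_dim_II])
    also have "\<dots> \<le> pp.dim (II (a + 1) b Z)"
      by (rule pp_pp.dim_image_le_fin_dim[OF linear_mult_pp fin_dim_II])
    finally show ?thesis using d1 by simp
  qed
  \<comment> \<open>One more degree in y leaves a single possible restriction up to scalars, so the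
    dimension grows by at most one.\<close>
  have b2: "pp.dim (II (a + 1) (b + 1) Z') \<le> a + 1 - t"
  proof -
    have im: "res \<xi> ` II (a + 1) (b + 1) Z' \<subseteq> ?W"
      using II_res_root_poly[OF _ E(1) sub(2)] E(2) by auto
    have ker: "{p \<in> II (a + 1) (b + 1) Z'. res \<xi> p = 0} \<subseteq> (*) (vline \<xi>) ` II a (b + 1) Z"
      using div0[of _ "a + 1" "b + 1"] by auto
    have "pp.dim (II (a + 1) (b + 1) Z') \<le> up.dim ?W + pp.dim ((*) (vline \<xi>) ` II a (b + 1) Z)"
      by (rule pp_up.dim_le_image_ker(2)[OF linear_res subspace_II fW im
            pp_pp.fin_dim_image[OF linear_mult_pp fin_dim_II] ker])
    also have "\<dots> \<le> 1 + (a - t)"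
      using dW d2 pp_pp.dim_image_le_fin_dim[OF linear_mult_pp fin_dim_II, of "vline \<xi>" a "b + 1" Z]
      by linarith
    finally show ?thesis using t by simp
  qed
  let ?M = "(\<lambda>v i. vline \<xi> * v i) ` KK a b Z"
  have fM: "tup.fin_dim ?M" by (rule tup_tup.fin_dim_image[OF linear_mult_tup fin_dim_KK])
  have dM: "tup.dim ?M \<le> a + b - 1 - 3 * t"
    using tup_tup.dim_image_le_fin_dim[OF linear_mult_tup fin_dim_KK, of "vline \<xi>" a b Z] dK by linarith
  have KK'D: "v 0 \<in> II (a + 1) (b + 1) Z'" "v 1 \<in> II (a + 1) (b + 1) Z'" "v 2 \<in> II (a + 2) b Z'"
    "v 3 \<in> II (a + 2) b Z'" "\<forall>i\<ge>4. v i = 0" "syz v = 0"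
    if "v \<in> KK (a + 1) b Z'" for v
    using that by (simp_all add: KK_iff)
  have KK'g: "\<exists>g. g \<in> II (a + 1) b Z \<and> v n = vline \<xi> * g" if "v \<in> KK (a + 1) b Z'" "n = 2 \<or> n = 3" for v n
    using div0[of "v n" "a + 2" b] II_zero_res[of "v n" "a + 2" b Z' E \<xi>] E KK'D[OF that(1)] that(2) sub(2)
    by auto
  \<comment> \<open>On the line the last two entries vanish, so the relation reads f0 + \<xi> f1 =
    0, and the restriction of f1 determines that of f0.\<close>
  have res0: "res \<xi> (v 0) = - (smult \<xi> (res \<xi> (v 1)))" if v: "v \<in> KK (a + 1) b Z'" for v
  proof -
    have "res \<xi> (v 2) = 0" "res \<xi> (v 3) = 0" using KK'g[OF v, of 2] KK'g[OF v, of 3] by auto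
    then have "res \<xi> (v 0) + res \<xi> (XX * v 1) = 0"
      using arg_cong[OF KK'D(6)[OF v], of "res \<xi>"] by (simp add: syz_def)
    moreover have "res \<xi> (XX * v 1) = smult \<xi> (res \<xi> (v 1))" by (simp add: res_def XX_def)
    ultimately show ?thesis by (simp add: add_eq_0_iff2)
  qed
  \<comment> \<open>If f1 vanishes on the line, all four entries are divisible by x - \<xi>, and the
    quotients form a syzygy on Z.\<close>
  have ker: "{v \<in> KK (a + 1) b Z'. res \<xi> (v 1) = 0} \<subseteq> ?M"
  proof
    fix v assume v: "v \<in> {v \<in> KK (a + 1) b Z'. res \<xi> (v 1) = 0}"
    then have v': "v \<in> KK (a + 1) b Z'" and r1: "res \<xi> (v 1) = 0" by auto
    have r0: "res \<xi> (v 0) = 0" using res0[OF v'] r1 by simp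
    obtain h0 where h0: "h0 \<in> II a (b + 1) Z" "v 0 = vline \<xi> * h0"
      using div0[OF KK'D(1)[OF v'] r0] by auto
    obtain h1 where h1: "h1 \<in> II a (b + 1) Z" "v 1 = vline \<xi> * h1"
      using div0[OF KK'D(2)[OF v'] r1] by auto
    obtain g0 where g0: "g0 \<in> II (a + 1) b Z" "v 2 = vline \<xi> * g0" using KK'g[OF v'] by blast
    obtain g1 where g1: "g1 \<in> II (a + 1) b Z" "v 3 = vline \<xi> * g1" using KK'g[OF v'] by blast
    define w where "w i = (if i = 0 then h0 else if i = 1 then h1 else if i = 2 then g0
      else if i = 3 then g1 else 0)" for i :: nat
    have vw: "v = (\<lambda>i. vline \<xi> * w i)"
    proof
      fix i show "v i = vline \<xi> * w i"
        using h0(2) h1(2) g0(2) g1(2) KK'D(5)[OF v'] less_4[of "\<lambda>i. v i = vline \<xi> * w i"]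
        by (cases "i < 4") (auto simp: w_def)
    qed
    then have "vline \<xi> * syz w = 0" using KK'D(6)[OF v'] by simp
    then have "syz w = 0" by simp
    then have "w \<in> KK a b Z"
      unfolding KK_iff using h0 h1 g0 g1 by (simp add: w_def)
    then show "v \<in> ?M" using vw by blast
  qed
  have im: "(\<lambda>v. res \<xi> (v 1)) ` KK (a + 1) b Z' \<subseteq> ?W"
    using II_res_root_poly[OF _ E(1) sub(2)] E(2) KK'D(2) by auto
  have b3: "tup.dim (KK (a + 1) b Z') \<le> a + 1 + b - 1 - 3 * t"
  proof (cases "a + b \<le> 3 * t")
    case False
    have "tup.dim (KK (a + 1) b Z') \<le> up.dim ?W + tup.dim ?M"
      by (rule tup_up.dim_le_image_ker(2)[OF linear_res_component subspace_KK fW im fM ker])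
    then show ?thesis using False dW dM by linarith
  next
    case True
    have "res \<xi> (v 1) = 0" if v: "v \<in> KK (a + 1) b Z'" for v
    proof (rule ccontr)
      assume nz: "res \<xi> (v 1) \<noteq> 0"
      define c where "c = coeff (res \<xi> (v 1)) (card E)"
      have "res \<xi> (v 1) \<in> ?W" using im v by blast
      then have r1: "res \<xi> (v 1) = smult c (root_poly E)"
        unfolding c_def using UP_with_roots[OF _ E(1)] by blast
      then have "c \<noteq> 0" using nz by auto
      obtain g0 where g0: "g0 \<in> II (a + 1) b Z" "v 2 = vline \<xi> * g0" using KK'g[OF v] by blast
      obtain g1 where g1: "g1 \<in> II (a + 1) b Z" "v 3 = vline \<xi> * g1" using KK'g[OF v] by blast
      \<comment> \<open>Writing x = \<xi> + (x - \<xi>) turns f0 + x f1 into u + (x - \<xi>) f1 with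
        u vanishing on the line, so x - \<xi> can be cancelled from the whole relation.\<close>
      define u where "u = v 0 + smult [:\<xi>:] (v 1)"
      have "u \<in> II (a + 1) (b + 1) Z'"
        unfolding u_def using KK'D[OF v] subspace_II by (meson pp.subspace_add pp.subspace_scale)
      moreover have "res \<xi> u = 0" by (simp add: u_def res0[OF v])
      ultimately obtain h where h: "h \<in> II a (b + 1) Z" "u = vline \<xi> * h" using div0 by fastforce
      have "syz v = u + vline \<xi> * v 1 + v 2 + YY * v 3"
        unfolding syz_def u_def smult_const_eq XX_vline[of \<xi>] distrib_right by (simp only: add_ac)
      also have "\<dots> = vline \<xi> * (h + v 1 + g0 + YY * g1)"
        unfolding h(2) g0(2) g1(2) by (simp only: distrib_left mult.left_commute)
      finally have "h + v 1 + g0 + YY * g1 = 0"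
        using KK'D(6)[OF v] by (metis mult_eq_0_iff vline_nonzero)
      then have "v 1 + (h + (g0 + YY * g1)) = 0" by (simp only: ac_simps)
      then have "v 1 = - (h + (g0 + YY * g1))" by (rule eq_neg_iff_add_eq_0[THEN iffD2])
      moreover have "h + (g0 + YY * g1) \<in> S"
        unfolding S_def pp.set_sum_def using h(1) g0(1) g1(1) by blast
      ultimately have "v 1 \<in> S" by (simp only: pp.subspace_neg[OF sS])
      then have "smult c (root_poly E) \<in> V" unfolding V_def r1[symmetric] by blast
      then have "smult (inverse c) (smult c (root_poly E)) \<in> V" by (rule up.subspace_scale[OF sV])
      then show False using EV[OF True] \<open>c \<noteq> 0\<close> by simp
    qed
    then have "KK (a + 1) b Z' \<subseteq> ?M" using ker by blast
    then have "tup.dim (KK (a + 1) b Z') \<le> tup.dim ?M" by (rule tup.dim_mono_fin_dim[OF fM])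
    then show ?thesis using dM True by linarith
  qed
  have "good_points (a + 1) b t Z'"
    unfolding good_points_def using card b1 b2 b3 by (simp add: add.commute add.left_commute)
  then show ?thesis by (rule that)
qed

lemma exists_good_points:
  assumes "t \<le> a" "t \<le> b"
  obtains Z :: "('k::field_char_0 \<times> 'k) set" where "good_points a b t Z"
proof -
  have "\<exists>Z :: ('k \<times> 'k) set. good_points a b t Z"
    using assms(1)
  proof (induction a rule: dec_induct)
    case base
    then show ?case using good_points_base[OF assms(2)] by metis
  next
    case (step a)
    then obtain Z :: "('k \<times> 'k) set" where Z: "good_points a b t Z" by blast
    from good_points_step[OF Z step(1) assms(2)] show ?case by (metis Suc_eq_plus1)
  qed
  then show ?thesis using that by blast
qed

section \<open>The number of new generators in each bidegree\<close>

text \<open>The part of bidegree (a, b) generated by the forms of bidegree (a - 1, b): in the chart,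
  x_{1,0} and x_{1,1} act as 1 and x. \<open>W2\<close> does the same for the other factor.\<close>

definition W1 :: "nat \<Rightarrow> nat \<Rightarrow> ('k::field \<times> 'k) set \<Rightarrow> 'k poly2 set"
  where "W1 a b Z = pp.set_sum (II a (b + 1) Z) ((*) XX ` II a (b + 1) Z)"

definition W2 :: "nat \<Rightarrow> nat \<Rightarrow> ('k::field \<times> 'k) set \<Rightarrow> 'k poly2 set"
  where "W2 a b Z = pp.set_sum (II (a + 1) b Z) ((*) YY ` II (a + 1) b Z)"

definition WW :: "nat \<Rightarrow> nat \<Rightarrow> ('k::field \<times> 'k) set \<Rightarrow> 'k poly2 set"
  where "WW a b Z = pp.set_sum (W1 a b Z) (W2 a b Z)"

lemma XX_mult_PP: "XX * p \<in> PP (Suc A) B \<longleftrightarrow> p \<in> PP A B"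
proof
  assume *: "XX * p \<in> PP (Suc A) B"
  have "i < A \<and> j < B" if "coeff (coeff p i) j \<noteq> 0" for i j
  proof -
    have "coeff (coeff (XX * p) (Suc i)) j \<noteq> 0" using that by (simp add: XX_def)
    then show ?thesis using * unfolding PP_def by blast
  qed
  then show "p \<in> PP A B" by (auto simp: PP_def)
next
  assume *: "p \<in> PP A B"
  have "i < Suc A \<and> j < B" if "coeff (coeff (XX * p) i) j \<noteq> 0" for i j
    using that * by (cases i) (auto simp: XX_def PP_def)
  then show "XX * p \<in> PP (Suc A) B" by (auto simp: PP_def)
qed

lemma YY_mult_PP: "YY * p \<in> PP A (Suc B) \<longleftrightarrow> p \<in> PP A B"
proof
  assume *: "YY * p \<in> PP A (Suc B)"
  have "i < A \<and> j < B" if "coeff (coeff p i) j \<noteq> 0" for i j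
  proof -
    have "coeff (coeff (YY * p) i) (Suc j) \<noteq> 0" using that by (simp add: YY_def)
    then show ?thesis using * unfolding PP_def by blast
  qed
  then show "p \<in> PP A B" by (auto simp: PP_def)
next
  assume *: "p \<in> PP A B"
  have "i < A \<and> j < Suc B" if "coeff (coeff (YY * p) i) j \<noteq> 0" for i j
    using that * by (cases j) (auto simp: YY_def PP_def)
  then show "YY * p \<in> PP A (Suc B)" by (auto simp: PP_def)
qed

lemma PP_mono: "A \<le> A' \<Longrightarrow> B \<le> B' \<Longrightarrow> PP A B \<subseteq> PP A' B'"
  unfolding PP_def by (blast intro: less_le_trans)

lemma II_mono: "A \<le> A' \<Longrightarrow> B \<le> B' \<Longrightarrow> II A B Z \<subseteq> II A' B' Z"
  using PP_mono unfolding II_def by blast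

lemma XX_nonzero [simp]: "XX \<noteq> 0" and YY_nonzero [simp]: "YY \<noteq> 0"
  by (simp_all add: XX_def YY_def)

lemma subspace_mult_II: "pp.subspace ((*) q ` II A B Z)"
  by (rule pp_pp.linear_subspace_image[OF linear_mult_pp subspace_II])

lemma fin_dim_mult_II: "pp.fin_dim ((*) q ` II A B Z)"
  by (rule pp_pp.fin_dim_image[OF linear_mult_pp fin_dim_II])

lemma dim_mult_II:
  assumes "q \<noteq> 0"
  shows "pp.dim ((*) q ` II A B Z) = pp.dim (II A B Z)"
  using assms by (intro pp_pp.dim_image_inj_fin_dim[OF linear_mult_pp subspace_II fin_dim_II]) auto

lemma subspace_W: "pp.subspace (W1 a b Z)" "pp.subspace (W2 a b Z)" "pp.subspace (WW a b Z)"
  unfolding WW_def W1_def W2_def by (intro pp.subspace_set_sum subspace_II subspace_mult_II)+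

lemma fin_dim_W: "pp.fin_dim (W1 a b Z)" "pp.fin_dim (W2 a b Z)" "pp.fin_dim (WW a b Z)"
  unfolding WW_def W1_def W2_def by (intro pp.fin_dim_set_sum fin_dim_II fin_dim_mult_II)+

lemma dim_W1: "2 * pp.dim (II a (b + 1) Z) \<le> pp.dim (W1 a b Z) + pp.dim (II (a - 1) (b + 1) Z)"
proof -
  have "II a (b + 1) Z \<inter> (*) XX ` II a (b + 1) Z \<subseteq> (*) XX ` II (a - 1) (b + 1) Z"
  proof (cases a)
    case 0
    then show ?thesis by (auto simp: II_def PP_0)
  next
    case (Suc a')
    then show ?thesis by (auto simp: II_def XX_mult_PP)
  qed
  then have "pp.dim (II a (b + 1) Z \<inter> (*) XX ` II a (b + 1) Z) \<le> pp.dim ((*) XX ` II (a - 1) (b + 1) Z)"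
    by (rule pp.dim_mono_fin_dim[OF fin_dim_mult_II])
  then show ?thesis
    using pp.dim_set_sum_Int_fin_dim[OF subspace_II subspace_mult_II fin_dim_II fin_dim_mult_II,
        of a "b + 1" Z XX a "b + 1" Z]
    by (simp add: W1_def dim_mult_II)
qed

lemma dim_W2: "2 * pp.dim (II (a + 1) b Z) \<le> pp.dim (W2 a b Z) + pp.dim (II (a + 1) (b - 1) Z)"
proof -
  have "II (a + 1) b Z \<inter> (*) YY ` II (a + 1) b Z \<subseteq> (*) YY ` II (a + 1) (b - 1) Z"
  proof (cases b)
    case 0
    then show ?thesis by (auto simp: II_def PP_0)
  next
    case (Suc b')
    then show ?thesis by (auto simp: II_def YY_mult_PP)
  qed
  then have "pp.dim (II (a + 1) b Z \<inter> (*) YY ` II (a + 1) b Z) \<le> pp.dim ((*) YY ` II (a + 1) (b - 1) Z)"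
    by (rule pp.dim_mono_fin_dim[OF fin_dim_mult_II])
  then show ?thesis
    using pp.dim_set_sum_Int_fin_dim[OF subspace_II subspace_mult_II fin_dim_II fin_dim_mult_II,
        of "a + 1" b Z YY "a + 1" b Z]
    by (simp add: W2_def dim_mult_II)
qed

text \<open>An element of both summands has two expressions f0 + x f1 = g0 + y g1, whose difference
  is a syzygy; so the intersection lies in an image of \<open>KK a b Z\<close>.\<close>

lemma dim_WW: "pp.dim (W1 a b Z) + pp.dim (W2 a b Z) \<le> pp.dim (WW a b Z) + tup.dim (KK a b Z)"
proof -
  let ?f = "\<lambda>v :: 'a tuple. v 0 + XX * v 1"
  have lin: "Vector_Spaces.linear (\<lambda>c v i. smult [:c:] (v i)) (\<lambda>(c::'a) p. smult [:c:] p) ?f"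
    using tup.vector_space_axioms pp.vector_space_axioms
    by (auto simp: Vector_Spaces.linear_iff distrib_left smult_add_right)
  have "W1 a b Z \<inter> W2 a b Z \<subseteq> ?f ` KK a b Z"
  proof
    fix p assume p: "p \<in> W1 a b Z \<inter> W2 a b Z"
    obtain f0 f1 where f: "f0 \<in> II a (b + 1) Z" "f1 \<in> II a (b + 1) Z" "p = f0 + XX * f1"
      using p unfolding W1_def pp.set_sum_def by blast
    obtain g0 g1 where g: "g0 \<in> II (a + 1) b Z" "g1 \<in> II (a + 1) b Z" "p = g0 + YY * g1"
      using p unfolding W2_def pp.set_sum_def by blast
    define v where "v i = (if i = 0 then f0 else if i = 1 then f1 else if i = 2 then - g0
      else if i = 3 then - g1 else 0)" for i :: nat
    have "- g0 \<in> II (a + 1) b Z" "- g1 \<in> II (a + 1) b Z"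
      using g pp.subspace_neg[OF subspace_II] by blast+
    moreover have "syz v = (f0 + XX * f1) - (g0 + YY * g1)"
      unfolding syz_def v_def by simp
    then have "syz v = 0" using f(3) g(3) by simp
    ultimately have "v \<in> KK a b Z"
      unfolding KK_iff using f by (simp add: v_def)
    moreover have "p = ?f v" by (simp add: v_def f(3))
    ultimately show "p \<in> ?f ` KK a b Z" by blast
  qed
  then have "pp.dim (W1 a b Z \<inter> W2 a b Z) \<le> pp.dim (?f ` KK a b Z)"
    by (rule pp.dim_mono_fin_dim[OF tup_pp.fin_dim_image[OF lin fin_dim_KK]])
  also have "\<dots> \<le> tup.dim (KK a b Z)"
    by (rule tup_pp.dim_image_le_fin_dim[OF lin fin_dim_KK])
  finally show ?thesis
    using pp.dim_set_sum_Int_fin_dim[OF subspace_W(1) subspace_W(2) fin_dim_W(1) fin_dim_W(2), of a b Z a b Z]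
    unfolding WW_def by linarith
qed

lemma W_subset_WW: "W1 a b Z \<subseteq> WW a b Z" "W2 a b Z \<subseteq> WW a b Z"
proof -
  have "p \<in> WW a b Z" if "p \<in> W1 a b Z" for p
  proof -
    have "p + 0 \<in> WW a b Z"
      unfolding WW_def pp.set_sum_def using that pp.subspace_0[OF subspace_W(2)] by blast
    then show ?thesis by simp
  qed
  moreover have "p \<in> WW a b Z" if "p \<in> W2 a b Z" for p
  proof -
    have "0 + p \<in> WW a b Z"
      unfolding WW_def pp.set_sum_def using that pp.subspace_0[OF subspace_W(1)] by blast
    then show ?thesis by simp
  qed
  ultimately show "W1 a b Z \<subseteq> WW a b Z" "W2 a b Z \<subseteq> WW a b Z" by blast+
qed

lemma WW_subset_II: "WW a b Z \<subseteq> II (a + 1) (b + 1) Z"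
proof -
  have "II a (b + 1) Z \<subseteq> II (a + 1) (b + 1) Z" "II (a + 1) b Z \<subseteq> II (a + 1) (b + 1) Z"
    by (rule II_mono; simp)+
  moreover have "(*) XX ` II a (b + 1) Z \<subseteq> II (a + 1) (b + 1) Z"
    "(*) YY ` II (a + 1) b Z \<subseteq> II (a + 1) (b + 1) Z"
    by (auto simp: II_def XX_mult_PP YY_mult_PP)
  moreover have "pp.set_sum S T \<subseteq> II (a + 1) (b + 1) Z"
    if "S \<subseteq> II (a + 1) (b + 1) Z" "T \<subseteq> II (a + 1) (b + 1) Z" for S T
    unfolding pp.set_sum_def using that pp.subspace_add[OF subspace_II] by blast
  ultimately show ?thesis
    unfolding WW_def W1_def W2_def by simp
qed

text \<open>The inner differences are the dimensions d(a-1,b) and d(a,b-1). As only nonnegative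
  numbers are subtracted, the truncated chain equals max 0 of the full difference.\<close>

definition gens :: "nat \<Rightarrow> nat \<times> nat \<Rightarrow> nat"
  where "gens s j = N j - s - 2 * (fst j * (snd j + 1) - s) - 2 * ((fst j + 1) * snd j - s)"

text \<open>Here \<open>s - a * b\<close> is the t of s = a b + t, and the side conditions say 0 <=
  t <= a, b.\<close>

definition general_points :: "nat \<Rightarrow> ('k::field \<times> 'k) set \<Rightarrow> bool"
  where "general_points s Z \<longleftrightarrow> finite Z \<and> card Z = s \<and> (\<forall>A B. pp.dim (II A B Z) = A * B - s) \<and>
    (\<forall>a b. a * b \<le> s \<longrightarrow> s - a * b \<le> a \<longrightarrow> s - a * b \<le> b \<longrightarrow>
      tup.dim (KK a b Z) \<le> a + b - 1 - 3 * (s - a * b))"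

text \<open>If \<open>a * b > s\<close> then \<open>(a - 1) * (b + 1) \<ge> s\<close> or \<open>(a + 1) * (b - 1) \<ge> s\<close>, and multiplication
  by the variables of one factor is already onto. Otherwise the syzygies are
  controlled by \<open>general_points\<close> unless one of the two summands vanishes.\<close>

lemma dim_new_generators:
  assumes Z: "general_points s Z"
  shows "pp.dim (II (a + 1) (b + 1) Z) - pp.dim (WW a b Z) = gens s (a, b)"
proof -
  define m where "m = a * b"
  have dI: "pp.dim (II A B Z) = A * B - s" for A B using Z by (auto simp: general_points_def)
  have D: "pp.dim (II (a + 1) (b + 1) Z) = m + a + b + 1 - s"
    and d1: "pp.dim (II a (b + 1) Z) = m + a - s" and d2: "pp.dim (II (a + 1) b Z) = m + b - s"
    unfolding dI m_def by (simp_all add: algebra_simps)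
  have c1: "pp.dim (II (a - 1) (b + 1) Z) = (if a = 0 then 0 else m + a - (b + 1) - s)"
    unfolding dI m_def by (cases a) (simp_all add: algebra_simps)
  have c2: "pp.dim (II (a + 1) (b - 1) Z) = (if b = 0 then 0 else m + b - (a + 1) - s)"
    unfolding dI m_def by (cases b) (simp_all add: algebra_simps)
  have m0: "a = 0 \<Longrightarrow> m = 0" "b = 0 \<Longrightarrow> m = 0" "a \<noteq> 0 \<Longrightarrow> b \<le> m" "b \<noteq> 0 \<Longrightarrow> a \<le> m"
    by (auto simp: m_def)
  have upper: "pp.dim (WW a b Z) \<le> pp.dim (II (a + 1) (b + 1) Z)"
    by (rule pp.dim_mono_fin_dim[OF fin_dim_II WW_subset_II])
  have lower: "pp.dim (W1 a b Z) \<le> pp.dim (WW a b Z)" "pp.dim (W2 a b Z) \<le> pp.dim (WW a b Z)"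
    by (rule pp.dim_mono_fin_dim[OF fin_dim_W(3) W_subset_WW(1)],
        rule pp.dim_mono_fin_dim[OF fin_dim_W(3) W_subset_WW(2)])
  have u1: "pp.dim (W1 a b Z) \<le> 2 * pp.dim (II a (b + 1) Z)"
    using pp.dim_set_sum_le[OF fin_dim_II fin_dim_mult_II, of a "b + 1" Z XX a "b + 1" Z]
    by (simp add: W1_def dim_mult_II)
  have u2: "pp.dim (W2 a b Z) \<le> 2 * pp.dim (II (a + 1) b Z)"
    using pp.dim_set_sum_le[OF fin_dim_II fin_dim_mult_II, of "a + 1" b Z YY "a + 1" b Z]
    by (simp add: W2_def dim_mult_II)
  have u3: "pp.dim (WW a b Z) \<le> pp.dim (W1 a b Z) + pp.dim (W2 a b Z)"
    unfolding WW_def by (rule pp.dim_set_sum_le[OF fin_dim_W(1,2)])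
  have K: "tup.dim (KK a b Z) \<le> a + b - 1 - 3 * (s - m)" if "m \<le> s" "s - m \<le> a" "s - m \<le> b"
    using Z that by (simp add: general_points_def m_def)
  have g: "gens s (a, b) = m + a + b + 1 - s - 2 * (m + a - s) - 2 * (m + b - s)"
    by (simp add: gens_def N_def m_def algebra_simps)
  note facts = upper lower u1 u2 u3 dim_W1[of a b Z] dim_W2[of a b Z] dim_WW[of a b Z]
  \<comment> \<open>In the second and third case I_(a-1,b) or I_(a,b-1) is zero, so only one summand
    remains; the fourth is 0 <= t < a, b.\<close>
  consider "s < m" | "m \<le> s" "m + a \<le> s" | "m \<le> s" "m + b \<le> s" | "m \<le> s" "s < m + a" "s < m + b"
    by linarith
  then show ?thesis
  proof cases
    case 1
    \<comment> \<open>One of (a - 1) (b + 1) and (a + 1) (b - 1) is at least a b - 1 >= s. If it is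
      the first, then 2 (a b + a - s) - (a b + a - b - 1 - s) = a b + a + b + 1 - s, so
      \<open>W1\<close> is everything.\<close>
    then show ?thesis using facts m0 unfolding D d1 d2 c1 c2 g by (auto split: if_splits)
  next
    case 2
    then show ?thesis using facts m0 unfolding D d1 d2 c1 c2 g by (auto split: if_splits)
  next
    case 3
    then show ?thesis using facts m0 unfolding D d1 d2 c1 c2 g by (auto split: if_splits)
  next
    case 4
    define t where "t = s - m"
    have s: "s = m + t" using 4(1) by (simp add: t_def)
    \<comment> \<open>With a = t + 1 + x and b = t + 1 + y the two components of lower degree have
      dimensions x + 1 and y + 1, and the target has t + x + y + 3.\<close>
    obtain x where x: "a = Suc (t + x)" using 4(2) s by (auto simp: less_iff_Suc_add)
    obtain y where y: "b = Suc (t + y)" using 4(3) s by (auto simp: less_iff_Suc_add)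
    have K': "tup.dim (KK a b Z) \<le> x + y + 1 - t"
      using K 4 by (simp add: s x y)
    have D': "m + a + b + 1 - s = t + x + y + 3" "m + a - s = Suc x" "m + b - s = Suc y"
      by (simp_all add: s x y)
    have c1': "pp.dim (II (a - 1) (b + 1) Z) \<le> x - (y + t + 1)"
      and c2': "pp.dim (II (a + 1) (b - 1) Z) \<le> y - (x + t + 1)"
      unfolding c1 c2 using 4 by (auto simp: s x y)
    \<comment> \<open>In the first two cases one summand fills the component; in the third there are
      no syzygies and the sum is direct; in the fourth 2 (x + 1) + 2 (y + 1) - (x + y + 1 - t) is
      the full dimension.\<close>
    consider "x > y + t + 1" | "y > x + t + 1" | "x \<le> y + t + 1" "y \<le> x + t + 1" "x + y + 1 \<le> t"
      | "x \<le> y + t + 1" "y \<le> x + t + 1" "t < x + y + 1"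
      by linarith
    then show ?thesis
      using facts K' c1' c2' unfolding D d1 d2 g D' by cases auto
  qed
qed

section \<open>The combinatorics of the degrees of the generators\<close>

lemma N_mono: "i \<le> j \<Longrightarrow> N i \<le> N j"
  unfolding N_def less_eq_prod_def by (intro mult_le_mono) auto

lemma D_iff: "i \<in> D s \<longleftrightarrow> s < N i \<and> (\<forall>j. s < N j \<longrightarrow> j \<le> i \<longrightarrow> j = i)"
  by (auto simp: D_def minimal_elements_def)

lemma D_below:
  assumes "s < N j"
  obtains i where "i \<in> D s" "i \<le> j"
proof -
  have "\<exists>i\<in>D s. i \<le> j"
    using assms
  proof (induction "fst j + snd j" arbitrary: j rule: less_induct)
    case less
    show ?case
    proof (cases "j \<in> D s")
      case False
      then obtain k where k: "s < N k" "k \<le> j" "k \<noteq> j" using less.prems by (auto simp: D_iff)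
      then have "fst k + snd k < fst j + snd j"
        by (cases k; cases j) auto
      then obtain i where "i \<in> D s" "i \<le> k" using less.hyps k(1) by blast
      then show ?thesis using k(2) order_trans by blast
    qed auto
  qed
  then show ?thesis using that by blast
qed

text \<open>The pairs (s, 0) and (0, s) have N = s + 1, so a minimal element cannot lie beyond
  them.\<close>

lemma finite_D: "finite (D s)"
proof (rule finite_subset)
  show "D s \<subseteq> {..s} \<times> {..s}"
  proof
    fix i assume i: "i \<in> D s"
    have "s < N (s, 0)" "s < N (0, s)" by (auto simp: N_def)
    then have "(s, 0) \<le> i \<longrightarrow> i = (s, 0)" "(0, s) \<le> i \<longrightarrow> i = (0, s)"
      using i unfolding D_iff by blast+
    then show "i \<in> {..s} \<times> {..s}" by (cases i) auto
  qed
qed auto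

lemma finite_DD: "finite (DD s)"
  using finite_D by (auto simp: DD_def D_shift_def)

lemma D_Int_DD: "D s \<inter> DD s = {}"
proof -
  have False if j: "j \<in> D s" "j \<in> DD s" for j
  proof -
    obtain i l where i: "i \<in> D s" "j = i + unit_e l"
      using j(2) by (auto simp: DD_def D_shift_def)
    have "i \<le> j" "i \<noteq> j"
      unfolding i(2) by (auto simp: unit_e_def less_eq_prod_def prod_eq_iff)
    then show False using i(1) j(1) unfolding D_iff by blast
  qed
  then show ?thesis by blast
qed

text \<open>By minimality N does not exceed s at the neighbours (a - 1, b) and (a, b - 1), so both
  subtracted terms vanish.\<close>

lemma gens_D:
  assumes "j \<in> D s"
  shows "int (gens s j) = int (N j) - int s"
proof -
  obtain a b where j: "j = (a, b)" by force
  have "a * (b + 1) \<le> s"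
  proof (rule ccontr)
    assume "\<not> a * (b + 1) \<le> s"
    then have "a \<noteq> 0" "s < N (a - 1, b)" by (cases a; simp add: N_def)+
    then have "(a - 1, b) = (a, b)" using assms unfolding D_iff j by (metis Pair_le diff_le_self order_refl)
    then show False using \<open>a \<noteq> 0\<close> by simp
  qed
  moreover have "(a + 1) * b \<le> s"
  proof (rule ccontr)
    assume "\<not> (a + 1) * b \<le> s"
    then have "b \<noteq> 0" "s < N (a, b - 1)" by (cases b; simp add: N_def)+
    then have "(a, b - 1) = (a, b)" using assms unfolding D_iff j by (metis Pair_le diff_le_self order_refl)
    then show False using \<open>b \<noteq> 0\<close> by simp
  qed
  moreover have "s < N j" using assms by (simp add: D_iff)
  ultimately show ?thesis by (simp add: gens_def j)
qed

lemma D_shift_iff: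
  "(a, b) \<in> D_shift s 1 \<longleftrightarrow> a \<noteq> 0 \<and> (a - 1, b) \<in> D s"
  "(a, b) \<in> D_shift s 2 \<longleftrightarrow> b \<noteq> 0 \<and> (a, b - 1) \<in> D s"
proof -
  have "(a, b) = i + (1, 0) \<longleftrightarrow> a \<noteq> 0 \<and> i = (a - 1, b)" for i :: "nat \<times> nat" by (cases i) auto
  then show "(a, b) \<in> D_shift s 1 \<longleftrightarrow> a \<noteq> 0 \<and> (a - 1, b) \<in> D s"
    by (auto simp: D_shift_def unit_e_def image_iff)
  have "(a, b) = i + (0, 1) \<longleftrightarrow> b \<noteq> 0 \<and> i = (a, b - 1)" for i :: "nat \<times> nat" by (cases i) auto
  then show "(a, b) \<in> D_shift s 2 \<longleftrightarrow> b \<noteq> 0 \<and> (a, b - 1) \<in> D s"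
    by (auto simp: D_shift_def unit_e_def image_iff)
qed

text \<open>For j in \<open>DD s\<close>, a neighbour j - e_l with N > s must itself be minimal,
  since a smaller i in \<open>D s\<close> would put j into \<open>DD_at i\<close>. So the sum over
  \<open>L s j\<close> collects all nonzero subtracted terms of \<open>gens\<close>.\<close>

lemma gens_DD:
  assumes "j \<in> DD s"
  shows "int (gens s j) =
    max 0 (int (N j) - int s - (\<Sum>l\<in>L s j. 2 * (int (N (j - unit_e l)) - int s)))"
proof -
  obtain a b where j: "j = (a, b)" by force
  have notin: "j \<notin> DD_at i" if "i \<in> D s" for i using assms that by (auto simp: DD_def)
  have e1: "2 * int (a * (b + 1) - s) = (if 1 \<in> L s j then 2 * (int (N (j - unit_e 1)) - int s) else 0)"
  proof (cases "1 \<in> L s j")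
    case True
    then have "a \<noteq> 0" "(a - 1, b) \<in> D s" using D_shift_iff(1)[of a b s] by (auto simp: L_def j)
    moreover have "N (a - 1, b) = a * (b + 1)" using \<open>a \<noteq> 0\<close> by (simp add: N_def)
    ultimately show ?thesis using True by (simp add: j unit_e_def D_iff)
  next
    case False
    have "a * (b + 1) \<le> s"
    proof (rule ccontr)
      assume "\<not> a * (b + 1) \<le> s"
      then have a: "a \<noteq> 0" "s < N (a - 1, b)" by (cases a; simp add: N_def)+
      then obtain i where i: "i \<in> D s" "i \<le> (a - 1, b)" using D_below by blast
      have "i \<noteq> (a - 1, b)" using False a i D_shift_iff(1)[of a b s] by (auto simp: L_def j)
      then have "j \<in> DD_at i" using i(2) a(1) by (cases i) (auto simp: DD_at_def j unit_e_def)
      then show False using notin i(1) by blast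
    qed
    then show ?thesis using False by simp
  qed
  have e2: "2 * int ((a + 1) * b - s) = (if 2 \<in> L s j then 2 * (int (N (j - unit_e 2)) - int s) else 0)"
  proof (cases "2 \<in> L s j")
    case True
    then have "b \<noteq> 0" "(a, b - 1) \<in> D s" using D_shift_iff(2)[of a b s] by (auto simp: L_def j)
    moreover have "N (a, b - 1) = (a + 1) * b" using \<open>b \<noteq> 0\<close> by (simp add: N_def)
    ultimately show ?thesis using True by (simp add: j unit_e_def D_iff)
  next
    case False
    have "(a + 1) * b \<le> s"
    proof (rule ccontr)
      assume "\<not> (a + 1) * b \<le> s"
      then have b: "b \<noteq> 0" "s < N (a, b - 1)" by (cases b; simp add: N_def)+
      then obtain i where i: "i \<in> D s" "i \<le> (a, b - 1)" using D_below by blast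
      have "i \<noteq> (a, b - 1)" using False b i D_shift_iff(2)[of a b s] by (auto simp: L_def j)
      then have "j \<in> DD_at i" using i(2) b(1) by (cases i) (auto simp: DD_at_def j unit_e_def)
      then show False using notin i(1) by blast
    qed
    then show ?thesis using False by simp
  qed
  have "L s j = {l \<in> {1, 2}. l \<in> L s j}" by (auto simp: L_def)
  then have "(\<Sum>l\<in>L s j. 2 * (int (N (j - unit_e l)) - int s)) =
      (\<Sum>l\<in>{1, 2}. if l \<in> L s j then 2 * (int (N (j - unit_e l)) - int s) else 0)"
    using sum.inter_filter[of "{1, 2}" "\<lambda>l. 2 * (int (N (j - unit_e l)) - int s)" "\<lambda>l. l \<in> L s j"] by simp
  also have "\<dots> = 2 * int (a * (b + 1) - s) + 2 * int ((a + 1) * b - s)"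
    unfolding e1 e2 by simp
  finally have sum: "(\<Sum>l\<in>L s j. 2 * (int (N (j - unit_e l)) - int s)) =
      2 * int (a * (b + 1) - s) + 2 * int ((a + 1) * b - s)" .
  obtain i l where i: "i \<in> D s" "j = i + unit_e l" using assms by (auto simp: DD_def D_shift_def)
  have "N i \<le> N j" by (rule N_mono) (auto simp: i(2) unit_e_def less_eq_prod_def)
  then have "s < N j" using i(1) by (simp add: D_iff)
  then have "int (gens s j) = max 0 (int (N j) - int s -
      (2 * int (a * (b + 1) - s) + 2 * int ((a + 1) * b - s)))"
    by (simp add: gens_def j)
  then show ?thesis by (simp only: sum)
qed

text \<open>If N j > s, such a j lies at least two unit steps above some k in \<open>D s\<close>, so
  N > s already at (a - 2, b), (a, b - 2) or (a - 1, b - 1); the doubled dimensions one step below j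
  then reach N j - s.\<close>

lemma gens_eq_0:
  assumes "j \<notin> D s" "j \<notin> DD s"
  shows "gens s j = 0"
proof (cases "s < N j")
  case False
  then show ?thesis by (simp add: gens_def)
next
  case True
  obtain a b where j: "j = (a, b)" by force
  obtain i where i: "i \<in> D s" "i \<le> j" using D_below[OF True] by blast
  have "\<exists>i\<in>D s. j \<in> DD_at i"
  proof (cases "j \<in> D_shift s 1 \<union> D_shift s 2")
    case True
    then show ?thesis using assms(2) by (auto simp: DD_def)
  next
    case False
    then have "j \<noteq> i + unit_e 1" "j \<noteq> i + unit_e 2" "j \<noteq> i" using i(1) assms(1) by (auto simp: D_shift_def)
    then show ?thesis using i by (auto simp: DD_at_def)
  qed
  then obtain k where k: "k \<in> D s" "j \<in> DD_at k" by blast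
  obtain c d where k': "k = (c, d)" by force
  have kN: "s < N k" using k(1) by (simp add: D_iff)
  define m where "m = a * b"
  have g: "gens s j = m + a + b + 1 - s - 2 * (m + a - s) - 2 * (m + b - s)"
    by (simp add: gens_def N_def m_def j algebra_simps)
  have "c \<le> a" "d \<le> b" "(a, b) \<noteq> (c, d)" "(a, b) \<noteq> (Suc c, d)" "(a, b) \<noteq> (c, Suc d)"
    using k(2) by (auto simp: DD_at_def j k' unit_e_def)
  then consider "c + 2 \<le> a" "d \<le> b" | "c \<le> a" "d + 2 \<le> b" | "c + 1 \<le> a" "d + 1 \<le> b"
    by (cases "a = c"; cases "b = d"; cases "a = Suc c") auto
  then show ?thesis
  proof cases
    case 1
    then have "N k \<le> N (a - 2, b)" unfolding k' by (intro N_mono) auto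
    also have "\<dots> + b + 1 = m + a"
      using 1 by (auto simp: N_def m_def algebra_simps dest!: le_Suc_ex)
    finally show ?thesis using kN g by simp
  next
    case 2
    then have "N k \<le> N (a, b - 2)" unfolding k' by (intro N_mono) auto
    also have "\<dots> + a + 1 = m + b"
      using 2 by (auto simp: N_def m_def algebra_simps dest!: le_Suc_ex)
    finally show ?thesis using kN g by simp
  next
    case 3
    then have "N k \<le> N (a - 1, b - 1)" unfolding k' by (intro N_mono) auto
    also have "\<dots> = m" using 3 by (simp add: N_def m_def)
    finally show ?thesis using kN g by simp
  qed
qed

lemma v11_eq_sum_gens: "v11 s = int (\<Sum>j\<in>D s \<union> DD s. gens s j)"
proof -
  have "int (\<Sum>j\<in>D s \<union> DD s. gens s j) = (\<Sum>j\<in>D s. int (gens s j)) + (\<Sum>j\<in>DD s. int (gens s j))"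
    by (simp add: sum.union_disjoint[OF finite_D finite_DD D_Int_DD])
  then show ?thesis by (simp add: v11_def gens_D gens_DD cong: sum.cong)
qed

section \<open>Evaluation of polynomials\<close>

definition mono_eval :: "('x \<Rightarrow> 'k::comm_semiring_1) \<Rightarrow> ('x \<Rightarrow>\<^sub>0 nat) \<Rightarrow> 'k"
  where "mono_eval a t = (\<Prod>x\<in>Poly_Mapping.keys t. a x ^ Poly_Mapping.lookup t x)"

lemma mono_eval_superset:
  assumes "finite S" "Poly_Mapping.keys t \<subseteq> S"
  shows "mono_eval a t = (\<Prod>x\<in>S. a x ^ Poly_Mapping.lookup t x)"
  unfolding mono_eval_def using assms
  by (intro prod.mono_neutral_left) (auto simp: not_in_keys_iff_lookup_eq_zero)

lemma mono_eval_0 [simp]: "mono_eval a 0 = 1"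
  by (simp add: mono_eval_def)

lemma mono_eval_add: "mono_eval a (t + u) = mono_eval a t * mono_eval a u"
proof -
  let ?S = "Poly_Mapping.keys t \<union> Poly_Mapping.keys u"
  have "Poly_Mapping.keys (t + u) \<subseteq> ?S" by (rule Poly_Mapping.keys_add)
  then show ?thesis
    by (subst (1 2 3) mono_eval_superset[of ?S])
      (auto simp: lookup_add power_add prod.distrib)
qed

lemma mono_eval_single [simp]: "mono_eval a (Poly_Mapping.single x n) = a x ^ n"
  by (subst mono_eval_superset[of "{x}"]) auto

lemma eval_superset:
  assumes "finite S" "Poly_Mapping.keys f \<subseteq> S"
  shows "eval a f = (\<Sum>t\<in>S. Poly_Mapping.lookup f t * mono_eval a t)"
  unfolding eval_def mono_eval_def using assms
  by (intro sum.mono_neutral_left) (auto simp: not_in_keys_iff_lookup_eq_zero)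

lemma eval_0 [simp]: "eval a 0 = 0"
  by (simp add: eval_def)

lemma eval_single [simp]: "eval a (Poly_Mapping.single t c) = c * mono_eval a t"
  by (subst eval_superset[of "{t}"]) auto

lemma eval_1 [simp]: "eval a 1 = 1"
  using eval_single[of a 0 1] by (simp del: eval_single add: single_one)

lemma eval_add [simp]: "eval a (f + g) = eval a f + eval a g"
proof -
  let ?S = "Poly_Mapping.keys f \<union> Poly_Mapping.keys g"
  have "Poly_Mapping.keys (f + g) \<subseteq> ?S" by (rule Poly_Mapping.keys_add)
  then show ?thesis
    by (subst (1 2 3) eval_superset[of ?S])
      (auto simp: lookup_add distrib_right sum.distrib)
qed

lemma eval_sum: "eval a (sum f S) = (\<Sum>x\<in>S. eval a (f x))"
  by (induction S rule: infinite_finite_induct) auto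

lemma poly_mapping_as_sum:
  "(f :: ('x, 'k::comm_ring_1) mpoly) = (\<Sum>t\<in>Poly_Mapping.keys f. Poly_Mapping.single t (Poly_Mapping.lookup f t))"
proof (rule poly_mapping_eqI)
  fix t
  have "(\<Sum>u\<in>Poly_Mapping.keys f. Poly_Mapping.lookup (Poly_Mapping.single u (Poly_Mapping.lookup f u)) t) =
      (\<Sum>u\<in>Poly_Mapping.keys f. if u = t then Poly_Mapping.lookup f t else 0)"
    by (intro sum.cong) (auto simp: lookup_single when_def)
  also have "\<dots> = Poly_Mapping.lookup f t"
    by (simp add: sum.delta not_in_keys_iff_lookup_eq_zero)
  finally show "Poly_Mapping.lookup f t = Poly_Mapping.lookup
      (\<Sum>t\<in>Poly_Mapping.keys f. Poly_Mapping.single t (Poly_Mapping.lookup f t)) t"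
    by (simp add: lookup_sum)
qed

lemma eval_mult [simp]: "eval a (f * g) = eval a f * eval a (g :: ('x, 'k::comm_ring_1) mpoly)"
proof -
  let ?s = "\<lambda>f t. Poly_Mapping.single t (Poly_Mapping.lookup f t)"
  have "f * g = (\<Sum>t\<in>Poly_Mapping.keys f. \<Sum>u\<in>Poly_Mapping.keys g. ?s f t * ?s g u)"
    by (subst poly_mapping_as_sum[of f], subst poly_mapping_as_sum[of g]) (simp only: sum_product)
  also have "eval a \<dots> = (\<Sum>t\<in>Poly_Mapping.keys f. \<Sum>u\<in>Poly_Mapping.keys g. eval a (?s f t) * eval a (?s g u))"
    by (simp add: eval_sum mult_single mono_eval_add mult_ac)
  also have "\<dots> = eval a (\<Sum>t\<in>Poly_Mapping.keys f. ?s f t) * eval a (\<Sum>t\<in>Poly_Mapping.keys g. ?s g t)"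
    by (simp only: sum_product eval_sum)
  finally show ?thesis by (simp only: poly_mapping_as_sum[symmetric])
qed

lemma eval_uminus [simp]: "eval a (- f) = - eval a (f :: ('x, 'k::comm_ring_1) mpoly)"
  using eval_add[of a f "- f"] by (simp add: eq_neg_iff_add_eq_0 add.commute del: eval_add)

text \<open>Moves evaluation through products and determinants.\<close>

interpretation eval: comm_ring_hom "eval a :: ('x, 'k::comm_ring_1) mpoly \<Rightarrow> 'k"
  by unfold_locales auto

section \<open>Multihomogeneous forms\<close>

text \<open>In \<open>multiform\<close> the multidegree is existentially hidden; naming it lets
  degrees add up in products and determinants.\<close>

definition mhom :: "nat \<Rightarrow> (nat \<Rightarrow> nat \<times> nat) \<Rightarrow> (nat \<times> var, 'k::zero) mpoly \<Rightarrow> bool"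
  where "mhom s d F \<longleftrightarrow> (\<forall>t\<in>Poly_Mapping.keys F. Poly_Mapping.keys t \<subseteq> {..<s} \<times> UNIV \<and>
    (\<forall>j<s. Poly_Mapping.lookup t (j, X10) + Poly_Mapping.lookup t (j, X11) = fst (d j) \<and>
       Poly_Mapping.lookup t (j, X20) + Poly_Mapping.lookup t (j, X21) = snd (d j)))"

lemma mhom_imp_multiform: "mhom s d F \<Longrightarrow> multiform s F"
  unfolding mhom_def multiform_def by blast

lemma mhom_0 [simp]: "mhom s d 0"
  by (simp add: mhom_def)

lemma mhom_1 [simp]: "mhom s 0 (1 :: (nat \<times> var, 'k::comm_ring_1) mpoly)"
  by (simp add: mhom_def)

lemma mhom_add: "mhom s d F \<Longrightarrow> mhom s d G \<Longrightarrow> mhom s d (F + G)"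
  using Poly_Mapping.keys_add[of F G] unfolding mhom_def by blast

lemma mhom_sum: "(\<And>x. x \<in> S \<Longrightarrow> mhom s d (F x)) \<Longrightarrow> mhom s d (sum F S)"
  by (induction S rule: infinite_finite_induct) (auto intro: mhom_add)

lemma mhom_uminus: "mhom s d F \<Longrightarrow> mhom s d (- F :: (nat \<times> var, 'k::comm_ring_1) mpoly)"
  by (simp add: mhom_def in_keys_iff)

lemma mhom_mult:
  assumes "mhom s d F" "mhom s e G"
  shows "mhom s (d + e) (F * G :: (nat \<times> var, 'k::comm_ring_1) mpoly)"
  unfolding mhom_def
proof
  fix t assume "t \<in> Poly_Mapping.keys (F * G)"
  then obtain u v where uv: "t = u + v" "u \<in> Poly_Mapping.keys F" "v \<in> Poly_Mapping.keys G"
    using Poly_Mapping.keys_mult[of F G] by auto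
  have "Poly_Mapping.keys t \<subseteq> Poly_Mapping.keys u \<union> Poly_Mapping.keys v"
    unfolding uv(1) by (rule Poly_Mapping.keys_add)
  moreover have "Poly_Mapping.keys u \<union> Poly_Mapping.keys v \<subseteq> {..<s} \<times> UNIV"
    using uv(2,3) assms unfolding mhom_def by blast
  moreover have "Poly_Mapping.lookup t (j, X10) + Poly_Mapping.lookup t (j, X11) = fst ((d + e) j) \<and>
       Poly_Mapping.lookup t (j, X20) + Poly_Mapping.lookup t (j, X21) = snd ((d + e) j)" if "j < s" for j
  proof -
    have "fst (d j) = Poly_Mapping.lookup u (j, X10) + Poly_Mapping.lookup u (j, X11)"
      "snd (d j) = Poly_Mapping.lookup u (j, X20) + Poly_Mapping.lookup u (j, X21)"
      "fst (e j) = Poly_Mapping.lookup v (j, X10) + Poly_Mapping.lookup v (j, X11)"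
      "snd (e j) = Poly_Mapping.lookup v (j, X20) + Poly_Mapping.lookup v (j, X21)"
      using assms uv(2,3) that unfolding mhom_def by metis+
    then show ?thesis by (simp add: uv(1) lookup_add)
  qed
  ultimately show "Poly_Mapping.keys t \<subseteq> {..<s} \<times> UNIV \<and>
    (\<forall>j<s. Poly_Mapping.lookup t (j, X10) + Poly_Mapping.lookup t (j, X11) = fst ((d + e) j) \<and>
       Poly_Mapping.lookup t (j, X20) + Poly_Mapping.lookup t (j, X21) = snd ((d + e) j))" by blast
qed

lemma mhom_prod:
  assumes "\<And>x. x \<in> S \<Longrightarrow> mhom s (d x) (F x)"
  shows "mhom s (sum d S) (prod F S :: (nat \<times> var, 'k::comm_ring_1) mpoly)"
  using assms
  by (induction S rule: infinite_finite_induct) (auto intro: mhom_mult)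

text \<open>Every product in the Leibniz formula takes one entry from each row, so all of them have
  the same multidegree.\<close>

lemma mhom_det:
  assumes "\<And>i j. i < n \<Longrightarrow> j < n \<Longrightarrow> mhom s (d i) (M i j :: (nat \<times> var, 'k::comm_ring_1) mpoly)"
  shows "mhom s (\<Sum>i<n. d i) (Determinant.det (mat n n (\<lambda>(i, j). M i j)))"
proof -
  have summand: "mhom s (\<Sum>i<n. d i) (signof p * (\<Prod>i = 0..<n. mat n n (\<lambda>(i, j). M i j) $$ (i, p i)))"
    if p: "p permutes {0..<n}" for p
  proof -
    have p': "p i < n" if "i < n" for i
      using permutes_in_image[OF p, of i] that by simp
    have "(\<Prod>i = 0..<n. mat n n (\<lambda>(i, j). M i j) $$ (i, p i)) = (\<Prod>i<n. M i (p i))"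
      unfolding lessThan_atLeast0
    proof (rule prod.cong[OF refl])
      fix i assume "i \<in> {0..<n}"
      then show "mat n n (\<lambda>(i, j). M i j) $$ (i, p i) = M i (p i)" using p' by simp
    qed
    moreover have "mhom s (\<Sum>i<n. d i) (\<Prod>i<n. M i (p i))"
      by (rule mhom_prod) (use p' assms in simp)
    ultimately show ?thesis
      by (cases "evenperm p") (simp_all add: sign_def mhom_uminus)
  qed
  have "mat n n (\<lambda>(i, j). M i j) \<in> carrier_mat n n" by simp
  then show ?thesis
    unfolding det_def'[OF \<open>mat n n (\<lambda>(i, j). M i j) \<in> carrier_mat n n\<close>]
    by (intro mhom_sum summand) simp
qed

section \<open>Homogenization\<close>

definition hmono :: "(var \<Rightarrow> 'x) \<Rightarrow> nat \<Rightarrow> nat \<Rightarrow> nat \<Rightarrow> nat \<Rightarrow> 'x \<Rightarrow>\<^sub>0 nat"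
  where "hmono \<iota> a b i l = Poly_Mapping.single (\<iota> X10) (a - i) + Poly_Mapping.single (\<iota> X11) i +
    Poly_Mapping.single (\<iota> X20) (b - l) + Poly_Mapping.single (\<iota> X21) l"

text \<open>The map \<iota> selects a copy of the four variables: \<open>Pair k\<close> gives the
  coordinates of the k-th point in the s-fold product, \<open>id\<close> gives R itself. The sums
  stay within i <= a and l <= b, where the exponents in \<open>hmono\<close> are exact.\<close>

definition homog :: "(var \<Rightarrow> 'x) \<Rightarrow> nat \<Rightarrow> nat \<Rightarrow> 'k::field poly2 \<Rightarrow> ('x, 'k) mpoly"
  where "homog \<iota> a b p = (\<Sum>i\<le>a. \<Sum>l\<le>b. Poly_Mapping.single (hmono \<iota> a b i l) (coeff (coeff p i) l))"

lemma homog_simps: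
  "homog \<iota> a b (p + q) = homog \<iota> a b p + homog \<iota> a b q" "homog \<iota> a b 0 = 0"
  by (simp_all add: homog_def single_add sum.distrib)

lemma homog_scale: "homog \<iota> a b (smult [:c:] p) = const c * homog \<iota> a b p"
  by (simp add: homog_def const_def sum_distrib_left mult_single)

lemma eval_homog_raw:
  "eval \<alpha> (homog \<iota> a b p) = (\<Sum>i\<le>a. \<Sum>l\<le>b. coeff (coeff p i) l *
    (\<alpha> (\<iota> X10) ^ (a - i) * \<alpha> (\<iota> X11) ^ i * \<alpha> (\<iota> X20) ^ (b - l) * \<alpha> (\<iota> X21) ^ l))"
  by (simp add: homog_def hmono_def eval_sum mono_eval_add)

lemma poly_eq_sum_atMost: "degree (p :: 'a::comm_semiring_1 poly) \<le> n \<Longrightarrow> poly p x = (\<Sum>i\<le>n. coeff p i * x ^ i)"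
  by (subst poly_altdef, rule sum.mono_neutral_left) (auto simp: coeff_eq_0)

lemma ev_PP:
  assumes "p \<in> PP (Suc a) (Suc b)"
  shows "ev z p = (\<Sum>i\<le>a. \<Sum>l\<le>b. coeff (coeff p i) l * (fst z ^ i * snd z ^ l))"
proof -
  have "degree p \<le> a"
    by (rule degree_le) (use assms in \<open>force simp: PP_def poly_eq_iff\<close>)
  then have "poly p [:fst z:] = (\<Sum>i\<le>a. coeff p i * [:fst z:] ^ i)"
    by (rule poly_eq_sum_atMost)
  then have "ev z p = (\<Sum>i\<le>a. poly (coeff p i) (snd z) * fst z ^ i)"
    by (simp add: ev_def poly_sum poly_const_pow mult.commute)
  also have "\<dots> = (\<Sum>i\<le>a. (\<Sum>l\<le>b. coeff (coeff p i) l * snd z ^ l) * fst z ^ i)"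
  proof (intro sum.cong refl)
    fix i
    have "degree (coeff p i) \<le> b"
      by (rule degree_le) (use assms in \<open>force simp: PP_def\<close>)
    then show "poly (coeff p i) (snd z) * fst z ^ i = (\<Sum>l\<le>b. coeff (coeff p i) l * snd z ^ l) * fst z ^ i"
      by (simp add: poly_eq_sum_atMost)
  qed
  finally show ?thesis by (simp add: sum_distrib_left sum_distrib_right mult_ac)
qed

lemma eval_homog:
  fixes p :: "'k::field poly2"
  assumes "p \<in> PP (Suc a) (Suc b)" and nz: "\<alpha> (\<iota> X10) \<noteq> 0" "\<alpha> (\<iota> X20) \<noteq> 0"
  shows "eval \<alpha> (homog \<iota> a b p) = \<alpha> (\<iota> X10) ^ a * \<alpha> (\<iota> X20) ^ b *
    ev (\<alpha> (\<iota> X11) / \<alpha> (\<iota> X10), \<alpha> (\<iota> X21) / \<alpha> (\<iota> X20)) p"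
proof -
  have pw: "x ^ a * (y / x) ^ i = x ^ (a - i) * y ^ i" if "i \<le> a" "x \<noteq> 0" for x y :: 'k and a i
    using that by (simp add: power_diff power_divide)
  show ?thesis
    unfolding eval_homog_raw ev_PP[OF assms(1)] sum_distrib_left
  proof (intro sum.cong refl)
    fix i l assume "i \<in> {..a}" "l \<in> {..b}"
    then have "\<alpha> (\<iota> X10) ^ a * (\<alpha> (\<iota> X11) / \<alpha> (\<iota> X10)) ^ i = \<alpha> (\<iota> X10) ^ (a - i) * \<alpha> (\<iota> X11) ^ i"
      "\<alpha> (\<iota> X20) ^ b * (\<alpha> (\<iota> X21) / \<alpha> (\<iota> X20)) ^ l = \<alpha> (\<iota> X20) ^ (b - l) * \<alpha> (\<iota> X21) ^ l"
      using nz pw by auto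
    then show "coeff (coeff p i) l *
       (\<alpha> (\<iota> X10) ^ (a - i) * \<alpha> (\<iota> X11) ^ i * \<alpha> (\<iota> X20) ^ (b - l) * \<alpha> (\<iota> X21) ^ l) =
       \<alpha> (\<iota> X10) ^ a * \<alpha> (\<iota> X20) ^ b * (coeff (coeff p i) l *
        (fst (\<alpha> (\<iota> X11) / \<alpha> (\<iota> X10), \<alpha> (\<iota> X21) / \<alpha> (\<iota> X20)) ^ i *
         snd (\<alpha> (\<iota> X11) / \<alpha> (\<iota> X10), \<alpha> (\<iota> X21) / \<alpha> (\<iota> X20)) ^ l))"
      by (simp add: mult_ac)
  qed
qed

lemma lookup_hmono:
  assumes "inj \<iota>"
  shows "Poly_Mapping.lookup (hmono \<iota> a b i l) (\<iota> X10) = a - i"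
    "Poly_Mapping.lookup (hmono \<iota> a b i l) (\<iota> X11) = i"
    "Poly_Mapping.lookup (hmono \<iota> a b i l) (\<iota> X20) = b - l"
    "Poly_Mapping.lookup (hmono \<iota> a b i l) (\<iota> X21) = l"
  using inj_eq[OF assms] by (simp_all add: hmono_def lookup_add lookup_single when_def)

lemma keys_homog: "t \<in> Poly_Mapping.keys (homog \<iota> a b p) \<Longrightarrow> \<exists>i l. i \<le> a \<and> l \<le> b \<and> t = hmono \<iota> a b i l"
proof -
  assume "t \<in> Poly_Mapping.keys (homog \<iota> a b p)"
  then have "(\<Sum>i\<le>a. \<Sum>l\<le>b. Poly_Mapping.lookup (Poly_Mapping.single (hmono \<iota> a b i l) (coeff (coeff p i) l)) t) \<noteq> 0"
    by (simp add: in_keys_iff homog_def lookup_sum)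
  then obtain i l where "i \<le> a" "l \<le> b"
    "Poly_Mapping.lookup (Poly_Mapping.single (hmono \<iota> a b i l) (coeff (coeff p i) l)) t \<noteq> 0"
    by (meson atMost_iff sum.not_neutral_contains_not_neutral)
  then show ?thesis by (auto simp: lookup_single when_def split: if_splits)
qed

lemma mhom_homog:
  assumes "k < s"
  shows "mhom s (\<lambda>j. if j = k then (a, b) else (0, 0)) (homog (Pair k) a b p)"
  unfolding mhom_def
proof
  fix t assume "t \<in> Poly_Mapping.keys (homog (Pair k) a b p)"
  then obtain i l where t: "i \<le> a" "l \<le> b" "t = hmono (Pair k) a b i l" using keys_homog by blast
  have "inj (Pair k :: var \<Rightarrow> nat \<times> var)" by (auto simp: inj_def)
  note lk = lookup_hmono[OF this, of a b i l]
  have other: "Poly_Mapping.lookup t (j, x) = 0" if "j \<noteq> k" for j x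
    using that by (simp add: t(3) hmono_def lookup_add lookup_single when_def)
  then have "Poly_Mapping.keys t \<subseteq> {..<s} \<times> UNIV"
    using assms by (force simp: in_keys_iff)
  moreover have "\<forall>j<s. Poly_Mapping.lookup t (j, X10) + Poly_Mapping.lookup t (j, X11) = fst (if j = k then (a, b) else (0, 0)) \<and>
      Poly_Mapping.lookup t (j, X20) + Poly_Mapping.lookup t (j, X21) = snd (if j = k then (a, b) else (0, 0))"
    using other lk t by auto
  ultimately show "Poly_Mapping.keys t \<subseteq> {..<s} \<times> UNIV \<and>
    (\<forall>j<s. Poly_Mapping.lookup t (j, X10) + Poly_Mapping.lookup t (j, X11) = fst (if j = k then (a, b) else (0, 0)) \<and>
      Poly_Mapping.lookup t (j, X20) + Poly_Mapping.lookup t (j, X21) = snd (if j = k then (a, b) else (0, 0)))" by blast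
qed

section \<open>Openness of dimension bounds\<close>

context vector_space
begin

text \<open>Gaussian elimination: pick a functional that is nonzero on V and pass to its kernel,
  where all later vectors live. The resulting m by m matrix is triangular with nonzero diagonal, and
  m is the rank of the conditions on V.\<close>

lemma triangular_functionals:
  assumes lin: "\<And>r. r \<in> R \<Longrightarrow> Vector_Spaces.linear scale (*) (f r)"
    and V: "subspace V" "local.fin_dim V"
  shows "\<exists>m vs rs. (\<forall>i<m. vs i \<in> V \<and> rs i \<in> R \<and> f (rs i) (vs i) \<noteq> 0) \<and>
    (\<forall>i j. i < j \<longrightarrow> j < m \<longrightarrow> f (rs i) (vs j) = 0) \<and>
    dim V = m + dim {v \<in> V. \<forall>r\<in>R. f r v = 0}"
  using V
proof (induction "dim V" arbitrary: V rule: less_induct)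
  case less
  show ?case
  proof (cases "\<forall>v\<in>V. \<forall>r\<in>R. f r v = 0")
    case True
    then have "{v \<in> V. \<forall>r\<in>R. f r v = 0} = V" by blast
    then show ?thesis by (intro exI[of _ 0]) auto
  next
    case False
    then obtain v r where vr: "v \<in> V" "r \<in> R" "f r v \<noteq> 0" by blast
    interpret fr: Vector_Spaces.linear scale "(*)" "f r" by (rule lin[OF vr(2)])
    define V' where "V' = {v \<in> V. f r v = 0}"
    have dV: "dim V = Suc (dim V')"
      unfolding V'_def by (rule dim_functional_kernel(2)[OF lin[OF vr(2)] less.prems(2,1) vr(1,3)])
    have V': "subspace V'" "local.fin_dim V'"
      using less.prems unfolding V'_def
      by (auto simp: subspace_def fr.add fr.scale intro: fin_dim_subset)
    obtain m vs rs where IH: "\<forall>i<m. vs i \<in> V' \<and> rs i \<in> R \<and> f (rs i) (vs i) \<noteq> 0"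
        "\<forall>i j. i < j \<longrightarrow> j < m \<longrightarrow> f (rs i) (vs j) = 0"
        "dim V' = m + dim {v \<in> V'. \<forall>r\<in>R. f r v = 0}"
      using less.hyps[OF _ V'] dV by auto
    have K: "{v \<in> V'. \<forall>r\<in>R. f r v = 0} = {v \<in> V. \<forall>r\<in>R. f r v = 0}"
      using vr(2) by (auto simp: V'_def)
    show ?thesis
    proof (intro exI conjI allI impI)
      show "dim V = Suc m + dim {v \<in> V. \<forall>r\<in>R. f r v = 0}"
        using dV IH(3) K by simp
      fix i assume i: "i < Suc m"
      show "case_nat v vs i \<in> V" "case_nat r rs i \<in> R" "f (case_nat r rs i) (case_nat v vs i) \<noteq> 0"
        using vr IH(1) i by (auto simp: V'_def split: nat.split)
    next
      fix i j assume "i < j" "j < Suc m"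
      then show "f (case_nat r rs i) (case_nat v vs j) = 0"
        using IH(1,2) by (auto simp: V'_def split: nat.split)
    qed
  qed
qed

text \<open>The columns of the inverse matrix yield vectors dual to the functionals, so each
  functional is nonzero on the common kernel of the earlier ones and cuts off one dimension.\<close>

lemma dim_functionals_le:
  assumes lin: "\<And>i. i < m \<Longrightarrow> Vector_Spaces.linear scale (*) (f i)"
    and V: "subspace V" "local.fin_dim V"
    and vs: "\<And>i. i < m \<Longrightarrow> vs i \<in> V"
    and det: "Determinant.det (mat m m (\<lambda>(i, j). f i (vs j))) \<noteq> 0"
  shows "m + dim {v \<in> V. \<forall>i<m. f i v = 0} \<le> dim V"
proof -
  let ?M = "mat m m (\<lambda>(i, j). f i (vs j))"
  obtain B where B: "B \<in> carrier_mat m m" "?M * B = 1\<^sub>m m"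
    using det_non_zero_imp_unit[OF _ det, of m "()"]
    unfolding Units_def ring_mat_def by auto
  define u where "u j = (\<Sum>l<m. scale (B $$ (l, j)) (vs l))" for j
  have uV: "u j \<in> V" for j
    unfolding u_def using V(1) vs by (intro subspace_sum subspace_scale) auto
  have fu: "f i (u j) = (if i = j then 1 else 0)" if "i < m" "j < m" for i j
  proof -
    interpret fi: Vector_Spaces.linear scale "(*)" "f i" by (rule lin[OF that(1)])
    have "f i (u j) = (\<Sum>l<m. B $$ (l, j) * f i (vs l))"
      unfolding u_def fi.sum fi.scale ..
    also have "\<dots> = (?M * B) $$ (i, j)"
      using that B(1) by (auto simp: scalar_prod_def lessThan_atLeast0 mult.commute intro!: sum.cong)
    finally show ?thesis using that by (simp add: B(2))
  qed
  have "n + dim {v \<in> V. \<forall>i<n. f i v = 0} \<le> dim V" if "n \<le> m" for n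
    using that
  proof (induction n)
    case 0
    then show ?case by simp
  next
    case (Suc n)
    let ?V = "{v \<in> V. \<forall>i<n. f i v = 0}"
    have "subspace ?V"
    proof (rule subspaceI)
      have "f i 0 = 0" if "i < m" for i
      proof -
        interpret fi: Vector_Spaces.linear scale "(*)" "f i" by (rule lin[OF that])
        show ?thesis by (rule fi.zero)
      qed
      then show "0 \<in> ?V" using Suc.prems subspace_0[OF V(1)] by auto
      show "x + y \<in> ?V" if "x \<in> ?V" "y \<in> ?V" for x y
        using that Suc.prems subspace_add[OF V(1)] lin unfolding Vector_Spaces.linear_iff by auto
      show "scale c x \<in> ?V" if "x \<in> ?V" for c x
        using that Suc.prems subspace_scale[OF V(1)] lin unfolding Vector_Spaces.linear_iff by auto
    qed
    moreover have "local.fin_dim ?V" by (rule fin_dim_subset[OF V(2)]) auto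
    moreover have "u n \<in> ?V" "f n (u n) \<noteq> 0" using uV fu Suc.prems by auto
    ultimately have "dim ?V = Suc (dim {v \<in> ?V. f n v = 0})"
      using Suc.prems by (intro dim_functional_kernel(2)[OF lin]) auto
    moreover have "{v \<in> ?V. f n v = 0} = {v \<in> V. \<forall>i<Suc n. f i v = 0}"
      by (auto simp: less_Suc_eq)
    ultimately show ?case using Suc by simp
  qed
  then show ?thesis by blast
qed

text \<open>Semicontinuity: F is a minor of maximal size that is nonzero at \<open>a0\<close>. Where
  it stays nonzero the rank of the conditions cannot drop, and as it is multihomogeneous, this locus
  is Zariski open.\<close>

lemma open_dim_bound:
  fixes E :: "'r \<Rightarrow> 'b \<Rightarrow> (nat \<times> var, 'a) mpoly"
  assumes lin: "\<And>r a. r \<in> R \<Longrightarrow> Vector_Spaces.linear scale (*) (\<lambda>v. eval a (E r v))"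
    and hom: "\<And>r v. r \<in> R \<Longrightarrow> mhom s (\<delta> r) (E r v)"
    and H: "subspace H" "local.fin_dim H"
  shows "\<exists>F d. mhom s d F \<and> eval a0 F \<noteq> 0 \<and> (\<forall>a. eval a F \<noteq> 0 \<longrightarrow>
    dim {v \<in> H. \<forall>r\<in>R. eval a (E r v) = 0} \<le> dim {v \<in> H. \<forall>r\<in>R. eval a0 (E r v) = 0})"
proof -
  obtain m vs rs where T: "\<forall>i<m. vs i \<in> H \<and> rs i \<in> R \<and> eval a0 (E (rs i) (vs i)) \<noteq> 0"
      "\<forall>i j. i < j \<longrightarrow> j < m \<longrightarrow> eval a0 (E (rs i) (vs j)) = 0"
      "dim H = m + dim {v \<in> H. \<forall>r\<in>R. eval a0 (E r v) = 0}"
    using triangular_functionals[of R "\<lambda>r v. eval a0 (E r v)" H, OF lin H] by blast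
  let ?M = "mat m m (\<lambda>(i, j). E (rs i) (vs j))"
  define F where "F = Determinant.det ?M"
  have ev: "eval a F = Determinant.det (mat m m (\<lambda>(i, j). eval a (E (rs i) (vs j))))" for a
  proof -
    have "map_mat (eval a) ?M = mat m m (\<lambda>(i, j). eval a (E (rs i) (vs j)))" by (rule eq_matI) auto
    then show ?thesis unfolding F_def by (metis eval.hom_det)
  qed
  show ?thesis
  proof (intro exI conjI allI impI)
    show "mhom s (\<Sum>i<m. \<delta> (rs i)) F"
      unfolding F_def using T(1) hom by (intro mhom_det) auto
    let ?A = "mat m m (\<lambda>(i, j). eval a0 (E (rs i) (vs j)))"
    have "Determinant.det ?A = prod_list (diag_mat ?A)"
      using T(2) by (intro det_lower_triangular[of m]) auto
    also have "\<dots> \<noteq> 0"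
      using T(1) by (auto simp: diag_mat_def prod_list_zero_iff)
    finally show "eval a0 F \<noteq> 0" by (simp add: ev)
    fix a assume "eval a F \<noteq> 0"
    then have "m + dim {v \<in> H. \<forall>i<m. eval a (E (rs i) v) = 0} \<le> dim H"
      using T(1) lin H by (intro dim_functionals_le[where vs = vs]) (auto simp: ev)
    moreover have "dim {v \<in> H. \<forall>r\<in>R. eval a (E r v) = 0} \<le> dim {v \<in> H. \<forall>i<m. eval a (E (rs i) v) = 0}"
      using T(1) by (intro dim_mono_fin_dim fin_dim_subset[OF H(2)]) auto
    ultimately show "dim {v \<in> H. \<forall>r\<in>R. eval a (E r v) = 0} \<le> dim {v \<in> H. \<forall>r\<in>R. eval a0 (E r v) = 0}"
      using T(3) by linarith
  qed
qed

end

section \<open>General coordinates\<close>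

text \<open>Unlike \<open>chart\<close>, this condition persists along the line joining two
  coordinate vectors, as \<open>common_nonvanishing\<close> requires.\<close>

definition affine_coords :: "(nat \<times> var \<Rightarrow> 'k::field) \<Rightarrow> bool"
  where "affine_coords a \<longleftrightarrow> (\<forall>j. a (j, X10) = 1 \<and> a (j, X20) = 1)"

text \<open>Restrict to the line joining the two coordinate vectors.\<close>

lemma common_nonvanishing:
  fixes F :: "'l \<Rightarrow> (nat \<times> var, 'k::field_char_0) mpoly"
  assumes "finite \<Lambda>" "\<And>l. l \<in> \<Lambda> \<Longrightarrow> \<exists>a. affine_coords a \<and> eval a (F l) \<noteq> 0"
  shows "\<exists>a. affine_coords a \<and> (\<forall>l\<in>\<Lambda>. eval a (F l) \<noteq> 0)"
  using assms
proof (induction \<Lambda>)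
  case empty
  have "affine_coords (\<lambda>_. 1 :: 'k)" by (simp add: affine_coords_def)
  then show ?case by blast
next
  case (insert m \<Lambda>)
  obtain a where a: "affine_coords a" "\<forall>l\<in>\<Lambda>. eval a (F l) \<noteq> 0" using insert by auto
  obtain b where b: "affine_coords b" "eval b (F m) \<noteq> 0" using insert.prems by auto
  define c where "c \<tau> x = a x + \<tau> * (b x - a x)" for \<tau> x
  define p where "p G = (\<Sum>t\<in>Poly_Mapping.keys G. [:Poly_Mapping.lookup G t:] *
    (\<Prod>x\<in>Poly_Mapping.keys t. [:a x, b x - a x:] ^ Poly_Mapping.lookup t x))" for G :: "(nat \<times> var, 'k) mpoly"
  have p: "poly (p G) \<tau> = eval (c \<tau>) G" for G \<tau>
    by (simp add: p_def eval_def poly_sum poly_prod c_def)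
  have c01: "c 0 = a" "c 1 = b" by (auto simp: c_def)
  have "p (F l) \<noteq> 0" if "l \<in> insert m \<Lambda>" for l
  proof
    assume "p (F l) = 0"
    then have "eval a (F l) = 0" "eval b (F l) = 0" using p[of "F l" 0] p[of "F l" 1] c01 by auto
    then show False using that a b by auto
  qed
  then have "(\<Prod>l\<in>insert m \<Lambda>. p (F l)) \<noteq> 0" using insert.hyps by simp
  then obtain \<tau> where "poly (\<Prod>l\<in>insert m \<Lambda>. p (F l)) \<tau> \<noteq> 0"
    using ex_new_if_finite[OF infinite_UNIV_char_0 poly_roots_finite] by blast
  then have "\<forall>l\<in>insert m \<Lambda>. eval (c \<tau>) (F l) \<noteq> 0"
    using insert.hyps by (simp add: poly_prod p)
  moreover have "affine_coords (c \<tau>)" using a b by (simp add: affine_coords_def c_def)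
  ultimately show ?case by blast
qed

definition zpt :: "(nat \<times> var \<Rightarrow> 'k::field) \<Rightarrow> nat \<Rightarrow> 'k \<times> 'k"
  where "zpt a k = (a (k, X11) / a (k, X10), a (k, X21) / a (k, X20))"

definition chart :: "nat \<Rightarrow> (nat \<times> var \<Rightarrow> 'k::field) \<Rightarrow> bool"
  where "chart s a \<longleftrightarrow> (\<forall>k<s. a (k, X10) \<noteq> 0 \<and> a (k, X20) \<noteq> 0)"

lemma affine_coords_chart: "affine_coords a \<Longrightarrow> chart s a"
  by (simp add: affine_coords_def chart_def)

lemma eval_const [simp]: "eval a (const c) = c"
  by (simp add: const_def)

lemma exists_affine_coords:
  assumes "finite Z" "card Z = s"
  obtains a :: "nat \<times> var \<Rightarrow> 'k::field" where "affine_coords a" "zpt a ` {..<s} = Z"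
proof -
  obtain e where e: "bij_betw e {..<s} Z"
    using ex_bij_betw_nat_finite[OF assms(1)] assms(2) by (auto simp: lessThan_atLeast0)
  define a :: "nat \<times> var \<Rightarrow> 'k" where "a = (\<lambda>(k, x). case x of X10 \<Rightarrow> 1 | X11 \<Rightarrow> fst (e k) | X20 \<Rightarrow> 1 | X21 \<Rightarrow> snd (e k))"
  have "zpt a k = e k" for k by (simp add: zpt_def a_def)
  then have "zpt a ` {..<s} = Z" using e by (simp add: bij_betw_def cong: image_cong)
  moreover have "affine_coords a" by (simp add: affine_coords_def a_def)
  ultimately show ?thesis using that by blast
qed

lemma eval_homog_eq_0_iff:
  assumes "chart s a" "k < s" "p \<in> PP A B" "0 < A" "0 < B"
  shows "eval a (homog (Pair k) (A - 1) (B - 1) p) = 0 \<longleftrightarrow> ev (zpt a k) p = 0"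
  using eval_homog[of p "A - 1" "B - 1" a "Pair k"] assms by (simp add: chart_def zpt_def)

lemma dim_II_0:
  assumes "A = 0 \<or> B = 0"
  shows "pp.dim (II A B Z) = 0"
proof -
  have "II A B Z \<subseteq> {0}" using assms by (auto simp: II_def PP_0)
  then have "pp.dim (II A B Z) \<le> pp.dim {0 :: 'a poly2}"
    by (rule pp.dim_mono_fin_dim[OF pp.fin_dim_zero])
  then show ?thesis by (simp add: pp.dim_zero)
qed

lemma open_dim_II:
  "\<exists>F d. mhom s d F \<and> (\<exists>a. affine_coords a \<and> eval a F \<noteq> 0) \<and>
    (\<forall>a. chart s a \<longrightarrow> eval a F \<noteq> 0 \<longrightarrow> pp.dim (II A B (zpt a ` {..<s}) :: 'k::field_char_0 poly2 set) \<le> A * B - s)"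
proof (cases "A = 0 \<or> B = 0")
  \<comment> \<open>Homogenizing in bidegree (A - 1, B - 1) makes sense only for positive A and B;
    otherwise the space is zero and the form 1 serves.\<close>
  case True
  then have "pp.dim (II A B X :: 'k poly2 set) = 0" for X by (rule dim_II_0)
  moreover have "affine_coords (\<lambda>_. 1 :: 'k)" by (simp add: affine_coords_def)
  ultimately show ?thesis
    by (intro exI[of _ 1] exI[of _ 0]) auto
next
  case False
  then have AB: "0 < A" "0 < B" by auto
  obtain Z :: "('k \<times> 'k) set" where Z: "finite Z" "card Z = s" "pp.dim (II A B Z) \<le> A * B - s"
    using exists_general_points[of "{(A, B)}" s] by auto
  obtain a0 :: "nat \<times> var \<Rightarrow> 'k" where a0: "affine_coords a0" "zpt a0 ` {..<s} = Z"
    using exists_affine_coords[OF Z(1,2)] .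
  let ?E = "\<lambda>k. homog (Pair k) (A - 1) (B - 1) :: 'k poly2 \<Rightarrow> _"
  have "\<exists>F d. mhom s d F \<and> eval a0 F \<noteq> 0 \<and> (\<forall>a. eval a F \<noteq> 0 \<longrightarrow>
    pp.dim {v \<in> PP A B. \<forall>r\<in>{..<s}. eval a (?E r v) = 0} \<le> pp.dim {v \<in> PP A B. \<forall>r\<in>{..<s}. eval a0 (?E r v) = 0})"
  proof (rule pp.open_dim_bound)
    show "Vector_Spaces.linear (\<lambda>c p. smult [:c:] p) (*) (\<lambda>v. eval a (?E r v))" for r a
      by (rule pp.linear_functionalI) (auto simp: homog_simps homog_scale simp del: smult_pCons)
  qed (auto intro: mhom_homog subspace_PP dim_PP)
  then obtain F d where F: "mhom s d F" "eval a0 F \<noteq> 0"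
    "\<And>a. eval a F \<noteq> 0 \<Longrightarrow> pp.dim {v \<in> PP A B. \<forall>r\<in>{..<s}. eval a (?E r v) = 0}
      \<le> pp.dim {v \<in> PP A B. \<forall>r\<in>{..<s}. eval a0 (?E r v) = 0}" by blast
  have II: "{v \<in> PP A B. \<forall>r\<in>{..<s}. eval a (?E r v) = 0} = II A B (zpt a ` {..<s})" if "chart s a" for a
    using eval_homog_eq_0_iff[OF that _ _ AB] unfolding II_def by blast
  show ?thesis
  proof (intro exI conjI allI impI)
    fix a assume "chart s a" "eval a F \<noteq> 0"
    then show "pp.dim (II A B (zpt a ` {..<s})) \<le> A * B - s"
      using F(3)[of a] Z(3) a0(2) unfolding II[OF \<open>chart s a\<close>] II[OF affine_coords_chart[OF a0(1)]]
      by simp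
  qed (use F a0 in auto)
qed

text \<open>Semicontinuity transfers the bound from the special points of
  \<open>exists_good_points\<close>; a condition is indexed by a point and one of the four
  entries.\<close>

lemma open_dim_KK:
  assumes s: "0 < s" and ab: "a * b \<le> s" "s - a * b \<le> a" "s - a * b \<le> b"
  shows "\<exists>F d. mhom s d F \<and> (\<exists>\<alpha>. affine_coords \<alpha> \<and> eval \<alpha> F \<noteq> 0) \<and>
    (\<forall>\<alpha>. chart s \<alpha> \<longrightarrow> eval \<alpha> F \<noteq> 0 \<longrightarrow>
      tup.dim (KK a b (zpt \<alpha> ` {..<s}) :: 'k::field_char_0 tuple set) \<le> a + b - 1 - 3 * (s - a * b))"
proof -
  \<comment> \<open>If a or b were 0, the side conditions would give s <= 0.\<close>
  have pos: "0 < a" "0 < b" using s ab by (auto intro: Nat.gr0I)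
  obtain Z :: "('k \<times> 'k) set" where "good_points a b (s - a * b) Z"
    using exists_good_points[OF ab(2,3)] .
  then have Z: "finite Z" "card Z = s" "tup.dim (KK a b Z) \<le> a + b - 1 - 3 * (s - a * b)"
    using ab(1) by (auto simp: good_points_def)
  obtain a0 :: "nat \<times> var \<Rightarrow> 'k" where a0: "affine_coords a0" "zpt a0 ` {..<s} = Z"
    using exists_affine_coords[OF Z(1,2)] .
  \<comment> \<open>Entries 0 and 1 have bidegree (a - 1, b), entries 2 and 3 have bidegree (a, b -
    1).\<close>
  define E :: "nat \<times> nat \<Rightarrow> 'k tuple \<Rightarrow> (nat \<times> var, 'k) mpoly" where
    "E r v = (if snd r < 2 then homog (Pair (fst r)) (a - 1) b (v (snd r))
      else homog (Pair (fst r)) a (b - 1) (v (snd r)))" for r v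
  define \<delta> :: "nat \<times> nat \<Rightarrow> nat \<Rightarrow> nat \<times> nat" where
    "\<delta> r = (if snd r < 2 then (\<lambda>j. if j = fst r then (a - 1, b) else (0, 0))
      else (\<lambda>j. if j = fst r then (a, b - 1) else (0, 0)))" for r
  let ?R = "{..<s} \<times> {..<4 :: nat}"
  have "\<exists>F d. mhom s d F \<and> eval a0 F \<noteq> 0 \<and> (\<forall>\<alpha>. eval \<alpha> F \<noteq> 0 \<longrightarrow>
    tup.dim {v \<in> HH a b. \<forall>r\<in>?R. eval \<alpha> (E r v) = 0} \<le> tup.dim {v \<in> HH a b. \<forall>r\<in>?R. eval a0 (E r v) = 0})"
  proof (rule tup.open_dim_bound)
    show "Vector_Spaces.linear (\<lambda>c v i. smult [:c:] (v i)) (*) (\<lambda>v. eval \<alpha> (E r v))" for r \<alpha>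
      by (rule tup.linear_functionalI) (auto simp: E_def homog_simps homog_scale simp del: smult_pCons)
    show "mhom s (\<delta> r) (E r v)" if "r \<in> ?R" for r v
      using that mhom_homog[of "fst r" s "a - 1" b "v (snd r)"] mhom_homog[of "fst r" s a "b - 1" "v (snd r)"]
      by (auto simp: E_def \<delta>_def)
  qed (auto intro: subspace_HH fin_dim_HH)
  then obtain F d where F: "mhom s d F" "eval a0 F \<noteq> 0"
    "\<And>\<alpha>. eval \<alpha> F \<noteq> 0 \<Longrightarrow> tup.dim {v \<in> HH a b. \<forall>r\<in>?R. eval \<alpha> (E r v) = 0}
      \<le> tup.dim {v \<in> HH a b. \<forall>r\<in>?R. eval a0 (E r v) = 0}" by blast
  have KK: "{v \<in> HH a b. \<forall>r\<in>?R. eval \<alpha> (E r v) = 0} = KK a b (zpt \<alpha> ` {..<s})" if ch: "chart s \<alpha>" for \<alpha>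
  proof -
    have "(\<forall>r\<in>?R. eval \<alpha> (E r v) = 0) \<longleftrightarrow> (\<forall>z\<in>zpt \<alpha> ` {..<s}. \<forall>i<4. ev z (v i) = 0)" if v: "v \<in> HH a b" for v
    proof -
      have "eval \<alpha> (E (k, i) v) = 0 \<longleftrightarrow> ev (zpt \<alpha> k) (v i) = 0" if "k < s" "i < 4" for k i
      proof (cases "i < 2")
        case True
        then have "v i \<in> PP a (b + 1)" using v by (auto simp: HH_def less_2_cases_iff)
        then show ?thesis
          using True eval_homog_eq_0_iff[OF ch that(1), of "v i" a "b + 1"] pos by (simp add: E_def)
      next
        case False
        then have "i = 2 \<or> i = 3" using that(2) by auto
        then have "v i \<in> PP (a + 1) b" using v by (auto simp: HH_def)
        then show ?thesis
          using False eval_homog_eq_0_iff[OF ch that(1), of "v i" "a + 1" b] pos by (simp add: E_def)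
      qed
      then show ?thesis by auto
    qed
    then show ?thesis unfolding KK_def by blast
  qed
  show ?thesis
  proof (intro exI conjI allI impI)
    fix \<alpha> assume "chart s \<alpha>" "eval \<alpha> F \<noteq> 0"
    then show "tup.dim (KK a b (zpt \<alpha> ` {..<s})) \<le> a + b - 1 - 3 * (s - a * b)"
      using F(3)[of \<alpha>] Z(3) a0(2) unfolding KK[OF \<open>chart s \<alpha>\<close>] KK[OF affine_coords_chart[OF a0(1)]]
      by simp
  qed (use F a0 in auto)
qed

section \<open>From finitely many bidegrees to all of them\<close>

lemma dim_II_Suc1: "pp.dim (II (Suc A) B Z) \<le> B + pp.dim (II A B Z)"
proof -
  have im: "(\<lambda>p. coeff p A) ` II (Suc A) B Z \<subseteq> UP B" by (auto simp: II_def PP_def UP_def)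
  have ker: "{p \<in> II (Suc A) B Z. coeff p A = 0} \<subseteq> II A B Z"
    using PP_Suc_kernel[of A B] unfolding II_def by blast
  show ?thesis
    using pp_up.dim_le_image_ker(2)[OF linear_coeff_pp subspace_II fin_dim_UP im fin_dim_II ker]
    by (simp add: dim_UP)
qed

lemma dim_II_Suc2: "pp.dim (II A (Suc B) Z) \<le> A + pp.dim (II A B Z)"
proof -
  \<comment> \<open>Collects the coefficients of y^B into a polynomial in x.\<close>
  let ?f = "map_poly (\<lambda>q. coeff q B) :: 'a poly2 \<Rightarrow> 'a poly"
  have cf: "coeff (?f p) i = coeff (coeff p i) B" for p i by (simp add: coeff_map_poly)
  have lin: "Vector_Spaces.linear (\<lambda>c p. smult [:c:] p) smult ?f"
    using pp.vector_space_axioms up.vector_space_axioms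
    by (auto simp: Vector_Spaces.linear_iff poly_eq_iff cf)
  have im: "?f ` II A (Suc B) Z \<subseteq> UP A" by (auto simp: II_def PP_def UP_def cf)
  have "j < B" if "p \<in> PP A (Suc B)" "?f p = 0" "coeff (coeff p i) j \<noteq> 0" for p i j
  proof -
    have "coeff (coeff p i) B = 0" using cf[of p i] that(2) by simp
    then have "j \<noteq> B" using that(3) by auto
    moreover have "j < Suc B" using that(1,3) by (auto simp: PP_def)
    ultimately show ?thesis by simp
  qed
  then have ker: "{p \<in> II A (Suc B) Z. ?f p = 0} \<subseteq> II A B Z"
    unfolding II_def by (auto simp: PP_def)
  show ?thesis
    using pp_up.dim_le_image_ker(2)[OF lin subspace_II fin_dim_UP im fin_dim_II ker]
    by (simp add: dim_UP)
qed

lemma dim_II_add: "pp.dim (II (A + m) (B + n) Z) \<le> m * (B + n) + n * A + pp.dim (II A B Z)"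
proof (induction m)
  case 0
  show ?case
  proof (induction n)
    case (Suc n)
    then show ?case using dim_II_Suc2[of A "B + n" Z] by simp
  qed simp
next
  case (Suc m)
  then show ?case using dim_II_Suc1[of "A + m" "B + n" Z] by simp
qed

text \<open>General position is an infinite family of conditions, but those up to s + 1 imply the
  rest: once a box has at least s monomials and the expected dimension, each monomial added to it
  adds at most one dimension.\<close>

lemma dim_II_general:
  assumes Z: "finite Z" "card Z \<le> s" and "0 < s"
    and bound: "\<And>A B. A \<le> s + 1 \<Longrightarrow> B \<le> s + 1 \<Longrightarrow> pp.dim (II A B Z) \<le> A * B - s"
  shows "card Z = s" "pp.dim (II A B Z) = A * B - s"
proof -
  \<comment> \<open>In \<open>PP (s + 1) 1\<close> the bound leaves dimension 1, so at least s
    conditions are imposed and the points must be distinct.\<close>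
  have "(s + 1) * 1 \<le> pp.dim (II (s + 1) 1 Z) + card Z" by (rule dim_II_ge[OF Z(1)])
  then show cs: "card Z = s" using bound[of "s + 1" 1] Z(2) \<open>0 < s\<close> by simp
  have "pp.dim (II A B Z) \<le> A * B - s"
  proof (cases "A \<le> s + 1 \<and> B \<le> s + 1")
    case True
    then show ?thesis using bound by blast
  next
    case False
    show ?thesis
    proof (cases "A = 0 \<or> B = 0")
      case True
      then show ?thesis by (simp add: dim_II_0)
    next
      case pos: False
      \<comment> \<open>Clamped to the box; one side is s + 1 and the other is positive, so the
        product is at least s.\<close>
      define A' B' where "A' = min A (s + 1)" and "B' = min B (s + 1)"
      have A: "A = A' + (A - A')" and B: "B = B' + (B - B')" by (auto simp: A'_def B'_def)
      have "s \<le> A' * B'"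
      proof (cases "A \<le> s + 1")
        case True
        then have "B' = s + 1" "A' \<ge> 1" using False pos by (auto simp: A'_def B'_def)
        then show ?thesis by (metis add_leD1 mult.commute mult_le_mono1 mult_1 order_trans)
      next
        case A: False
        then have "A' = s + 1" "B' \<ge> 1" using pos by (auto simp: A'_def B'_def)
        then show ?thesis by (metis add_leD1 mult.commute mult_le_mono1 mult_1 order_trans)
      qed
      moreover have "pp.dim (II A' B' Z) \<le> A' * B' - s"
        by (rule bound) (auto simp: A'_def B'_def)
      moreover have "pp.dim (II A B Z) \<le> (A - A') * B + (B - B') * A' + pp.dim (II A' B' Z)"
        using dim_II_add[of A' "A - A'" B' "B - B'" Z] A B by simp
      moreover have "A * B = (A - A') * B + (B - B') * A' + A' * B'"
        using A B by (metis add.assoc add.commute distrib_left distrib_right mult.commute)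
      ultimately show ?thesis by linarith
    qed
  qed
  moreover have "A * B \<le> pp.dim (II A B Z) + s" using dim_II_ge[OF Z(1)] cs by blast
  ultimately show "pp.dim (II A B Z) = A * B - s" by simp
qed

text \<open>All open conditions are combined by multiplying their forms. Each factor is nonzero at
  some normalized coordinates, hence all of them are at common ones.\<close>

lemma general_form:
  assumes "0 < s"
  shows "\<exists>(F :: (nat \<times> var, 'k::field_char_0) mpoly) d. mhom s d F \<and>
    (\<exists>a. affine_coords a \<and> eval a F \<noteq> 0) \<and>
    (\<forall>a. eval a F \<noteq> 0 \<longrightarrow> chart s a \<and> general_points s (zpt a ` {..<s}))"
proof -
  define \<Lambda>1 :: "(nat \<times> nat) set" where "\<Lambda>1 = {..s + 1} \<times> {..s + 1}"
  define \<Lambda>2 :: "(nat \<times> nat) set" where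
    "\<Lambda>2 = {(a, b). a \<le> s \<and> b \<le> s \<and> a * b \<le> s \<and> s - a * b \<le> a \<and> s - a * b \<le> b}"
  have fin: "finite \<Lambda>1" "finite \<Lambda>2"
    unfolding \<Lambda>1_def by simp (rule finite_subset[of _ "{..s} \<times> {..s}"], auto simp: \<Lambda>2_def)
  have "\<forall>l. \<exists>F d. mhom s d F \<and> (\<exists>a. affine_coords a \<and> eval a F \<noteq> 0) \<and>
    (\<forall>a. chart s a \<longrightarrow> eval a F \<noteq> 0 \<longrightarrow>
      pp.dim (II (fst l) (snd l) (zpt a ` {..<s}) :: 'k poly2 set) \<le> fst l * snd l - s)"
    using open_dim_II by blast
  then obtain F1 d1 where F1: "\<And>l. mhom s (d1 l) (F1 l)" "\<And>l. \<exists>a. affine_coords a \<and> eval a (F1 l) \<noteq> 0"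
    "\<And>l a. chart s a \<Longrightarrow> eval a (F1 l) \<noteq> 0 \<Longrightarrow>
      pp.dim (II (fst l) (snd l) (zpt a ` {..<s}) :: 'k poly2 set) \<le> fst l * snd l - s"
    by metis
  have "\<forall>l\<in>\<Lambda>2. \<exists>F d. mhom s d F \<and> (\<exists>a. affine_coords a \<and> eval a F \<noteq> 0) \<and>
    (\<forall>a. chart s a \<longrightarrow> eval a F \<noteq> 0 \<longrightarrow>
      tup.dim (KK (fst l) (snd l) (zpt a ` {..<s}) :: 'k tuple set) \<le> fst l + snd l - 1 - 3 * (s - fst l * snd l))"
    using open_dim_KK[OF assms] unfolding \<Lambda>2_def by auto
  then obtain F2 d2 where F2: "\<And>l. l \<in> \<Lambda>2 \<Longrightarrow> mhom s (d2 l) (F2 l)"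
    "\<And>l. l \<in> \<Lambda>2 \<Longrightarrow> \<exists>a. affine_coords a \<and> eval a (F2 l) \<noteq> 0"
    "\<And>l a. l \<in> \<Lambda>2 \<Longrightarrow> chart s a \<Longrightarrow> eval a (F2 l) \<noteq> 0 \<Longrightarrow>
      tup.dim (KK (fst l) (snd l) (zpt a ` {..<s}) :: 'k tuple set) \<le> fst l + snd l - 1 - 3 * (s - fst l * snd l)"
    by metis
  \<comment> \<open>Homogenizing 1 in bidegree (1, 1) gives x_{1,0} x_{2,0}, so F0 is nonzero
    exactly on \<open>chart s\<close>.\<close>
  define F0 :: "(nat \<times> var, 'k) mpoly" where "F0 = (\<Prod>k<s. homog (Pair k) 1 1 1)"
  have "eval a (homog (Pair k) 1 1 1) = a (k, X10) * a (k, X20)" for a :: "nat \<times> var \<Rightarrow> 'k" and k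
    by (simp add: eval_homog_raw)
  then have F0: "eval a F0 \<noteq> 0 \<longleftrightarrow> chart s a" for a
    by (auto simp: F0_def eval.hom_prod chart_def)
  define F where "F = F0 * (\<Prod>l\<in>\<Lambda>1. F1 l) * (\<Prod>l\<in>\<Lambda>2. F2 l)"
  have evF: "eval a F \<noteq> 0 \<longleftrightarrow> chart s a \<and> (\<forall>l\<in>\<Lambda>1. eval a (F1 l) \<noteq> 0) \<and> (\<forall>l\<in>\<Lambda>2. eval a (F2 l) \<noteq> 0)" for a
    using fin F0 by (auto simp: F_def eval.hom_prod)
  have "mhom s ((\<Sum>k<s. (\<lambda>j. if j = k then (1, 1) else (0, 0))) + sum d1 \<Lambda>1 + sum d2 \<Lambda>2) F"
    unfolding F_def F0_def
    by (intro mhom_mult mhom_prod F1 F2) (auto intro: mhom_homog simp del: One_nat_def)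
  then have "\<exists>d. mhom s d F" by blast
  moreover have "\<exists>a. affine_coords a \<and> eval a F \<noteq> 0"
  proof -
    define G where "G = case_sum F1 F2"
    have "\<exists>a. affine_coords a \<and> (\<forall>l\<in>\<Lambda>1 <+> \<Lambda>2. eval a (G l) \<noteq> 0)"
      using fin F1(2) F2(2) by (intro common_nonvanishing) (auto simp: G_def)
    then obtain a where "affine_coords a" "\<forall>l\<in>\<Lambda>1 <+> \<Lambda>2. eval a (G l) \<noteq> 0" by blast
    then show ?thesis using evF[of a] affine_coords_chart[of a s] by (force simp: G_def)
  qed
  moreover have "general_points s (zpt a ` {..<s})" if "eval a F \<noteq> 0" for a
  proof -
    let ?Z = "zpt a ` {..<s}"
    have ch: "chart s a" and nz: "\<And>l. l \<in> \<Lambda>1 \<Longrightarrow> eval a (F1 l) \<noteq> 0" "\<And>l. l \<in> \<Lambda>2 \<Longrightarrow> eval a (F2 l) \<noteq> 0"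
      using that evF by auto
    have bound: "pp.dim (II A B ?Z) \<le> A * B - s" if "A \<le> s + 1" "B \<le> s + 1" for A B
      using F1(3)[OF ch nz(1), of "(A, B)"] that by (simp add: \<Lambda>1_def)
    have "card ?Z \<le> s" using card_image_le[of "{..<s}" "zpt a"] by simp
    note g = dim_II_general[OF _ this assms bound]
    have "tup.dim (KK x y ?Z) \<le> x + y - 1 - 3 * (s - x * y)"
      if xy: "x * y \<le> s" "s - x * y \<le> x" "s - x * y \<le> y" for x y
    proof -
      \<comment> \<open>Both are positive, so x, y <= x y <= s, and the finite set
        \<open>\<Lambda>2\<close> contains every pair that matters.\<close>
      have "0 < x" "0 < y" using assms xy by (auto intro: Nat.gr0I)
      then have "x \<le> x * y" "y \<le> x * y" by auto
      then have "x \<le> s" "y \<le> s" using xy(1) by linarith+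
      then have "(x, y) \<in> \<Lambda>2" using xy unfolding \<Lambda>2_def by auto
      then show ?thesis using F2(3)[OF _ ch nz(2), of "(x, y)"] by simp
    qed
    then show ?thesis using g by (simp add: general_points_def)
  qed
  ultimately show ?thesis using evF by blast
qed

section \<open>Bihomogeneous forms\<close>

text \<open>On \<open>PP (a + 1) (b + 1)\<close> this is an isomorphism onto the component of R of
  bidegree (a, b), by \<open>psi_in_R\<close>, \<open>psi_inj\<close> and
  \<open>psi_surj\<close>.\<close>

abbreviation psi :: "nat \<Rightarrow> nat \<Rightarrow> 'k::field poly2 \<Rightarrow> 'k R"
  where "psi \<equiv> homog id"

definition xvar :: "var \<Rightarrow> 'k::field R"
  where "xvar v = Poly_Mapping.single (Poly_Mapping.single v 1) 1"

lemma mdeg_add: "mdeg (t + u) = mdeg t + mdeg u"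
  by (simp add: mdeg_def lookup_add)

lemma mdeg_hmono: "i \<le> a \<Longrightarrow> l \<le> b \<Longrightarrow> mdeg (hmono id a b i l) = (a, b)"
  using lookup_hmono[of id a b i l] by (simp add: mdeg_def)

lemma hmono_lookup:
  assumes "mdeg t = (a, b)"
  shows "t = hmono id a b (Poly_Mapping.lookup t X11) (Poly_Mapping.lookup t X21)"
    "Poly_Mapping.lookup t X11 \<le> a" "Poly_Mapping.lookup t X21 \<le> b"
proof -
  show "Poly_Mapping.lookup t X11 \<le> a" "Poly_Mapping.lookup t X21 \<le> b"
    using assms by (auto simp: mdeg_def)
  show "t = hmono id a b (Poly_Mapping.lookup t X11) (Poly_Mapping.lookup t X21)"
  proof (rule poly_mapping_eqI)
    fix v
    show "Poly_Mapping.lookup t v =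
        Poly_Mapping.lookup (hmono id a b (Poly_Mapping.lookup t X11) (Poly_Mapping.lookup t X21)) v"
      using assms lookup_hmono[of id a b "Poly_Mapping.lookup t X11" "Poly_Mapping.lookup t X21"]
      by (cases v) (auto simp: mdeg_def)
  qed
qed

lemma lookup_psi:
  assumes "mdeg t = (a, b)"
  shows "Poly_Mapping.lookup (psi a b p) t =
    coeff (coeff p (Poly_Mapping.lookup t X11)) (Poly_Mapping.lookup t X21)"
proof -
  let ?i = "Poly_Mapping.lookup t X11" and ?l = "Poly_Mapping.lookup t X21"
  have "hmono id a b i l = t \<longleftrightarrow> i = ?i \<and> l = ?l" if "i \<le> a" "l \<le> b" for i l
    using lookup_hmono(2,4)[of id a b i l] hmono_lookup(1)[OF assms] by auto
  then have "Poly_Mapping.lookup (psi a b p) t =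
      (\<Sum>i\<le>a. \<Sum>l\<le>b. if l = ?l then if i = ?i then coeff (coeff p i) l else 0 else 0)"
    unfolding homog_def lookup_sum
    by (intro sum.cong) (auto simp: lookup_single when_def)
  also have "\<dots> = (\<Sum>i\<le>a. if i = ?i then coeff (coeff p i) ?l else 0)"
    using hmono_lookup(3)[OF assms] by (intro sum.cong refl) (simp add: sum.delta)
  also have "\<dots> = coeff (coeff p ?i) ?l"
    using hmono_lookup(2)[OF assms] by (simp add: sum.delta)
  finally show ?thesis .
qed

lemma psi_in_R: "psi a b p \<in> R_comp (a, b)"
  using keys_homog[of _ id a b p] mdeg_hmono unfolding R_comp_def by blast

lemma psi_inj:
  assumes "p \<in> PP (a + 1) (b + 1)" "psi a b p = 0"
  shows "p = 0"
proof -
  have "coeff (coeff p i) l = 0" for i l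
  proof (cases "i \<le> a \<and> l \<le> b")
    case True
    then show ?thesis
      using lookup_psi[OF mdeg_hmono, of i a l b p] lookup_hmono[of id a b i l] assms(2) by simp
  next
    case False
    then show ?thesis using assms(1) by (force simp: PP_def)
  qed
  then show ?thesis by (simp add: poly_eq_iff)
qed

lemma psi_surj:
  assumes "f \<in> R_comp (a, b)"
  obtains p where "p \<in> PP (a + 1) (b + 1)" "f = psi a b p"
proof -
  define p where "p = (\<Sum>i\<le>a. monom (\<Sum>l\<le>b. monom (Poly_Mapping.lookup f (hmono id a b i l)) l) i)"
  have c: "coeff (coeff p i) l = (if i \<le> a \<and> l \<le> b then Poly_Mapping.lookup f (hmono id a b i l) else 0)" for i l
  proof -
    have "coeff p i = (\<Sum>k\<le>a. if k = i then (\<Sum>l\<le>b. monom (Poly_Mapping.lookup f (hmono id a b i l)) l) else 0)"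
      unfolding p_def coeff_sum by (intro sum.cong) auto
    also have "\<dots> = (if i \<le> a then (\<Sum>l\<le>b. monom (Poly_Mapping.lookup f (hmono id a b i l)) l) else 0)"
      by (simp add: sum.delta)
    finally show ?thesis
      by (simp add: coeff_sum sum.delta)
  qed
  have "p \<in> PP (a + 1) (b + 1)" by (auto simp: PP_def c split: if_splits)
  moreover have "f = psi a b p"
  proof (rule poly_mapping_eqI)
    fix t
    show "Poly_Mapping.lookup f t = Poly_Mapping.lookup (psi a b p) t"
    proof (cases "mdeg t = (a, b)")
      case True
      then show ?thesis using hmono_lookup[OF True] by (simp add: lookup_psi[OF True] c)
    next
      case False
      then have "t \<notin> Poly_Mapping.keys f" "t \<notin> Poly_Mapping.keys (psi a b p)"
        using assms psi_in_R[of a b p] unfolding R_comp_def by blast+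
      then show ?thesis by (simp add: in_keys_iff)
    qed
  qed
  ultimately show ?thesis using that by blast
qed

lemma xvar_hmono:
  "i \<le> a \<Longrightarrow> Poly_Mapping.single X10 1 + hmono id a b i l = hmono id (Suc a) b i l"
  "Poly_Mapping.single X11 1 + hmono id a b i l = hmono id (Suc a) b (Suc i) l"
  "l \<le> b \<Longrightarrow> Poly_Mapping.single X20 1 + hmono id a b i l = hmono id a (Suc b) i l"
  "Poly_Mapping.single X21 1 + hmono id a b i l = hmono id a (Suc b) i (Suc l)"
proof -
  have s: "Poly_Mapping.single v (Suc n) = Poly_Mapping.single v 1 + Poly_Mapping.single v n" for v :: var and n
    by (simp flip: single_add)
  show "i \<le> a \<Longrightarrow> Poly_Mapping.single X10 1 + hmono id a b i l = hmono id (Suc a) b i l"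
    "Poly_Mapping.single X11 1 + hmono id a b i l = hmono id (Suc a) b (Suc i) l"
    "l \<le> b \<Longrightarrow> Poly_Mapping.single X20 1 + hmono id a b i l = hmono id a (Suc b) i l"
    "Poly_Mapping.single X21 1 + hmono id a b i l = hmono id a (Suc b) i (Suc l)"
    by (simp_all add: hmono_def Suc_diff_le s[of _ "_ - _"] s[of X11 i] s[of X21 l] ac_simps del: One_nat_def)
qed

text \<open>In the chart x_{1,0} and x_{2,0} only raise the bidegree, while x_{1,1} and x_{2,1}
  multiply by x and y. The degree bounds ensure that the larger homogenization picks up no further
  coefficient.\<close>

lemma xvar_psi:
  "p \<in> PP (a + 1) B \<Longrightarrow> xvar X10 * psi a b p = psi (Suc a) b p"
  "xvar X11 * psi a b p = psi (Suc a) b (XX * p)"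
  "p \<in> PP A (b + 1) \<Longrightarrow> xvar X20 * psi a b p = psi a (Suc b) p"
  "xvar X21 * psi a b p = psi a (Suc b) (YY * p)"
proof -
  have m: "xvar v * psi a b p = (\<Sum>i\<le>a. \<Sum>l\<le>b. Poly_Mapping.single
      (Poly_Mapping.single v 1 + hmono id a b i l) (coeff (coeff p i) l))" for v
    by (simp add: xvar_def homog_def sum_distrib_left mult_single)
  show "xvar X10 * psi a b p = psi (Suc a) b p" if "p \<in> PP (a + 1) B"
  proof -
    have "coeff (coeff p (Suc a)) l = 0" for l using that by (force simp: PP_def)
    then show ?thesis unfolding m by (simp add: homog_def xvar_hmono(1)[unfolded One_nat_def])
  qed
  show "xvar X11 * psi a b p = psi (Suc a) b (XX * p)"
    unfolding m unfolding homog_def sum.atMost_Suc_shift[of _ a] xvar_hmono by (simp add: XX_def)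
  show "xvar X20 * psi a b p = psi a (Suc b) p" if "p \<in> PP A (b + 1)"
  proof -
    have "coeff (coeff p i) (Suc b) = 0" for i
    proof (rule ccontr)
      assume "coeff (coeff p i) (Suc b) \<noteq> 0"
      then have "Suc b < b + 1" using that unfolding PP_def by blast
      then show False by simp
    qed
    then show ?thesis unfolding m by (simp add: homog_def xvar_hmono(3)[unfolded One_nat_def])
  qed
  show "xvar X21 * psi a b p = psi a (Suc b) (YY * p)"
    unfolding m unfolding homog_def sum.atMost_Suc_shift[of _ b] xvar_hmono by (simp add: YY_def)
qed

section \<open>Bihomogeneous components\<close>

definition hcomp :: "nat \<times> nat \<Rightarrow> 'k::field R \<Rightarrow> 'k R"
  where "hcomp j f = (\<Sum>t\<in>{t \<in> Poly_Mapping.keys f. mdeg t = j}. Poly_Mapping.single t (Poly_Mapping.lookup f t))"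

lemma lookup_hcomp: "Poly_Mapping.lookup (hcomp j f) t = (if mdeg t = j then Poly_Mapping.lookup f t else 0)"
proof -
  have "Poly_Mapping.lookup (hcomp j f) t =
      (\<Sum>u\<in>{t \<in> Poly_Mapping.keys f. mdeg t = j}. if u = t then Poly_Mapping.lookup f t else 0)"
    unfolding hcomp_def lookup_sum by (intro sum.cong) (auto simp: lookup_single when_def)
  then show ?thesis by (auto simp: sum.delta in_keys_iff)
qed

lemma hcomp_add: "hcomp j (f + g) = hcomp j f + hcomp j g"
  by (rule poly_mapping_eqI) (simp add: lookup_hcomp lookup_add)

lemma hcomp_0 [simp]: "hcomp j 0 = 0"
  by (rule poly_mapping_eqI) (simp add: lookup_hcomp)

lemma hcomp_sum: "hcomp j (sum f S) = (\<Sum>x\<in>S. hcomp j (f x))"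
  by (induction S rule: infinite_finite_induct) (auto simp: hcomp_add)

lemma hcomp_const: "hcomp j (const c * f) = const c * hcomp j f"
proof -
  have l: "Poly_Mapping.lookup (const c * g) t = c * Poly_Mapping.lookup g t" for g :: "'a R" and t
  proof -
    have "const c * g = Poly_Mapping.map ((*) c) g" by (simp add: const_def mult_map_scale_conv_mult)
    then show ?thesis by (simp add: Poly_Mapping.map.rep_eq when_def)
  qed
  show ?thesis by (rule poly_mapping_eqI) (simp add: lookup_hcomp l)
qed

lemma hcomp_R: "f \<in> R_comp i \<Longrightarrow> hcomp j f = (if i = j then f else 0)"
  by (rule poly_mapping_eqI) (auto simp: lookup_hcomp R_comp_def in_keys_iff)

lemma hcomp_in_R: "hcomp j f \<in> R_comp j"
  by (auto simp: R_comp_def in_keys_iff lookup_hcomp split: if_splits)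

lemma hcomp_single: "hcomp j (Poly_Mapping.single t c) = (if mdeg t = j then Poly_Mapping.single t c else 0)"
  by (rule poly_mapping_eqI) (auto simp: lookup_hcomp lookup_single when_def)

text \<open>The condition \<open>mdeg u \<le> j\<close> makes the truncated subtraction exact.\<close>

lemma hcomp_single_mult:
  "hcomp j (Poly_Mapping.single u c * f) =
    (if mdeg u \<le> j then Poly_Mapping.single u c * hcomp (j - mdeg u) f else 0)"
proof -
  have 1: "hcomp j (Poly_Mapping.single u c * Poly_Mapping.single t e) =
      (if mdeg u \<le> j then Poly_Mapping.single u c * hcomp (j - mdeg u) (Poly_Mapping.single t e) else 0)" for t e
  proof -
    have "mdeg u + mdeg t = j \<longleftrightarrow> mdeg u \<le> j \<and> mdeg t = j - mdeg u"
      by (cases j; cases "mdeg u"; cases "mdeg t") auto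
    then show ?thesis by (auto simp: mult_single hcomp_single mdeg_add)
  qed
  show ?thesis
    by (subst (1 2) poly_mapping_as_sum[of f]) (simp add: sum_distrib_left hcomp_sum 1)
qed

lemma R_comp_mult_single: "f \<in> R_comp i \<Longrightarrow> Poly_Mapping.single t c * f \<in> R_comp (mdeg t + i)"
proof -
  assume f: "f \<in> R_comp i"
  have "mdeg u = mdeg t + i" if "u \<in> Poly_Mapping.keys (Poly_Mapping.single t c * f)" for u
  proof -
    have "\<exists>v. u = t + v \<and> v \<in> Poly_Mapping.keys f"
    proof -
      have "u \<in> {x + y |x y. x \<in> Poly_Mapping.keys (Poly_Mapping.single t c) \<and> y \<in> Poly_Mapping.keys f}"
        using that Poly_Mapping.keys_mult[of "Poly_Mapping.single t c" f] by blast
      then show ?thesis by (auto split: if_splits)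
    qed
    then show ?thesis using f by (auto simp: mdeg_add R_comp_def)
  qed
  then show ?thesis by (simp add: R_comp_def)
qed

interpretation rm: Modules.module "(*) :: 'r::comm_ring_1 \<Rightarrow> 'r \<Rightarrow> 'r"
  by unfold_locales (auto simp: algebra_simps)

lemma const_simps: "const (c + d) = const c + const d" "const (c * d) = const c * const (d :: 'k::field)"
    "const 1 = 1" "const 0 = 0"
  by (simp_all add: const_def single_add mult_single)

interpretation rr: vector_space "\<lambda>(c::'k::field) (f::'k R). const c * f"
  by unfold_locales (simp_all only: const_simps distrib_left distrib_right mult.assoc mult_1_left)

lemma abs_proj1_eqD:
  assumes "u \<noteq> (0, 0)" "v \<noteq> (0, 0)" "abs_proj1 u = abs_proj1 v"
  shows "proj_rel u v"
proof -
  have "proj_rel w w" if "w \<noteq> (0, 0)" for w :: "'a \<times> 'a"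
    using that by (auto simp: proj_rel_def intro: exI[of _ 1])
  then show ?thesis using Quotient3_rel[OF Quotient3_proj1, of u v] assms by blast
qed

section \<open>The ideal of general points\<close>

locale general_config =
  fixes s :: nat and a :: "nat \<times> var \<Rightarrow> 'k::field_char_0" and P :: "nat \<Rightarrow> 'k point"
  assumes s: "0 < s" and ch: "chart s a" and gen: "general_points s (zpt a ` {..<s})"
    and coords: "\<And>k. k < s \<Longrightarrow> hcoords (\<lambda>x. a (k, x)) (P k)"
begin

definition Z where "Z = zpt a ` {..<s}"

definition J where "J = vanishing_ideal (P ` {..<s})"

text \<open>The component of J of bidegree (i, j), by \<open>Ih_subset_J\<close> and
  \<open>J_hcomp\<close>; written through the chart so that the dimensions found there
  apply.\<close>

definition Ih where "Ih i j = psi i j ` II (i + 1) (j + 1) Z"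

text \<open>Other homogeneous coordinates differ by nonzero factors c and d, which leave the affine
  ratios unchanged.\<close>

lemma eval_psi:
  assumes "p \<in> PP (i + 1) (j + 1)" "k < s" "hcoords b (P k)"
  shows "eval b (psi i j p) = 0 \<longleftrightarrow> ev (zpt a k) p = 0"
proof -
  have "proj_rel (a (k, X10), a (k, X11)) (b X10, b X11)" "proj_rel (a (k, X20), a (k, X21)) (b X20, b X21)"
    using coords[OF assms(2)] assms(3) unfolding hcoords_def by (auto intro!: abs_proj1_eqD)
  then obtain c d where cd: "c \<noteq> 0" "d \<noteq> 0" "b X10 = c * a (k, X10)" "b X11 = c * a (k, X11)"
    "b X20 = d * a (k, X20)" "b X21 = d * a (k, X21)"
    unfolding proj_rel_def by auto
  have nz: "a (k, X10) \<noteq> 0" "a (k, X20) \<noteq> 0" using ch assms(2) by (auto simp: chart_def)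
  have "(b X11 / b X10, b X21 / b X20) = zpt a k"
    using cd nz by (simp add: zpt_def)
  then show ?thesis
    using eval_homog[of p i j b id] assms(1) cd nz by simp
qed

end

lemma psi_diff: "psi i j (p - q) = psi i j p - psi i j q"
  using homog_simps(1)[of id i j "p - q" q] by (simp add: algebra_simps)

lemma psi_combination:
  "psi i j (\<Sum>b\<in>C. smult [:c b:] b) = (\<Sum>b\<in>C. const (c b) * psi i j b)"
  by (induction C rule: infinite_finite_induct) (simp_all add: homog_simps homog_scale del: smult_pCons)

text \<open>Carries \<open>complement_basis\<close> over to R through the injective map
  \<open>psi i j\<close>.\<close>

lemma complement_basis_psi:
  fixes V :: "'k::field poly2 set"
  assumes V: "pp.subspace V" "V \<subseteq> PP (i + 1) (j + 1)" and W: "pp.subspace W" "W \<subseteq> V"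
  obtains B where "finite B" "card B = pp.dim V - pp.dim W" "pp.dim W \<le> pp.dim V" "B \<subseteq> psi i j ` V"
    "\<forall>f\<in>psi i j ` V. \<exists>c. f - (\<Sum>b\<in>B. const (c b) * b) \<in> psi i j ` W"
    "\<forall>c. (\<Sum>b\<in>B. const (c b) * b) \<in> psi i j ` W \<longrightarrow> (\<forall>b\<in>B. c b = 0)"
proof -
  obtain C where C: "finite C" "card C = pp.dim V - pp.dim W" "pp.dim W \<le> pp.dim V" "C \<subseteq> V"
    "\<forall>v\<in>V. \<exists>c. v - (\<Sum>b\<in>C. smult [:c b:] b) \<in> W"
    "\<forall>c. (\<Sum>b\<in>C. smult [:c b:] b) \<in> W \<longrightarrow> (\<forall>b\<in>C. c b = 0)"
    using pp.complement_basis[OF pp.fin_dim_subset[OF dim_PP(1) V(2)] V(1) W] .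
  have inj: "inj_on (psi i j) V"
  proof (rule inj_onI)
    fix p q assume pq: "p \<in> V" "q \<in> V" "psi i j p = psi i j q"
    then have "p - q \<in> PP (i + 1) (j + 1)" using V pp.subspace_diff by blast
    then have "p - q = 0" using pq(3) by (intro psi_inj[of "p - q" i j]) (auto simp: psi_diff)
    then show "p = q" by simp
  qed
  then have injC: "inj_on (psi i j) C" using C(4) inj_on_subset by blast
  have sum: "(\<Sum>b\<in>psi i j ` C. const (c b) * b) = psi i j (\<Sum>b\<in>C. smult [:c (psi i j b):] b)" for c
    by (simp add: sum.reindex[OF injC] psi_combination del: smult_pCons)
  have inV: "(\<Sum>b\<in>C. smult [:c b:] b) \<in> V" for c
    using C(4) V(1) by (intro pp.subspace_sum pp.subspace_scale) auto
  show ?thesis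
  proof (rule that[of "psi i j ` C"])
    show "finite (psi i j ` C)" "card (psi i j ` C) = pp.dim V - pp.dim W" "pp.dim W \<le> pp.dim V"
      "psi i j ` C \<subseteq> psi i j ` V"
      using C injC by (auto simp: card_image)
    show "\<forall>f\<in>psi i j ` V. \<exists>c. f - (\<Sum>b\<in>psi i j ` C. const (c b) * b) \<in> psi i j ` W"
    proof
      fix f assume "f \<in> psi i j ` V"
      then obtain v where v: "v \<in> V" "f = psi i j v" by blast
      obtain c where c: "v - (\<Sum>b\<in>C. smult [:c b:] b) \<in> W" using C(5) v(1) by blast
      \<comment> \<open>Coefficients are indexed by basis elements, hence pulled back along the
        inverse of \<open>psi i j\<close> on C.\<close>
      define c' where "c' b = c (inv_into C (psi i j) b)" for b
      have "(\<Sum>b\<in>C. smult [:c' (psi i j b):] b) = (\<Sum>b\<in>C. smult [:c b:] b)"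
        using injC by (intro sum.cong) (auto simp: c'_def)
      then have "f - (\<Sum>b\<in>psi i j ` C. const (c' b) * b) = psi i j (v - (\<Sum>b\<in>C. smult [:c b:] b))"
        unfolding sum v(2) psi_diff by simp
      then show "\<exists>c. f - (\<Sum>b\<in>psi i j ` C. const (c b) * b) \<in> psi i j ` W" using c by blast
    qed
    show "\<forall>c. (\<Sum>b\<in>psi i j ` C. const (c b) * b) \<in> psi i j ` W \<longrightarrow> (\<forall>b\<in>psi i j ` C. c b = 0)"
    proof (intro allI impI)
      fix c assume "(\<Sum>b\<in>psi i j ` C. const (c b) * b) \<in> psi i j ` W"
      then obtain w where w: "w \<in> W" "psi i j (\<Sum>b\<in>C. smult [:c (psi i j b):] b) = psi i j w"
        unfolding sum by blast
      then have "(\<Sum>b\<in>C. smult [:c (psi i j b):] b) = w"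
        using inj_onD[OF inj] inV[of "\<lambda>b. c (psi i j b)"] W(2) by blast
      then have "\<forall>b\<in>C. c (psi i j b) = 0" using C(6)[rule_format, of "\<lambda>b. c (psi i j b)"] w(1) by blast
      then show "\<forall>b\<in>psi i j ` C. c b = 0" by blast
    qed
  qed
qed

lemma R_comp_combination:
  assumes "B \<subseteq> (R_comp j :: 'k::field R set)"
  shows "(\<Sum>b\<in>B. const (c b) * b) \<in> R_comp j"
proof -
  have "hcomp j (\<Sum>b\<in>B. const (c b) * b) = (\<Sum>b\<in>B. const (c b) * b)"
    unfolding hcomp_sum hcomp_const using assms by (intro sum.cong) (auto simp: hcomp_R)
  then show ?thesis using hcomp_in_R[of j "\<Sum>b\<in>B. const (c b) * b"] by simp
qed

lemma ideal_gen_closed: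
  "x \<in> S \<Longrightarrow> x \<in> ideal_gen S" "0 \<in> ideal_gen S"
  "f \<in> ideal_gen S \<Longrightarrow> g \<in> ideal_gen S \<Longrightarrow> f + g \<in> ideal_gen S"
  "f \<in> ideal_gen S \<Longrightarrow> r * f \<in> ideal_gen S"
  "(\<And>x. x \<in> X \<Longrightarrow> h x \<in> ideal_gen S) \<Longrightarrow> sum h X \<in> ideal_gen S"
  unfolding ideal_gen_def
  by (rule rm.span_base rm.span_zero rm.span_add rm.span_scale rm.span_sum; assumption)+

lemma ideal_gen_induct:
  assumes "f \<in> ideal_gen S" "Q 0" "\<And>x. x \<in> S \<Longrightarrow> Q x"
    "\<And>f g. Q f \<Longrightarrow> Q g \<Longrightarrow> Q (f + g)" "\<And>r f. Q f \<Longrightarrow> Q (r * f)"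
  shows "Q f"
  using assms(1) unfolding ideal_gen_def
proof (rule rm.span_induct)
  show "rm.subspace {f. Q f}" by (rule rm.subspaceI) (simp_all add: assms(2,4,5))
qed (rule assms(3))

lemma WW_memI:
  assumes "f0 \<in> II i (j + 1) Z" "f1 \<in> II i (j + 1) Z" "g0 \<in> II (i + 1) j Z" "g1 \<in> II (i + 1) j Z"
  shows "(f0 + XX * f1) + (g0 + YY * g1) \<in> WW i j Z"
  unfolding WW_def W1_def W2_def pp.set_sum_def using assms by blast

lemma WW_memE:
  assumes "w \<in> WW i j Z"
  obtains f0 f1 g0 g1 where "f0 \<in> II i (j + 1) Z" "f1 \<in> II i (j + 1) Z" "g0 \<in> II (i + 1) j Z"
    "g1 \<in> II (i + 1) j Z" "w = (f0 + XX * f1) + (g0 + YY * g1)"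
proof -
  obtain p q where pq: "p \<in> W1 i j Z" "q \<in> W2 i j Z" "w = p + q"
    using assms unfolding WW_def pp.set_sum_def by blast
  obtain f0 f1 where f: "f0 \<in> II i (j + 1) Z" "f1 \<in> II i (j + 1) Z" "p = f0 + XX * f1"
    using pq(1) unfolding W1_def pp.set_sum_def by blast
  obtain g0 g1 where g: "g0 \<in> II (i + 1) j Z" "g1 \<in> II (i + 1) j Z" "q = g0 + YY * g1"
    using pq(2) unfolding W2_def pp.set_sum_def by blast
  show ?thesis using that[OF f(1,2) g(1,2)] pq(3) f(3) g(3) by simp
qed

context general_config
begin

lemma Ih_iff: "f \<in> Ih i j \<longleftrightarrow> f \<in> R_comp (i, j) \<and> (\<forall>k<s. eval (\<lambda>x. a (k, x)) f = 0)"
proof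
  assume "f \<in> Ih i j"
  then obtain p where p: "p \<in> II (i + 1) (j + 1) Z" "f = psi i j p" by (auto simp: Ih_def)
  then have "p \<in> PP (i + 1) (j + 1)" "\<And>k. k < s \<Longrightarrow> ev (zpt a k) p = 0" by (auto simp: II_def Z_def)
  then show "f \<in> R_comp (i, j) \<and> (\<forall>k<s. eval (\<lambda>x. a (k, x)) f = 0)"
    using eval_psi[OF _ _ coords] psi_in_R p(2) by blast
next
  assume f: "f \<in> R_comp (i, j) \<and> (\<forall>k<s. eval (\<lambda>x. a (k, x)) f = 0)"
  then obtain p where p: "p \<in> PP (i + 1) (j + 1)" "f = psi i j p" using psi_surj by blast
  then have "\<forall>k<s. ev (zpt a k) p = 0" using eval_psi[OF p(1) _ coords] f by blast
  then show "f \<in> Ih i j" using p by (auto simp: Ih_def II_def Z_def)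
qed

lemma vanishes_iff:
  assumes "f \<in> R_comp (i, j)"
  shows "(\<forall>x\<in>P ` {..<s}. vanishes_at f x) \<longleftrightarrow> f \<in> Ih i j"
proof -
  obtain p where p: "p \<in> PP (i + 1) (j + 1)" "f = psi i j p" using psi_surj[OF assms] .
  have "vanishes_at f (P k) \<longleftrightarrow> eval (\<lambda>x. a (k, x)) f = 0" if "k < s" for k
    using eval_psi[OF p(1) that] coords[OF that] unfolding vanishes_at_def p(2) by blast
  then show ?thesis using assms Ih_iff by auto
qed

lemma J_eq: "J = ideal_gen (\<Union>i j. Ih i j)"
proof -
  have "{f. (\<exists>i. f \<in> R_comp i) \<and> (\<forall>p\<in>P ` {..<s}. vanishes_at f p)} = (\<Union>i j. Ih i j)"
    using vanishes_iff Ih_iff by fast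
  then show ?thesis by (simp add: J_def vanishing_ideal_def)
qed

lemma Ih_subset_J: "Ih i j \<subseteq> J"
  unfolding J_eq by (intro subsetI ideal_gen_closed(1)) blast

lemma J_closed:
  "0 \<in> J" "f \<in> J \<Longrightarrow> g \<in> J \<Longrightarrow> f + g \<in> J" "f \<in> J \<Longrightarrow> r * f \<in> J"
  "(\<And>x. x \<in> X \<Longrightarrow> h x \<in> J) \<Longrightarrow> sum h X \<in> J"
  unfolding J_eq by (rule ideal_gen_closed(2-5); assumption)+

lemma Ih_closed:
  "0 \<in> Ih i j" "f \<in> Ih i j \<Longrightarrow> g \<in> Ih i j \<Longrightarrow> f + g \<in> Ih i j"
  "(\<And>x. x \<in> X \<Longrightarrow> h x \<in> Ih i j) \<Longrightarrow> sum h X \<in> Ih i j"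
proof -
  show 0: "0 \<in> Ih i j" by (auto simp: Ih_iff R_comp_def)
  show add: "f + g \<in> Ih i j" if "f \<in> Ih i j" "g \<in> Ih i j" for f g
    using that Poly_Mapping.keys_add[of f g] unfolding Ih_iff R_comp_def by auto
  show "(\<And>x. x \<in> X \<Longrightarrow> h x \<in> Ih i j) \<Longrightarrow> sum h X \<in> Ih i j"
    by (induction X rule: infinite_finite_induct) (auto intro: 0 add)
qed

lemma Ih_mult_single:
  assumes "f \<in> Ih i j" "mdeg t + (i, j) = (i', j')"
  shows "Poly_Mapping.single t c * f \<in> Ih i' j'"
proof -
  have f: "f \<in> R_comp (i, j)" "\<forall>k<s. eval (\<lambda>x. a (k, x)) f = 0" using assms(1) by (simp_all add: Ih_iff)
  have "Poly_Mapping.single t c * f \<in> R_comp (i', j')"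
    using R_comp_mult_single[OF f(1), of t c] unfolding assms(2) .
  then show ?thesis using f(2) by (simp add: Ih_iff)
qed

text \<open>J is a bigraded ideal: its generators are bihomogeneous, and a multiple r f splits along
  the monomials of r, each of which shifts the bidegree.\<close>

lemma J_hcomp: "f \<in> J \<Longrightarrow> hcomp (i, j) f \<in> Ih i j"
proof -
  assume "f \<in> J"
  then have "\<forall>i j. hcomp (i, j) f \<in> Ih i j"
    unfolding J_eq
  proof (rule ideal_gen_induct)
    show "\<forall>i j. hcomp (i, j) 0 \<in> Ih i j" by (simp add: Ih_closed)
  next
    fix x assume "x \<in> (\<Union>i j. Ih i j)"
    then obtain i j where x: "x \<in> Ih i j" by blast
    then have "x \<in> R_comp (i, j)" by (simp add: Ih_iff)
    then show "\<forall>i j. hcomp (i, j) x \<in> Ih i j" using x by (auto simp: hcomp_R Ih_closed)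
  next
    fix f g :: "'k R" assume "\<forall>i j. hcomp (i, j) f \<in> Ih i j" "\<forall>i j. hcomp (i, j) g \<in> Ih i j"
    then show "\<forall>i j. hcomp (i, j) (f + g) \<in> Ih i j" by (simp add: hcomp_add Ih_closed)
  next
    fix r f :: "'k R" assume f: "\<forall>i j. hcomp (i, j) f \<in> Ih i j"
    show "\<forall>i j. hcomp (i, j) (r * f) \<in> Ih i j"
    proof (intro allI)
      fix i j
      have "hcomp (i, j) (Poly_Mapping.single t c * f) \<in> Ih i j" for t c
      proof (cases "mdeg t \<le> (i, j)")
        case True
        have "mdeg t + ((i, j) - mdeg t) = (i, j)" using True by (cases "mdeg t") auto
        then show ?thesis
          using True f by (cases "(i, j) - mdeg t") (auto simp: hcomp_single_mult intro: Ih_mult_single)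
      qed (simp add: hcomp_single_mult Ih_closed)
      then show "hcomp (i, j) (r * f) \<in> Ih i j"
        by (subst poly_mapping_as_sum[of r]) (auto simp: sum_distrib_right hcomp_sum intro: Ih_closed)
    qed
  qed
  then show ?thesis by blast
qed

lemma card_Z: "card Z = s" and dim_II_Z: "pp.dim (II A B Z) = A * B - s"
  using gen by (auto simp: general_points_def Z_def)

lemma generic: "generic_position s P"
proof -
  have "inj_on P {..<s}"
  proof (rule inj_onI)
    fix k l assume kl: "k \<in> {..<s}" "l \<in> {..<s}" "P k = P l"
    \<comment> \<open>Z has s elements, so the affine points are distinct, while equal projective
      points have equal ratios.\<close>
    have "inj_on (zpt a) {..<s}"
      using card_Z unfolding Z_def by (intro eq_card_imp_inj_on) auto
    moreover have "zpt a k = zpt a l"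
    proof -
      have "proj_rel (a (k, X10), a (k, X11)) (a (l, X10), a (l, X11))"
        "proj_rel (a (k, X20), a (k, X21)) (a (l, X20), a (l, X21))"
        using coords[of k] coords[of l] kl unfolding hcoords_def by (auto intro!: abs_proj1_eqD)
      then show ?thesis by (auto simp: proj_rel_def zpt_def)
    qed
    ultimately show "k = l" using kl by (auto dest: inj_onD)
  qed
  moreover have "has_dim_mod (R_comp (i, j)) J (min (N (i, j)) s)" for i j
  proof -
    have sub: "II (i + 1) (j + 1) Z \<subseteq> PP (i + 1) (j + 1)" by (auto simp: II_def)
    obtain B where B: "finite B" "card B = pp.dim (PP (i + 1) (j + 1) :: 'k poly2 set) - pp.dim (II (i + 1) (j + 1) Z)"
      "pp.dim (II (i + 1) (j + 1) Z) \<le> pp.dim (PP (i + 1) (j + 1) :: 'k poly2 set)"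
      "B \<subseteq> psi i j ` PP (i + 1) (j + 1)"
      "\<forall>f\<in>psi i j ` PP (i + 1) (j + 1). \<exists>c. f - (\<Sum>b\<in>B. const (c b) * b) \<in> psi i j ` II (i + 1) (j + 1) Z"
      "\<forall>c. (\<Sum>b\<in>B. const (c b) * b) \<in> psi i j ` II (i + 1) (j + 1) Z \<longrightarrow> (\<forall>b\<in>B. c b = 0)"
      using complement_basis_psi[OF subspace_PP order_refl subspace_II sub] .
    have BR: "B \<subseteq> R_comp (i, j)" using B(4) psi_in_R by blast
    \<comment> \<open>N - (N - s) with truncated subtraction is the minimum.\<close>
    have "card B = min (N (i, j)) s"
      unfolding B(2) dim_PP dim_II_Z N_def by (auto simp: min_def)
    moreover have "\<exists>c. f - (\<Sum>b\<in>B. const (c b) * b) \<in> J" if "f \<in> R_comp (i, j)" for f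
    proof -
      have "f \<in> psi i j ` PP (i + 1) (j + 1)" using psi_surj[OF that] by blast
      then show ?thesis using B(5) Ih_subset_J unfolding Ih_def by blast
    qed
    moreover have "\<forall>b\<in>B. c b = 0" if "(\<Sum>b\<in>B. const (c b) * b) \<in> J" for c
    proof -
      \<comment> \<open>The combination is bihomogeneous, so for it membership in J is membership in
        \<open>Ih i j\<close>.\<close>
      have "hcomp (i, j) (\<Sum>b\<in>B. const (c b) * b) = (\<Sum>b\<in>B. const (c b) * b)"
        using hcomp_R[OF R_comp_combination[OF BR]] by simp
      then have "(\<Sum>b\<in>B. const (c b) * b) \<in> Ih i j" using J_hcomp[OF that, of i j] by simp
      then show ?thesis using B(6) unfolding Ih_def by blast
    qed
    ultimately show ?thesis unfolding has_dim_mod_def using B(1) BR by blast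
  qed
  ultimately show ?thesis by (auto simp: generic_position_def J_def)
qed

text \<open>\<open>mJ\<close> is the product of the irrelevant ideal and \<open>J\<close>, described by its bihomogeneous components.\<close>

definition mJ where "mJ = {f. \<forall>i j. hcomp (i, j) f \<in> psi i j ` WW i j Z}"

lemma psi_WW_closed:
  "0 \<in> psi i j ` WW i j Z" "f \<in> psi i j ` WW i j Z \<Longrightarrow> g \<in> psi i j ` WW i j Z \<Longrightarrow> f + g \<in> psi i j ` WW i j Z"
  "f \<in> psi i j ` WW i j Z \<Longrightarrow> const c * f \<in> psi i j ` WW i j Z"
proof -
  show "0 \<in> psi i j ` WW i j Z"
    using pp.subspace_0[OF subspace_W(3)] by (intro image_eqI[of _ _ 0]) (simp_all add: homog_simps)
  show "f + g \<in> psi i j ` WW i j Z" if fg: "f \<in> psi i j ` WW i j Z" "g \<in> psi i j ` WW i j Z"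
  proof -
    obtain p q where pq: "p \<in> WW i j Z" "f = psi i j p" "q \<in> WW i j Z" "g = psi i j q" using fg by blast
    have "p + q \<in> WW i j Z" by (rule pp.subspace_add[OF subspace_W(3) pq(1,3)])
    then show ?thesis unfolding pq homog_simps(1)[symmetric] by (rule imageI)
  qed
  show "const c * f \<in> psi i j ` WW i j Z" if f: "f \<in> psi i j ` WW i j Z"
  proof -
    obtain p where p: "p \<in> WW i j Z" "f = psi i j p" using f by blast
    have "smult [:c:] p \<in> WW i j Z" by (rule pp.subspace_scale[OF subspace_W(3) p(1)])
    then show ?thesis unfolding p(2) homog_scale[symmetric] by (rule imageI)
  qed
qed

lemma subspace_mJ: "rr.subspace mJ"
  by (rule rr.subspaceI) (auto simp: mJ_def hcomp_add hcomp_const psi_WW_closed)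

lemma mdeg_var:
  "mdeg (Poly_Mapping.single X10 1) = (1, 0)" "mdeg (Poly_Mapping.single X11 1) = (1, 0)"
  "mdeg (Poly_Mapping.single X20 1) = (0, 1)" "mdeg (Poly_Mapping.single X21 1) = (0, 1)"
  by (simp_all add: mdeg_def lookup_single when_def)

lemma zero_in_II: "0 \<in> II A B Z"
  by (rule pp.subspace_0[OF subspace_II])

text \<open>Each of the four variables leads into one of the four summands f0, x f1, g0, y g1 of
  \<open>WW\<close>, the other three being zero.\<close>

lemma xvar_mult_mJ:
  assumes "h \<in> J"
  shows "xvar v * h \<in> mJ"
  unfolding mJ_def
proof (intro CollectI allI)
  fix i j
  have c: "hcomp (i, j) (xvar v * h) = (if mdeg (Poly_Mapping.single v 1) \<le> (i, j)
      then xvar v * hcomp ((i, j) - mdeg (Poly_Mapping.single v 1)) h else 0)"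
    unfolding xvar_def by (rule hcomp_single_mult)
  show "hcomp (i, j) (xvar v * h) \<in> psi i j ` WW i j Z"
  proof (cases "mdeg (Poly_Mapping.single v 1) \<le> (i, j)")
    case False
    then show ?thesis unfolding c by (simp add: psi_WW_closed)
  next
    case True
    have x: "\<exists>p. p \<in> II i (j + 1) Z \<and> hcomp (i - 1, j) h = psi (i - 1) j p" if "1 \<le> i"
      using J_hcomp[OF assms, of "i - 1" j] that by (auto simp: Ih_def)
    have y: "\<exists>p. p \<in> II (i + 1) j Z \<and> hcomp (i, j - 1) h = psi i (j - 1) p" if "1 \<le> j"
      using J_hcomp[OF assms, of i "j - 1"] that by (auto simp: Ih_def)
    show ?thesis
    proof (cases v)
      case X10
      then have i: "1 \<le> i" using True mdeg_var by auto
      then obtain p where p: "p \<in> II i (j + 1) Z" "hcomp (i - 1, j) h = psi (i - 1) j p" using x by blast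
      have "xvar X10 * psi (i - 1) j p = psi i j p"
        using xvar_psi(1)[of p "i - 1" "j + 1" j] p(1) i by (simp add: II_def)
      moreover have "p \<in> WW i j Z" using WW_memI[OF p(1) zero_in_II zero_in_II zero_in_II] by simp
      ultimately show ?thesis using c True p(2) unfolding X10 mdeg_var by simp
    next
      case X11
      then have i: "1 \<le> i" using True mdeg_var by auto
      then obtain p where p: "p \<in> II i (j + 1) Z" "hcomp (i - 1, j) h = psi (i - 1) j p" using x by blast
      have "xvar X11 * psi (i - 1) j p = psi i j (XX * p)"
        using xvar_psi(2)[of "i - 1" j p] i by simp
      moreover have "XX * p \<in> WW i j Z" using WW_memI[OF zero_in_II p(1) zero_in_II zero_in_II] by simp
      ultimately show ?thesis using c True p(2) unfolding X11 mdeg_var by simp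
    next
      case X20
      then have j: "1 \<le> j" using True mdeg_var by auto
      then obtain p where p: "p \<in> II (i + 1) j Z" "hcomp (i, j - 1) h = psi i (j - 1) p" using y by blast
      have "xvar X20 * psi i (j - 1) p = psi i j p"
        using xvar_psi(3)[of p "i + 1" "j - 1" i] p(1) j by (simp add: II_def)
      moreover have "p \<in> WW i j Z" using WW_memI[OF zero_in_II zero_in_II p(1) zero_in_II] by simp
      ultimately show ?thesis using c True p(2) unfolding X20 mdeg_var by simp
    next
      case X21
      then have j: "1 \<le> j" using True mdeg_var by auto
      then obtain p where p: "p \<in> II (i + 1) j Z" "hcomp (i, j - 1) h = psi i (j - 1) p" using y by blast
      have "xvar X21 * psi i (j - 1) p = psi i j (YY * p)"
        using xvar_psi(4)[of i "j - 1" p] j by simp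
      moreover have "YY * p \<in> WW i j Z" using WW_memI[OF zero_in_II zero_in_II zero_in_II p(1)] by simp
      ultimately show ?thesis using c True p(2) unfolding X21 mdeg_var by simp
    qed
  qed
qed

text \<open>A nonconstant monomial contains a variable; the rest of it is absorbed by the ideal
  J.\<close>

lemma single_mult_mJ:
  assumes "h \<in> J" "t \<noteq> 0"
  shows "Poly_Mapping.single t c * h \<in> mJ"
proof -
  have "\<exists>v. Poly_Mapping.lookup t v \<noteq> 0"
    using assms(2) by (metis lookup_zero poly_mapping_eqI)
  then obtain v where v: "Poly_Mapping.lookup t v \<noteq> 0" by blast
  define u where "u = t - Poly_Mapping.single v 1"
  have "t = Poly_Mapping.single v 1 + u"
    using v by (intro poly_mapping_eqI) (auto simp: u_def lookup_add lookup_minus lookup_single when_def)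
  then have "Poly_Mapping.single t c * h = xvar v * (Poly_Mapping.single u c * h)"
    by (simp add: xvar_def mult_single flip: mult.assoc)
  then show ?thesis by (simp only: xvar_mult_mJ J_closed(3)[OF assms(1)])
qed

text \<open>Modulo \<open>mJ\<close> a ring element acts on J through its constant term, so ideal
  generators of J span J modulo \<open>mJ\<close> over k.\<close>

lemma mult_minus_const_mJ:
  assumes "h \<in> J"
  shows "r * h - const (Poly_Mapping.lookup r 0) * h \<in> mJ"
proof -
  have "r = (\<Sum>t\<in>insert 0 (Poly_Mapping.keys r). Poly_Mapping.single t (Poly_Mapping.lookup r t))"
    by (subst poly_mapping_as_sum) (rule sum.mono_neutral_left, auto simp: in_keys_iff)
  also have "\<dots> = const (Poly_Mapping.lookup r 0) +
      (\<Sum>t\<in>Poly_Mapping.keys r - {0}. Poly_Mapping.single t (Poly_Mapping.lookup r t))"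
    by (subst sum.insert_remove) (auto simp: const_def)
  finally have eq: "r = const (Poly_Mapping.lookup r 0) +
      (\<Sum>t\<in>Poly_Mapping.keys r - {0}. Poly_Mapping.single t (Poly_Mapping.lookup r t))" .
  have "r * h - const (Poly_Mapping.lookup r 0) * h =
      (\<Sum>t\<in>Poly_Mapping.keys r - {0}. Poly_Mapping.single t (Poly_Mapping.lookup r t)) * h"
    using arg_cong[OF eq, of "\<lambda>x. x * h"] by (simp only: distrib_right add_diff_cancel_left')
  also have "\<dots> \<in> mJ"
    unfolding sum_distrib_right
    by (intro rr.subspace_sum[OF subspace_mJ] single_mult_mJ[OF assms]) auto
  finally show ?thesis .
qed

text \<open>The graded Nakayama argument: \<open>B\<close> collects complements of \<open>mJ\<close> in the components of \<open>J\<close>.\<close>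

lemma min_gens_J: "min_gens J = (\<Sum>j\<in>D s \<union> DD s. gens s j)"
proof -
  have "\<exists>B. finite B \<and> card B = gens s (i, j) \<and> B \<subseteq> Ih i j \<and>
    (\<forall>f\<in>Ih i j. \<exists>c. f - (\<Sum>b\<in>B. const (c b) * b) \<in> psi i j ` WW i j Z) \<and>
    (\<forall>c. (\<Sum>b\<in>B. const (c b) * b) \<in> psi i j ` WW i j Z \<longrightarrow> (\<forall>b\<in>B. c b = 0))" for i j
  proof -
    have sub: "II (i + 1) (j + 1) Z \<subseteq> PP (i + 1) (j + 1)" by (auto simp: II_def)
    obtain B where B: "finite B" "card B = pp.dim (II (i + 1) (j + 1) Z) - pp.dim (WW i j Z)"
      "pp.dim (WW i j Z) \<le> pp.dim (II (i + 1) (j + 1) Z)" "B \<subseteq> psi i j ` II (i + 1) (j + 1) Z"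
      "\<forall>f\<in>psi i j ` II (i + 1) (j + 1) Z. \<exists>c. f - (\<Sum>b\<in>B. const (c b) * b) \<in> psi i j ` WW i j Z"
      "\<forall>c. (\<Sum>b\<in>B. const (c b) * b) \<in> psi i j ` WW i j Z \<longrightarrow> (\<forall>b\<in>B. c b = 0)"
      using complement_basis_psi[OF subspace_II sub subspace_W(3) WW_subset_II] .
    moreover have "card B = gens s (i, j)"
      using B(2) dim_new_generators[OF gen, of i j] by (simp add: Z_def)
    ultimately show ?thesis unfolding Ih_def by blast
  qed
  then have "\<forall>d. \<exists>B. finite B \<and> card B = gens s d \<and> B \<subseteq> Ih (fst d) (snd d) \<and>
    (\<forall>f\<in>Ih (fst d) (snd d). \<exists>c. f - (\<Sum>b\<in>B. const (c b) * b) \<in> psi (fst d) (snd d) ` WW (fst d) (snd d) Z) \<and>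
    (\<forall>c. (\<Sum>b\<in>B. const (c b) * b) \<in> psi (fst d) (snd d) ` WW (fst d) (snd d) Z \<longrightarrow> (\<forall>b\<in>B. c b = 0))"
    by (simp only: prod.collapse split_paired_all split_paired_All fst_conv snd_conv simp_thms)
  from choice[OF this] obtain B where B': "\<forall>d. finite (B d) \<and> card (B d) = gens s d \<and> B d \<subseteq> Ih (fst d) (snd d) \<and>
    (\<forall>f\<in>Ih (fst d) (snd d). \<exists>c. f - (\<Sum>b\<in>B d. const (c b) * b) \<in> psi (fst d) (snd d) ` WW (fst d) (snd d) Z) \<and>
    (\<forall>c. (\<Sum>b\<in>B d. const (c b) * b) \<in> psi (fst d) (snd d) ` WW (fst d) (snd d) Z \<longrightarrow> (\<forall>b\<in>B d. c b = 0))" ..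
  have B: "finite (B d)" "card (B d) = gens s d" "B d \<subseteq> Ih (fst d) (snd d)"
    "f \<in> Ih (fst d) (snd d) \<Longrightarrow>
      \<exists>c. f - (\<Sum>b\<in>B d. const (c b) * b) \<in> psi (fst d) (snd d) ` WW (fst d) (snd d) Z"
    "(\<Sum>b\<in>B d. const (c b) * b) \<in> psi (fst d) (snd d) ` WW (fst d) (snd d) Z \<Longrightarrow> (\<forall>b\<in>B d. c b = 0)"
    for d f c
  proof -
    note q = B'[THEN spec, of d]
    show "finite (B d)" by (rule q[THEN conjunct1])
    show "card (B d) = gens s d" by (rule q[THEN conjunct2, THEN conjunct1])
    show "B d \<subseteq> Ih (fst d) (snd d)" by (rule q[THEN conjunct2, THEN conjunct2, THEN conjunct1])
    show "\<exists>c. f - (\<Sum>b\<in>B d. const (c b) * b) \<in> psi (fst d) (snd d) ` WW (fst d) (snd d) Z"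
      if "f \<in> Ih (fst d) (snd d)"
      by (rule q[THEN conjunct2, THEN conjunct2, THEN conjunct2, THEN conjunct1, THEN bspec, OF that])
    show "\<forall>b\<in>B d. c b = 0" if "(\<Sum>b\<in>B d. const (c b) * b) \<in> psi (fst d) (snd d) ` WW (fst d) (snd d) Z"
      by (rule q[THEN conjunct2, THEN conjunct2, THEN conjunct2, THEN conjunct2, THEN spec, THEN mp, OF that])
  qed
  define \<Gamma> where "\<Gamma> = D s \<union> DD s"
  define G where "G = (\<Union>d\<in>\<Gamma>. B d)"
  have fin\<Gamma>: "finite \<Gamma>" by (simp add: \<Gamma>_def finite_D finite_DD)
  have finG: "finite G" using fin\<Gamma> B(1) by (simp add: G_def)
  have BR: "B d \<subseteq> R_comp d" for d using B(3)[of d] Ih_iff[of _ "fst d" "snd d"] by auto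
  \<comment> \<open>A member 0 could carry any coefficient. Its absence makes the sets of different
    bidegrees disjoint, since a nonzero form has only one bidegree.\<close>
  have B0: "0 \<notin> B d" for d
  proof
    assume 0: "0 \<in> B d"
    have "(\<Sum>b\<in>B d. const (if b = 0 then 1 else 0) * b) = 0"
      by (intro sum.neutral) (auto simp: const_simps)
    then have "\<forall>b\<in>B d. (if b = 0 then 1 else 0 :: 'k) = 0"
      using B(5)[where d = d and c = "\<lambda>b. if b = 0 then 1 else 0"] psi_WW_closed(1) by simp
    then show False using 0 by auto
  qed
  have disj: "B d \<inter> B e = {}" if "d \<noteq> e" for d e
  proof -
    have "b = 0" if "b \<in> B d" "b \<in> B e" for b
      using hcomp_R[of b d d] hcomp_R[of b e d] BR that \<open>d \<noteq> e\<close> by (metis subsetD)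
    then show ?thesis using B0 by blast
  qed
  have cardG: "card G = (\<Sum>d\<in>\<Gamma>. gens s d)"
    unfolding G_def using fin\<Gamma> B(1,2) disj by (subst card_UN_disjoint) auto
  have "ideal_gen G = J"
  proof (rule subset_antisym)
    have "G \<subseteq> J" using B(3) Ih_subset_J unfolding G_def by blast
    show "ideal_gen G \<subseteq> J"
    proof
      fix f assume "f \<in> ideal_gen G"
      then show "f \<in> J"
        by (rule ideal_gen_induct) (use \<open>G \<subseteq> J\<close> J_closed in auto)
    qed
    \<comment> \<open>Induction on the total degree: up to a combination of \<open>B (i, j)\<close>,
      f comes from \<open>WW i j Z\<close>, which is built from components of total degree i + j -
      1.\<close>
    have Ih: "Ih i j \<subseteq> ideal_gen G" for i j
    proof (induction "i + j" arbitrary: i j rule: less_induct)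
      case less
      show ?case
      proof
        fix f assume "f \<in> Ih i j"
        then obtain c where "f - (\<Sum>b\<in>B (i, j). const (c b) * b) \<in> psi i j ` WW i j Z"
          using B(4)[of f "(i, j)"] by auto
        then obtain w where w: "w \<in> WW i j Z" "f - (\<Sum>b\<in>B (i, j). const (c b) * b) = psi i j w" by blast
        \<comment> \<open>Outside \<Gamma> the complement is empty because \<open>gens\<close> is 0
          there; hence finitely many bidegrees suffice.\<close>
        have "B (i, j) \<subseteq> G"
        proof (cases "(i, j) \<in> \<Gamma>")
          case False
          then have "card (B (i, j)) = 0" using B(2) gens_eq_0 by (simp add: \<Gamma>_def)
          then show ?thesis using B(1) by simp
        qed (auto simp: G_def)
        then have "(\<Sum>b\<in>B (i, j). const (c b) * b) \<in> ideal_gen G"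
          by (intro ideal_gen_closed(5) ideal_gen_closed(4) ideal_gen_closed(1)) auto
        moreover have "psi i j w \<in> ideal_gen G"
        proof -
          obtain f0 f1 g0 g1 where fg: "f0 \<in> II i (j + 1) Z" "f1 \<in> II i (j + 1) Z"
            "g0 \<in> II (i + 1) j Z" "g1 \<in> II (i + 1) j Z" "w = (f0 + XX * f1) + (g0 + YY * g1)"
            using WW_memE[OF w(1)] .
          have x: "psi i j p \<in> ideal_gen G \<and> psi i j (XX * p) \<in> ideal_gen G" if p: "p \<in> II i (j + 1) Z" for p
          proof (cases i)
            case 0
            then have "p = 0" using p by (simp add: II_def PP_0)
            then show ?thesis by (simp add: homog_simps ideal_gen_closed(2))
          next
            case (Suc i')
            have "psi i' j p \<in> ideal_gen G"
              using less[of i' j] p Suc by (auto simp: Ih_def)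
            moreover have "psi i j p = xvar X10 * psi i' j p" "psi i j (XX * p) = xvar X11 * psi i' j p"
              using xvar_psi(1)[of p i' "j + 1" j] xvar_psi(2)[of i' j p] p Suc by (simp_all add: II_def)
            ultimately show ?thesis by (simp add: ideal_gen_closed(4))
          qed
          have y: "psi i j p \<in> ideal_gen G \<and> psi i j (YY * p) \<in> ideal_gen G" if p: "p \<in> II (i + 1) j Z" for p
          proof (cases j)
            case 0
            then have "p = 0" using p by (simp add: II_def PP_0)
            then show ?thesis by (simp add: homog_simps ideal_gen_closed(2))
          next
            case (Suc j')
            have "psi i j' p \<in> ideal_gen G"
              using less[of i j'] p Suc by (auto simp: Ih_def)
            moreover have "psi i j p = xvar X20 * psi i j' p" "psi i j (YY * p) = xvar X21 * psi i j' p"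
              using xvar_psi(3)[of p "i + 1" j' i] xvar_psi(4)[of i j' p] p Suc by (simp_all add: II_def)
            ultimately show ?thesis by (simp add: ideal_gen_closed(4))
          qed
          show ?thesis
            unfolding fg(5) homog_simps using x[OF fg(1)] x[OF fg(2)] y[OF fg(3)] y[OF fg(4)]
            by (intro ideal_gen_closed(3)) auto
        qed
        ultimately have "psi i j w + (\<Sum>b\<in>B (i, j). const (c b) * b) \<in> ideal_gen G"
          by (intro ideal_gen_closed(3))
        then show "f \<in> ideal_gen G" by (simp add: w(2)[symmetric])
      qed
    qed
    show "J \<subseteq> ideal_gen G"
    proof
      fix f assume "f \<in> J"
      then show "f \<in> ideal_gen G"
        unfolding J_eq by (rule ideal_gen_induct) (use Ih ideal_gen_closed[where S = G] in auto)
    qed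
  qed
  \<comment> \<open>Minimality: a generating set spans J modulo \<open>mJ\<close> over k, while G is
    independent modulo \<open>mJ\<close>.\<close>
  moreover have "card G \<le> card G'" if G': "finite G'" "ideal_gen G' = J" for G'
  proof (rule rr.card_le_mod_span[OF subspace_mJ finG G'(1)])
    have mod: "f \<in> J \<and> (\<exists>g\<in>rr.span G'. f - g \<in> mJ)" if "f \<in> J" for f
      using that unfolding G'(2)[symmetric]
    proof (rule ideal_gen_induct)
      show "0 \<in> ideal_gen G' \<and> (\<exists>g\<in>rr.span G'. 0 - g \<in> mJ)"
        using rr.span_zero[of G'] rr.subspace_0[OF subspace_mJ] ideal_gen_closed(2) by force
      show "x \<in> ideal_gen G' \<and> (\<exists>g\<in>rr.span G'. x - g \<in> mJ)" if "x \<in> G'" for x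
        using rr.span_base[OF that] rr.subspace_0[OF subspace_mJ] ideal_gen_closed(1)[OF that]
        by (intro conjI bexI[of _ x]) auto
      show "f + h \<in> ideal_gen G' \<and> (\<exists>g\<in>rr.span G'. f + h - g \<in> mJ)"
        if fh: "f \<in> ideal_gen G' \<and> (\<exists>g\<in>rr.span G'. f - g \<in> mJ)"
          "h \<in> ideal_gen G' \<and> (\<exists>g\<in>rr.span G'. h - g \<in> mJ)" for f h
      proof -
        obtain g g' where g: "g \<in> rr.span G'" "f - g \<in> mJ" "g' \<in> rr.span G'" "h - g' \<in> mJ"
          using fh by blast
        have "(f - g) + (h - g') \<in> mJ" using rr.subspace_add[OF subspace_mJ g(2,4)] .
        then have "f + h - (g + g') \<in> mJ" by (simp add: algebra_simps)
        then show ?thesis using fh rr.span_add[OF g(1,3)] ideal_gen_closed(3) by blast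
      qed
      show "r * f \<in> ideal_gen G' \<and> (\<exists>g\<in>rr.span G'. r * f - g \<in> mJ)"
        if f: "f \<in> ideal_gen G' \<and> (\<exists>g\<in>rr.span G'. f - g \<in> mJ)" for r f
      proof -
        obtain g where g: "g \<in> rr.span G'" "f - g \<in> mJ" using f by blast
        let ?c = "Poly_Mapping.lookup r 0"
        have "f \<in> J" using f G'(2) by simp
        \<comment> \<open>Modulo \<open>mJ\<close>, r f is congruent to c f with c the constant term
          of r, and c f to c g.\<close>
        then have "(r * f - const ?c * f) + const ?c * (f - g) \<in> mJ"
          by (intro rr.subspace_add[OF subspace_mJ] mult_minus_const_mJ rr.subspace_scale[OF subspace_mJ g(2)])
        then have "r * f - const ?c * g \<in> mJ" by (simp add: right_diff_distrib)
        then show ?thesis using f rr.span_scale[OF g(1)] ideal_gen_closed(4) by blast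
      qed
    qed
    show "\<exists>g\<in>rr.span G'. b - g \<in> mJ" if "b \<in> G" for b
      using mod[of b] that B(3) Ih_subset_J unfolding G_def by blast
    fix c assume c: "(\<Sum>b\<in>G. const (c b) * b) \<in> mJ"
    show "\<forall>b\<in>G. c b = 0"
    proof
      fix b assume "b \<in> G"
      then obtain d where d: "d \<in> \<Gamma>" "b \<in> B d" by (auto simp: G_def)
      \<comment> \<open>Taking the component of bidegree d isolates the coefficients of
        \<open>B d\<close>, so independence is tested one bidegree at a time.\<close>
      have "hcomp d (\<Sum>b\<in>G. const (c b) * b) = (\<Sum>b\<in>G. if b \<in> B d then const (c b) * b else 0)"
        unfolding hcomp_sum hcomp_const
      proof (rule sum.cong[OF refl])
        fix b assume "b \<in> G"
        then obtain e where e: "b \<in> B e" by (auto simp: G_def)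
        then have "hcomp d b = (if e = d then b else 0)" using hcomp_R BR by blast
        moreover have "b \<in> B d \<longleftrightarrow> e = d" using e disj[of d e] by auto
        ultimately show "const (c b) * hcomp d b = (if b \<in> B d then const (c b) * b else 0)" by simp
      qed
      also have "\<dots> = (\<Sum>b\<in>{b \<in> G. b \<in> B d}. const (c b) * b)"
        by (rule sum.inter_filter[OF finG, symmetric])
      also have "{b \<in> G. b \<in> B d} = B d" using d(1) by (auto simp: G_def)
      finally have "(\<Sum>b\<in>B d. const (c b) * b) \<in> psi (fst d) (snd d) ` WW (fst d) (snd d) Z"
        using c unfolding mJ_def by (metis (mono_tags, lifting) mem_Collect_eq prod.collapse)
      then show "c b = 0" using B(5) d(2) by blast
    qed
  qed
  ultimately have "min_gens J = card G"
    unfolding min_gens_def using finG by (intro Least_equality) auto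
  then show ?thesis by (simp add: cardG \<Gamma>_def)
qed

end

theorem theorem5p4:
  fixes s :: nat
  assumes "s \<ge> 2"
  shows "\<exists>U :: (nat \<Rightarrow> 'k::{alg_closed_field, field_char_0} point) set.
    openin (zariski s) U \<and> U \<noteq> {} \<and>
    (\<forall>P\<in>U. generic_position s P \<and>
       int (min_gens (vanishing_ideal (P ` {..<s}))) = v11 s)"
proof -
  have s: "0 < s" using assms by simp
  obtain F :: "(nat \<times> var, 'k) mpoly" and d where F: "mhom s d F" "\<exists>a. affine_coords a \<and> eval a F \<noteq> 0"
    "\<forall>a. eval a F \<noteq> 0 \<longrightarrow> chart s a \<and> general_points s (zpt a ` {..<s})"
    using general_form[OF s, where ?'k = 'k] by blast
  define U where "U = tuples s - zero_locus s F"
  have "openin (zariski s) U"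
    unfolding zariski_def U_def
    by (rule topology_generated_by_Basis) (use mhom_imp_multiform[OF F(1)] in blast)
  moreover have "U \<noteq> {}"
  proof -
    obtain a where a: "affine_coords a" "eval a F \<noteq> 0" using F(2) by blast
    \<comment> \<open>Normalized coordinates are never (0, 0), so they are valid homogeneous
      coordinates of the witness.\<close>
    define P where "P = (\<lambda>k\<in>{..<s}. (abs_proj1 (a (k, X10), a (k, X11)), abs_proj1 (a (k, X20), a (k, X21))))"
    have "hcoords (\<lambda>x. a (k, x)) (P k)" if "k < s" for k
      using a(1) that by (simp add: hcoords_def P_def affine_coords_def)
    moreover have "eval (\<lambda>(j, x). a (j, x)) F \<noteq> 0" using a(2) by simp
    ultimately have "P \<notin> zero_locus s F" unfolding zero_locus_def
      by (auto intro!: exI[of _ "\<lambda>j x. a (j, x)"])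
    moreover have "P \<in> tuples s" by (simp add: tuples_def P_def)
    ultimately show ?thesis by (auto simp: U_def)
  qed
  moreover have "generic_position s P \<and> int (min_gens (vanishing_ideal (P ` {..<s}))) = v11 s"
    if PU: "P \<in> U" for P
  proof -
    \<comment> \<open>Lying off the zero locus provides one choice of coordinates at which F is
      nonzero; the locale is instantiated with it.\<close>
    obtain b where b: "\<forall>j<s. hcoords (b j) (P j)" "eval (\<lambda>(j, x). b j x) F \<noteq> 0"
      using PU unfolding U_def zero_locus_def by blast
    define a where "a = (\<lambda>(j, x). b j x)"
    have gen: "chart s a" "general_points s (zpt a ` {..<s})" using F(3) b(2) unfolding a_def by blast+
    interpret general_config s a P
    proof (unfold_locales, rule s, rule gen(1), rule gen(2))
      show "hcoords (\<lambda>x. a (k, x)) (P k)" if "k < s" for k using b(1) that by (simp add: a_def)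
    qed
    show ?thesis using generic min_gens_J v11_eq_sum_gens[of s] by (simp add: J_def)
  qed
  ultimately show ?thesis by blast
qed

end
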